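(* There exists an absolute constant $\epsilon_0>0$ such that for every constant $\epsilon$ with $0<\epsilon\le\epsilon_0$ there is a constant $K=K(\epsilon)>0$ for which the following holds. Let $p=\frac{1+\epsilon}{d}$, and let $R$ be a random subset of $V(Q^d)$ formed by including each vertex of the $d$-dimensional hypercube $Q^d$ independently with probability $p$. Then, with probability tending to $1$ as $d\to\infty$, all the connected components of the induced subgraph $Q^d[R]$ other than the giant (i.e. largest) component $L_1$ have at most $Kd$ vertices.
   Context: The $d$-dimensional hypercube $Q^d$ is the graph with vertex set $\{0,1\}^d$ in which two vertices are adjacent if and only if they differ in exactly one coordinate. $Q^d[R]$ denotes the subgraph of $Q^d$ induced by $R$. The size of a component is its number of vertices. The giant component $L_1$ is the largest connected component of $Q^d[R]$ (ties, if any, broken arbitrarily). *)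

theory Defs
  imports "HOL-Probability.Probability" "Graph_Theory.Graph_Theory"
begin

definition hypercube_verts :: "nat \<Rightarrow> (nat \<Rightarrow> nat) set" where
  "hypercube_verts d = {..<d} \<rightarrow>\<^sub>E {0, 1}"

text \<open>An undirected graph is a symmetric digraph, as in \<^locale>\<open>pair_graph\<close>.\<close>

definition hypercube :: "nat \<Rightarrow> (nat \<Rightarrow> nat) pair_pre_digraph" where
  "hypercube d =
     \<lparr> pverts = hypercube_verts d,
       parcs = {(u, v). u \<in> hypercube_verts d \<and> v \<in> hypercube_verts d \<and>
                        card {i. i < d \<and> u i \<noteq> v i} = 1} \<rparr>"

lemma finite_hypercube_verts: "finite (hypercube_verts d)"
  by (simp add: hypercube_verts_def finite_PiE)

lemma pair_graph_hypercube: "pair_graph (hypercube d)"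
proof
  have "parcs (hypercube d) \<subseteq> hypercube_verts d \<times> hypercube_verts d"
    by (auto simp: hypercube_def)
  then show "finite (parcs (hypercube d))"
    by (rule finite_subset) (simp add: finite_hypercube_verts)
  show "symmetric (with_proj (hypercube d))"
    unfolding symmetric_def with_proj_simps
    by (rule symI) (simp add: hypercube_def eq_commute)
qed (auto simp: hypercube_def finite_hypercube_verts)

text \<open>On the symmetric digraphs considered here, the strongly connected components
  are exactly the connected components of the undirected graph.\<close>

definition graph_components :: "('a, 'b) pre_digraph \<Rightarrow> 'a set set" where
  "graph_components G = pre_digraph.sccs_verts G"

definition largest_component :: "('a, 'b) pre_digraph \<Rightarrow> 'a set \<Rightarrow> bool" where
  "largest_component G L \<longleftrightarrow> is_arg_max card (\<lambda>C. C \<in> graph_components G) L"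

text \<open>\<^const>\<open>bernoulli_pmf\<close> truncates its parameter to the interval from 0 to 1.\<close>

definition random_subset :: "'a set \<Rightarrow> real \<Rightarrow> 'a set pmf" where
  "random_subset V p =
     map_pmf (\<lambda>f. {v \<in> V. f v}) (Pi_pmf V False (\<lambda>_. bernoulli_pmf p))"

end

theory Submission
  imports Defs "HOL-Real_Asymp.Real_Asymp"
begin

text \<open>Write \<open>R = R\<^sub>1 \<union> R\<^sub>2\<close> with independent \<open>R\<^sub>1\<close>, \<open>R\<^sub>2\<close> of densities \<open>(1 + \<epsilon>/2)/d\<close> and about
  \<open>\<epsilon>/(2d)\<close>. Any \<open>m\<close> vertices are distinguished by at most \<open>m\<close> coordinates, so the neighbours of
  \<open>\<gamma>d\<close> given vertices contain \<open>\<Omega>(d\<^sup>2)\<close> vertices lying in pairwise disjoint subcubes of dimension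
  \<open>(1 - O(\<gamma>))d\<close>, where percolation is still supercritical and independent. Iterating this, a vertex
  has a cluster of size \<open>\<Omega>(d\<^sup>j)\<close> with probability bounded below, for each fixed \<open>j\<close>. Applied to
  \<open>R\<^sub>1\<close>, the same device shows, with failure probability \<open>exp(-\<Omega>(d\<^sup>2))\<close> and hence simultaneously for all
  connected sets \<open>S\<close> of about \<open>Kd\<close> vertices of the cube, that \<open>\<Omega>(Kd\<^sup>2)\<close> neighbours of \<open>S\<close> are adjacent to
  large clusters of \<open>R\<^sub>1\<close>; this uses that \<open>S\<close> has \<open>\<Omega>(Kd\<^sup>2)\<close> neighbours. Now reveal \<open>R\<^sub>2\<close> first
  off the set \<open>B\<close> of vertices adjacent to large clusters. A component of more than \<open>Kd\<close> vertices that
  misses the large clusters has \<open>\<Omega>(Kd\<^sup>2)\<close> neighbours in \<open>B\<close>, all of which must avoid \<open>R\<^sub>2\<close>; for large \<open>K\<close>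
  this has probability below \<open>e\<^sup>-\<^sup>d\<close>, which beats the \<open>2\<^sup>d\<close> possible components. Finally all large
  clusters of \<open>R\<^sub>1\<close> are joined by \<open>R\<^sub>2\<close>: every vertex is within distance 3 of a large cluster, so by
  isoperimetry each bipartition of the large clusters is crossed by many disjoint short paths.\<close>

section \<open>Expectations over random subsets\<close>

text \<open>Connected sets and components cannot be treated alike. Per root there are up to exp(O(d
  log d)) connected sets of Kd vertices. A failure probability exp(-\<Omega>(d^2)) in
  \<open>R\<^sub>1\<close> survives a union bound over all of them, but a second-round failure
  exp(-\<Omega>(Kd)) does not, however large K is. This dictates the order of exposure: once
  \<open>R\<^sub>2\<close> is known off \<open>B\<close>, the component of a given root is
  determined, only the root is left to choose, and \<open>R\<^sub>2\<close> inside \<open>B\<close>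
  is still fresh. Clusters of polynomial size are large enough. The exponent only has to outweigh
  the polynomial losses of merging, namely the probability of a path of up to 8 vertices and the
  thinning that makes the paths disjoint; what remains, exp(-\<Omega>(d^2)) per cluster, beats the
  at most 2^d large clusters. Probabilities are weighted sums over the subsets of a finite set, so
  exposing the vertices in portions is a rewriting of sums. Statements about cubes are made for
  arbitrary sets of directions, so that they apply to subcubes with the same p.\<close>

definition expect :: "'a set \<Rightarrow> real \<Rightarrow> ('a set \<Rightarrow> real) \<Rightarrow> real" where
  "expect V p f = (\<Sum>R\<in>Pow V. p ^ card R * (1 - p) ^ card (V - R) * f R)"

definition sprob :: "'a set \<Rightarrow> real \<Rightarrow> ('a set \<Rightarrow> bool) \<Rightarrow> real" where
  "sprob V p Q = expect V p (\<lambda>R. of_bool (Q R))"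

lemma expect_empty [simp]: "expect {} p f = f {}"
  by (simp add: expect_def)

lemma expect_insert:
  assumes "finite V" "a \<notin> V"
  shows "expect (insert a V) p f =
    p * expect V p (\<lambda>R. f (insert a R)) + (1 - p) * expect V p f"
proof -
  let ?w = "\<lambda>R. p ^ card R * (1 - p) ^ card (insert a V - R) * f R"
  have disj: "Pow V \<inter> insert a ` Pow V = {}"
    using assms by auto
  have inj: "inj_on (insert a) (Pow V)"
    using assms by (auto simp: inj_on_def)
  have "expect (insert a V) p f = sum ?w (Pow V) + sum ?w (insert a ` Pow V)"
    unfolding expect_def Pow_insert
    by (rule sum.union_disjoint) (use assms disj in auto)
  also have "sum ?w (Pow V) = (1 - p) * expect V p f"
    unfolding expect_def sum_distrib_left
  proof (rule sum.cong)
    fix R assume "R \<in> Pow V"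
    then have "insert a V - R = insert a (V - R)" "a \<notin> V - R" "finite (V - R)"
      using assms by auto
    then show "?w R = (1 - p) * (p ^ card R * (1 - p) ^ card (V - R) * f R)"
      by simp
  qed simp
  also have "sum ?w (insert a ` Pow V) = p * expect V p (\<lambda>R. f (insert a R))"
    unfolding expect_def sum_distrib_left sum.reindex[OF inj]
  proof (rule sum.cong)
    fix R assume "R \<in> Pow V"
    then have "insert a V - insert a R = V - R" "a \<notin> R" "finite R"
      using assms by (auto intro: finite_subset)
    then show "(?w \<circ> insert a) R =
        p * (p ^ card R * (1 - p) ^ card (V - R) * f (insert a R))"
      by simp
  qed simp
  finally show ?thesis by simp
qed

lemma expect_const: "finite V \<Longrightarrow> expect V p (\<lambda>_. c) = c"
  by (induction V rule: finite_induct) (auto simp: expect_insert algebra_simps)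

lemma expect_cong:
  "(\<And>R. R \<subseteq> V \<Longrightarrow> f R = g R) \<Longrightarrow> expect V p f = expect V p g"
  unfolding expect_def by (rule sum.cong) auto

lemma expect_mono:
  assumes "0 \<le> p" "p \<le> 1" "\<And>R. R \<subseteq> V \<Longrightarrow> f R \<le> g R"
  shows "expect V p f \<le> expect V p g"
  unfolding expect_def using assms by (intro sum_mono mult_left_mono) auto

lemma expect_add: "expect V p (\<lambda>R. f R + g R) = expect V p f + expect V p g"
  by (simp add: expect_def sum.distrib algebra_simps)

lemma expect_cmult: "expect V p (\<lambda>R. c * f R) = c * expect V p f"
  by (simp add: expect_def sum_distrib_left algebra_simps)

lemma expect_sum: "expect V p (\<lambda>R. \<Sum>i\<in>I. f i R) = (\<Sum>i\<in>I. expect V p (f i))"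
  unfolding expect_def sum_distrib_left by (rule sum.swap)

lemma expect_nonneg:
  assumes "0 \<le> p" "p \<le> 1" "\<And>R. R \<subseteq> V \<Longrightarrow> 0 \<le> f R"
  shows "0 \<le> expect V p f"
  unfolding expect_def using assms by (intro sum_nonneg mult_nonneg_nonneg) auto

lemma expect_union:
  assumes "finite A" "finite B" "A \<inter> B = {}"
  shows "expect (A \<union> B) p f = expect A p (\<lambda>X. expect B p (\<lambda>Y. f (X \<union> Y)))"
  using assms
proof (induction A arbitrary: f rule: finite_induct)
  case (insert a A)
  then have "expect (insert a A \<union> B) p f = p * expect (A \<union> B) p (\<lambda>R. f (insert a R))
      + (1 - p) * expect (A \<union> B) p f"
    by (simp add: expect_insert)
  then show ?case
    using insert by (simp add: expect_insert)
qed simp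

lemma expect_split:
  assumes "finite V" "A \<subseteq> V"
  shows "expect V p f = expect A p (\<lambda>X. expect (V - A) p (\<lambda>Y. f (X \<union> Y)))"
proof -
  have V: "V = A \<union> (V - A)" using assms by auto
  have "finite A" using assms by (rule finite_subset[rotated])
  then have "expect (A \<union> (V - A)) p f =
      expect A p (\<lambda>X. expect (V - A) p (\<lambda>Y. f (X \<union> Y)))"
    using assms by (intro expect_union) auto
  then show ?thesis using V by simp
qed

lemma expect_restrict:
  assumes "finite V" "A \<subseteq> V"
  shows "expect V p (\<lambda>R. f (R \<inter> A)) = expect A p f"
proof -
  have fin: "finite (V - A)" using assms by auto
  show ?thesis
    unfolding expect_split[OF assms]
  proof (rule expect_cong)
    fix X assume X: "X \<subseteq> A"
    have "expect (V - A) p (\<lambda>Y. f ((X \<union> Y) \<inter> A)) = expect (V - A) p (\<lambda>_. f X)"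
      using X by (intro expect_cong arg_cong[of _ _ f]) blast
    then show "expect (V - A) p (\<lambda>Y. f ((X \<union> Y) \<inter> A)) = f X"
      using fin by (simp add: expect_const)
  qed
qed

text \<open>A vertex avoids both rounds with probability 1 - (p + q - p q), the product of 1 - p and
  1 - q. This identity is what sprinkling rests on.\<close>

lemma expect_two_rounds:
  assumes "finite V"
  shows "expect V (p + q - p * q) f = expect V p (\<lambda>X. expect V q (\<lambda>Y. f (X \<union> Y)))"
  using assms
proof (induction V arbitrary: f rule: finite_induct)
  case (insert a V)
  have "expect (insert a V) p (\<lambda>X. expect (insert a V) q (\<lambda>Y. f (X \<union> Y))) =
     p * expect V p (\<lambda>X. q * expect V q (\<lambda>Y. f (insert a (X \<union> Y)))
        + (1 - q) * expect V q (\<lambda>Y. f (insert a (X \<union> Y))))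
     + (1 - p) * expect V p (\<lambda>X. q * expect V q (\<lambda>Y. f (insert a (X \<union> Y)))
        + (1 - q) * expect V q (\<lambda>Y. f (X \<union> Y)))"
    using insert by (simp add: expect_insert)
  also have "\<dots> = (p + q - p * q) * expect V (p + q - p * q) (\<lambda>R. f (insert a R))
      + (1 - (p + q - p * q)) * expect V (p + q - p * q) f"
    unfolding expect_add expect_cmult insert.IH by (simp add: algebra_simps)
  finally show ?case using insert by (simp add: expect_insert)
qed simp

lemma expect_power_card:
  assumes "finite V"
  shows "expect V p (\<lambda>R. l ^ card R) = (1 - p * (1 - l)) ^ card V"
  using assms
proof (induction V rule: finite_induct)
  case (insert a V)
  have "expect V p (\<lambda>R. l ^ card (insert a R)) = expect V p (\<lambda>R. l * l ^ card R)"
  proof (rule expect_cong)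
    fix R assume "R \<subseteq> V"
    then have "finite R" "a \<notin> R" using insert by (auto intro: finite_subset)
    then show "l ^ card (insert a R) = l * l ^ card R" by simp
  qed
  then show ?case
    using insert by (simp add: expect_insert expect_cmult algebra_simps)
qed simp

lemma sprob_nonneg: "0 \<le> p \<Longrightarrow> p \<le> 1 \<Longrightarrow> 0 \<le> sprob V p Q"
  unfolding sprob_def by (rule expect_nonneg) auto

lemma sprob_mono:
  assumes "0 \<le> p" "p \<le> 1" "\<And>R. R \<subseteq> V \<Longrightarrow> Q R \<Longrightarrow> Q' R"
  shows "sprob V p Q \<le> sprob V p Q'"
  unfolding sprob_def using assms by (intro expect_mono) auto

lemma sprob_cong:
  assumes "\<And>R. R \<subseteq> V \<Longrightarrow> Q R \<longleftrightarrow> Q' R"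
  shows "sprob V p Q = sprob V p Q'"
  unfolding sprob_def using assms by (intro expect_cong) auto

lemma sprob_le_1:
  assumes "0 \<le> p" "p \<le> 1" "finite V"
  shows "sprob V p Q \<le> 1"
proof -
  have "sprob V p Q \<le> expect V p (\<lambda>_. 1)"
    unfolding sprob_def using assms by (intro expect_mono) auto
  then show ?thesis using assms by (simp add: expect_const)
qed

lemma sprob_not:
  assumes "finite V"
  shows "sprob V p (\<lambda>R. \<not> Q R) = 1 - sprob V p Q"
proof -
  have "sprob V p Q + sprob V p (\<lambda>R. \<not> Q R) = expect V p (\<lambda>_. 1)"
    unfolding sprob_def expect_add[symmetric] by (rule expect_cong) auto
  then show ?thesis using assms by (simp add: expect_const)
qed

lemma sprob_disj:
  assumes "0 \<le> p" "p \<le> 1"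
  shows "sprob V p (\<lambda>R. Q R \<or> Q' R) \<le> sprob V p Q + sprob V p Q'"
  unfolding sprob_def expect_add[symmetric] using assms by (intro expect_mono) auto

lemma sprob_UN:
  assumes "0 \<le> p" "p \<le> 1" "finite I"
  shows "sprob V p (\<lambda>R. \<exists>i\<in>I. Q i R) \<le> (\<Sum>i\<in>I. sprob V p (Q i))"
  unfolding sprob_def expect_sum[symmetric]
proof (rule expect_mono)
  fix R
  show "of_bool (\<exists>i\<in>I. Q i R) \<le> (\<Sum>i\<in>I. of_bool (Q i R) :: real)"
  proof (cases "\<exists>i\<in>I. Q i R")
    case True
    then obtain i where i: "i \<in> I" "Q i R" by auto
    have "of_bool (Q i R) \<le> (\<Sum>i\<in>I. of_bool (Q i R) :: real)"
      by (rule member_le_sum) (use i assms in auto)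
    then show ?thesis using True i by simp
  qed (auto intro: sum_nonneg)
qed (use assms in auto)

lemma sprob_UN_le:
  assumes "0 \<le> p" "p \<le> 1" "finite I" "\<And>i. i \<in> I \<Longrightarrow> sprob V p (Q i) \<le> c"
  shows "sprob V p (\<lambda>R. \<exists>i\<in>I. Q i R) \<le> real (card I) * c"
proof -
  have "(\<Sum>i\<in>I. sprob V p (Q i)) \<le> (\<Sum>i\<in>I. c)"
    by (rule sum_mono) (use assms in auto)
  then show ?thesis using sprob_UN[OF assms(1-3), of V Q] by simp
qed

lemma sprob_restrict:
  assumes "finite V" "A \<subseteq> V"
  shows "sprob V p (\<lambda>R. Q (R \<inter> A)) = sprob A p Q"
  unfolding sprob_def by (rule expect_restrict[OF assms])

lemma sprob_split:
  assumes "finite V" "A \<subseteq> V"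
  shows "sprob V p Q = expect A p (\<lambda>X. sprob (V - A) p (\<lambda>Y. Q (X \<union> Y)))"
  unfolding sprob_def by (rule expect_split[OF assms])

lemma sprob_disjoint:
  assumes "finite V" "F \<subseteq> V"
  shows "sprob V p (\<lambda>R. R \<inter> F = {}) = (1 - p) ^ card F"
proof -
  have "finite F" using assms finite_subset by auto
  have "sprob V p (\<lambda>R. R \<inter> F = {}) = sprob F p (\<lambda>R. R = {})"
    using sprob_restrict[OF assms, where Q="\<lambda>R. R = {}"] by simp
  \<comment> \<open>As \<open>0 ^ 0 = 1\<close>, the power \<open>0 ^ card R\<close> is the
    indicator of \<open>R = {}\<close>, so the generating function of the size can be evaluated at
    0.\<close>
  also have "\<dots> = expect F p (\<lambda>R. 0 ^ card R)"
    unfolding sprob_def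
  proof (rule expect_cong)
    fix R assume "R \<subseteq> F"
    then have "finite R" using \<open>finite F\<close> finite_subset by auto
    then show "of_bool (R = {}) = (0::real) ^ card R"
      by (auto simp: card_gt_0_iff)
  qed
  also have "\<dots> = (1 - p) ^ card F" using \<open>finite F\<close> by (simp add: expect_power_card)
  finally show ?thesis .
qed

lemma sprob_superset:
  assumes "finite V" "F \<subseteq> V"
  shows "sprob V p (\<lambda>R. F \<subseteq> R) = p ^ card F"
proof -
  have "finite F" using assms finite_subset by auto
  have "F \<subseteq> R \<longleftrightarrow> F \<subseteq> R \<inter> F" for R by auto
  then have "sprob V p (\<lambda>R. F \<subseteq> R) = sprob F p (\<lambda>R. F \<subseteq> R)"
    using sprob_restrict[OF assms, where Q="\<lambda>R. F \<subseteq> R"] by simp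
  also have "\<dots> = (\<Sum>R\<in>{F}. p ^ card R * (1 - p) ^ card (F - R) * of_bool (F \<subseteq> R))"
    unfolding sprob_def expect_def
    by (rule sum.mono_neutral_right) (use \<open>finite F\<close> in auto)
  also have "\<dots> = p ^ card F" by simp
  finally show ?thesis .
qed

section \<open>Independent trials on disjoint sets of vertices\<close>

lemma expect_power_successes:
  assumes "finite V" "finite U" "0 \<le> p" "p \<le> 1" "0 \<le> l" "l \<le> 1"
    and "\<And>u. u \<in> U \<Longrightarrow> Q u \<subseteq> V" "disjoint_family_on Q U"
    and "\<And>u. u \<in> U \<Longrightarrow> c \<le> sprob (Q u) p (S u)" "0 \<le> c" "c \<le> 1"
  shows "expect V p (\<lambda>R. l ^ card {u\<in>U. S u (R \<inter> Q u)}) \<le> (1 - c * (1 - l)) ^ card U"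
  using assms(2,1,3-)
proof (induction U arbitrary: V rule: finite_induct)
  case empty
  then show ?case by (simp add: expect_const)
next
  case (insert a U)
  \<comment> \<open>\<open>Q a\<close> is exposed separately from \<open>V - Q a\<close>, which
    contains every other \<open>Q u\<close>; the trial at \<open>a\<close> therefore contributes an
    independent factor.\<close>
  have QV: "Q a \<subseteq> V" and finQ: "finite (Q a)" and fin: "finite (V - Q a)"
    using insert.prems finite_subset[of "Q a" V] by auto
  have disj: "Q u \<inter> Q a = {}" if "u \<in> U" for u
    using insert.prems(7) insert.hyps that by (auto simp: disjoint_family_on_def)
  let ?N = "\<lambda>R. card {u\<in>U. S u (R \<inter> Q u)}"
  have IH: "expect (V - Q a) p (\<lambda>R. l ^ ?N R) \<le> (1 - c * (1 - l)) ^ card U"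
  proof (rule insert.IH)
    show "disjoint_family_on Q U"
      using insert.prems(7) by (auto simp: disjoint_family_on_def)
    show "\<And>u. u \<in> U \<Longrightarrow> Q u \<subseteq> V - Q a"
      using insert.prems(6) disj by fast
  qed (use insert.prems fin in auto)
  have split: "l ^ card {u\<in>insert a U. S u ((X \<union> Y) \<inter> Q u)} =
      (if S a X then l else 1) * l ^ ?N Y" if "X \<subseteq> Q a" "Y \<subseteq> V - Q a" for X Y
  proof -
    have 1: "(X \<union> Y) \<inter> Q a = X" using that by auto
    have 2: "(X \<union> Y) \<inter> Q u = Y \<inter> Q u" if "u \<in> U" for u
      using disj[OF that] \<open>X \<subseteq> Q a\<close> by auto
    have "{u\<in>insert a U. S u ((X \<union> Y) \<inter> Q u)} =
        (if S a X then insert a {u\<in>U. S u (Y \<inter> Q u)} else {u\<in>U. S u (Y \<inter> Q u)})"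
      using 1 2 by auto
    then show ?thesis using insert.hyps by auto
  qed
  have "expect V p (\<lambda>R. l ^ card {u\<in>insert a U. S u (R \<inter> Q u)}) =
      expect (Q a) p (\<lambda>X. expect (V - Q a) p (\<lambda>Y. (if S a X then l else 1) * l ^ ?N Y))"
    unfolding expect_split[OF insert.prems(1) QV]
    by (intro expect_cong split)
  also have "\<dots> = expect (Q a) p (\<lambda>X. expect (V - Q a) p (\<lambda>R. l ^ ?N R) *
      (1 + (l - 1) * of_bool (S a X)))"
    by (intro expect_cong) (simp add: expect_cmult)
  also have "\<dots> = expect (V - Q a) p (\<lambda>R. l ^ ?N R) * (1 + (l - 1) * sprob (Q a) p (S a))"
    unfolding expect_cmult expect_add sprob_def using finQ by (simp add: expect_const)
  also have "\<dots> \<le> (1 - c * (1 - l)) ^ card U * (1 - c * (1 - l))"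
  proof (rule mult_mono[OF IH])
    have "(1 - l) * c \<le> (1 - l) * sprob (Q a) p (S a)"
      by (rule mult_left_mono) (use insert.prems in auto)
    then show "1 + (l - 1) * sprob (Q a) p (S a) \<le> 1 - c * (1 - l)"
      by (simp add: algebra_simps)
    have "c * (1 - l) \<le> 1 * 1" by (rule mult_mono) (use insert.prems in auto)
    then show "0 \<le> (1 - c * (1 - l)) ^ card U" by simp
    have "(1 - l) * sprob (Q a) p (S a) \<le> 1 * 1"
      by (rule mult_mono) (use insert.prems finQ sprob_le_1 sprob_nonneg in auto)
    then show "0 \<le> 1 + (l - 1) * sprob (Q a) p (S a)" by (simp add: algebra_simps)
  qed
  finally show ?case using insert.hyps by (simp add: algebra_simps)
qed

text \<open>Markov's inequality for 2^(-N), with N the number of successes: the threshold costs at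
  most exp(c |U| / 4), while each trial contributes a factor 1 - c/2 \<le> exp(-c/2).\<close>

lemma few_successes:
  assumes "finite V" "finite U" "0 \<le> p" "p \<le> 1"
    and "\<And>u. u \<in> U \<Longrightarrow> Q u \<subseteq> V" "disjoint_family_on Q U"
    and "\<And>u. u \<in> U \<Longrightarrow> c \<le> sprob (Q u) p (S u)" "0 \<le> c" "c \<le> 1"
  shows "sprob V p (\<lambda>R. real (card {u\<in>U. S u (R \<inter> Q u)}) < c * card U / 4)
      \<le> exp (- c * card U / 4)"
proof -
  let ?N = "\<lambda>R. card {u\<in>U. S u (R \<inter> Q u)}"
  let ?x = "c * card U / 4"
  have pos: "0 \<le> (2::real) powr ?x" by simp
  have "sprob V p (\<lambda>R. real (?N R) < ?x) \<le> expect V p (\<lambda>R. 2 powr ?x * (1/2) ^ ?N R)"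
    unfolding sprob_def
  proof (rule expect_mono)
    fix R
    show "of_bool (real (?N R) < ?x) \<le> 2 powr ?x * (1/2) ^ ?N R"
    proof (cases "real (?N R) < ?x")
      case True
      then have "2 powr real (?N R) \<le> 2 powr ?x" by (intro powr_mono) auto
      then have "(2::real) ^ ?N R \<le> 2 powr ?x" by (simp add: powr_realpow)
      then show ?thesis using True by (simp add: power_divide field_simps)
    qed auto
  qed (use assms in auto)
  also have "\<dots> = 2 powr ?x * expect V p (\<lambda>R. (1/2) ^ ?N R)"
    by (rule expect_cmult)
  also have "\<dots> \<le> 2 powr ?x * (1 - c * (1 - 1/2)) ^ card U"
    by (intro mult_left_mono expect_power_successes pos) (use assms in auto)
  also have "\<dots> \<le> exp ?x * exp (- c * card U / 2)"
  proof (rule mult_mono)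
    have "ln 2 * ?x \<le> 1 * ?x"
      using assms ln_2_less_1 by (intro mult_right_mono) auto
    then show "2 powr ?x \<le> exp ?x" by (simp add: powr_def mult.commute)
    have "(1 - c * (1 - 1/2)) ^ card U \<le> exp (- c/2) ^ card U"
      using exp_ge_add_one_self[of "- c/2"] assms by (intro power_mono) auto
    also have "\<dots> = exp (- c * card U / 2)"
      by (simp add: exp_of_nat_mult[symmetric] algebra_simps)
    finally show "(1 - c * (1 - 1/2)) ^ card U \<le> exp (- c * card U / 2)" .
  qed (use assms in auto)
  also have "\<dots> = exp (- c * card U / 4)"
    unfolding exp_add[symmetric] by (rule arg_cong[of _ _ exp]) auto
  finally show ?thesis .
qed

text \<open>The generating function at 0, where \<open>0 ^ N\<close> indicates that nothing
  succeeds; this saves the factor 1/4 in the exponent.\<close>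

lemma no_success:
  assumes "finite V" "finite U" "0 \<le> p" "p \<le> 1"
    and "\<And>u. u \<in> U \<Longrightarrow> Q u \<subseteq> V" "disjoint_family_on Q U"
    and "\<And>u. u \<in> U \<Longrightarrow> c \<le> sprob (Q u) p (S u)" "0 \<le> c" "c \<le> 1"
  shows "sprob V p (\<lambda>R. \<forall>u\<in>U. \<not> S u (R \<inter> Q u)) \<le> exp (- c * card U)"
proof -
  let ?N = "\<lambda>R. card {u\<in>U. S u (R \<inter> Q u)}"
  have "sprob V p (\<lambda>R. \<forall>u\<in>U. \<not> S u (R \<inter> Q u)) \<le> expect V p (\<lambda>R. 0 ^ ?N R)"
    unfolding sprob_def using assms by (intro expect_mono) (auto simp: power_0_left)
  also have "\<dots> \<le> (1 - c * (1 - 0)) ^ card U"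
    by (intro expect_power_successes) (use assms in auto)
  also have "\<dots> \<le> exp (- c) ^ card U"
    using exp_ge_add_one_self[of "- c"] assms by (intro power_mono) auto
  also have "\<dots> = exp (- c * card U)"
    by (simp add: exp_of_nat_mult[symmetric] algebra_simps)
  finally show ?thesis .
qed

lemma expect_bij:
  assumes "inj_on h V" "finite V"
  shows "expect (h ` V) p f = expect V p (\<lambda>R. f (h ` R))"
  using assms(2,1)
proof (induction V arbitrary: f rule: finite_induct)
  case (insert a V)
  then show ?case by (simp add: expect_insert)
qed simp

section \<open>The cube and its clusters\<close>

text \<open>Vertices are the sets of coordinates equal to 1, and a subcube is given by a base point
  and its free directions, so that a face of a face needs no renumbering.\<close>

definition flip :: "nat \<Rightarrow> nat set \<Rightarrow> nat set" where
  "flip i x = {k. (k \<in> x) \<noteq> (k = i)}"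

definition cube :: "nat set \<Rightarrow> nat set \<Rightarrow> nat set set" where
  "cube v J = {w. w - J = v - J}"

definition adj :: "nat set \<Rightarrow> nat set \<Rightarrow> bool" where
  "adj x y \<longleftrightarrow> (\<exists>i. y = flip i x)"

text \<open>The root \<open>x\<close> belongs to its cluster even if \<open>x \<notin> R\<close>, so for a vertex \<open>x\<close> of the cube
  \<open>x \<in> R\<close> and every event about \<open>cluster R x\<close> are independent.\<close>

definition cluster :: "nat set set \<Rightarrow> nat set \<Rightarrow> nat set set" where
  "cluster R x = {y. (\<lambda>a b. adj a b \<and> b \<in> R)\<^sup>*\<^sup>* x y}"

definition large :: "nat set set \<Rightarrow> real \<Rightarrow> nat set set" where
  "large R s = {w \<in> R. s \<le> real (card (cluster R w))}"

lemma mem_flip: "k \<in> flip i x \<longleftrightarrow> (k \<in> x) \<noteq> (k = i)"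
  by (simp add: flip_def)

lemma flip_flip [simp]: "flip i (flip i x) = x"
  by (auto simp: flip_def)

lemma flip_eq_iff [simp]: "flip i x = flip j x \<longleftrightarrow> i = j"
  by (auto simp: flip_def set_eq_iff)

lemma flip_inject [simp]: "flip i x = flip i y \<longleftrightarrow> x = y"
  by (metis flip_flip)

lemma flip_neq [simp]: "flip i x \<noteq> x" "x \<noteq> flip i x"
  by (auto simp: flip_def set_eq_iff)

lemma adj_flip [simp]: "adj x (flip i x)" "adj (flip i x) x"
  by (auto simp: adj_def intro: exI[of _ i])

lemma adj_sym: "adj x y \<Longrightarrow> adj y x"
  by (metis adj_def flip_flip)

lemma self_in_cube [simp]: "v \<in> cube v J"
  by (simp add: cube_def)

lemma cube_image: "cube v J = (\<lambda>B. (v - J) \<union> B) ` Pow J"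
proof (intro equalityI subsetI)
  fix w assume "w \<in> cube v J"
  then have "w = (v - J) \<union> (w \<inter> J)" by (auto simp: cube_def)
  then show "w \<in> (\<lambda>B. (v - J) \<union> B) ` Pow J" by blast
qed (auto simp: cube_def)

lemma finite_cube [simp]: "finite J \<Longrightarrow> finite (cube v J)"
  by (simp add: cube_image)

lemma card_cube:
  assumes "finite J"
  shows "card (cube v J) = 2 ^ card J"
proof -
  have "inj_on (\<lambda>B. (v - J) \<union> B) (Pow J)" by (auto simp: inj_on_def)
  then show ?thesis by (simp add: cube_image card_image card_Pow assms)
qed

lemma flip_in_cube [simp]: "i \<in> J \<Longrightarrow> flip i x \<in> cube v J \<longleftrightarrow> x \<in> cube v J"
  by (auto simp: cube_def mem_flip set_eq_iff)

lemma flip_in_cube_D: "x \<in> cube v J \<Longrightarrow> flip i x \<in> cube v J \<Longrightarrow> i \<in> J"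
  by (auto simp: cube_def mem_flip set_eq_iff)

lemma adj_in_cubeE:
  assumes "adj x y" "x \<in> cube v J" "y \<in> cube v J"
  obtains i where "i \<in> J" "y = flip i x"
  using assms flip_in_cube_D by (auto simp: adj_def)

lemma cube_mono: "u \<in> cube v J \<Longrightarrow> I \<subseteq> J \<Longrightarrow> cube u I \<subseteq> cube v J"
  by (auto simp: cube_def set_eq_iff)

lemma cube_disjoint:
  assumes "I \<inter> J = {}" "I \<inter> J' = {}" "u \<inter> I \<noteq> u' \<inter> I"
  shows "cube u J \<inter> cube u' J' = {}"
  using assms by (auto simp: cube_def set_eq_iff)

text \<open>If \<open>flip a x = flip b y\<close> and \<open>x \<noteq> y\<close>, then x and y
  differ exactly in a and b. One common neighbour thus determines the pair {a, b}, and every other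
  one is obtained from the same pair.\<close>

lemma common_neighbours:
  assumes "x \<noteq> y"
  shows "card ((\<lambda>i. flip i x) ` J \<inter> (\<lambda>i. flip i y) ` J) \<le> 2"
proof (cases "(\<lambda>i. flip i x) ` J \<inter> (\<lambda>i. flip i y) ` J = {}")
  case False
  then obtain i j where ij: "flip i x = flip j y" by auto
  have D: "{k. (k \<in> x) \<noteq> (k \<in> y)} = {a, b}" if "flip a x = flip b y" for a b
  proof -
    have "a \<noteq> b" using that assms by auto
    have e: "((k \<in> x) \<noteq> (k = a)) = ((k \<in> y) \<noteq> (k = b))" for k
      using that mem_flip by metis
    show ?thesis using e \<open>a \<noteq> b\<close> by auto
  qed
  have "(\<lambda>i. flip i x) ` J \<inter> (\<lambda>i. flip i y) ` J \<subseteq> (\<lambda>k. flip k x) ` {i, j}"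
  proof
    fix u assume "u \<in> (\<lambda>i. flip i x) ` J \<inter> (\<lambda>i. flip i y) ` J"
    then obtain a b where u: "u = flip a x" "flip a x = flip b y" by auto
    then have "{a, b} = {i, j}" using D[OF ij] D[OF u(2)] by simp
    then show "u \<in> (\<lambda>k. flip k x) ` {i, j}" using u by auto
  qed
  then have "card ((\<lambda>i. flip i x) ` J \<inter> (\<lambda>i. flip i y) ` J) \<le> card ((\<lambda>k. flip k x) ` {i, j})"
    by (intro card_mono) auto
  also have "\<dots> \<le> card {i, j}" by (rule card_image_le) auto
  also have "\<dots> \<le> 2" by (simp add: card_insert_if)
  finally show ?thesis .
qed auto

lemma card_neighbours [simp]: "card ((\<lambda>i. flip i x) ` J) = card J"
  by (rule card_image) (auto simp: inj_on_def)

lemma cluster_refl [simp]: "x \<in> cluster R x"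
  by (simp add: cluster_def)

lemma cluster_step: "y \<in> cluster R x \<Longrightarrow> adj y z \<Longrightarrow> z \<in> R \<Longrightarrow> z \<in> cluster R x"
  unfolding cluster_def by (auto intro: rtranclp.rtrancl_into_rtrancl)

lemma cluster_induct [consumes 1, case_names refl step]:
  assumes "y \<in> cluster R x" "P x"
    and "\<And>y z. y \<in> cluster R x \<Longrightarrow> P y \<Longrightarrow> adj y z \<Longrightarrow> z \<in> R \<Longrightarrow> P z"
  shows "P y"
proof -
  have "(\<lambda>a b. adj a b \<and> b \<in> R)\<^sup>*\<^sup>* x y" using assms(1) by (simp add: cluster_def)
  then show ?thesis
    by (induction rule: rtranclp_induct) (use assms(2,3) in \<open>auto simp: cluster_def\<close>)
qed

lemma cluster_subset: "cluster R x \<subseteq> insert x R"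
proof
  fix y assume "y \<in> cluster R x"
  then show "y \<in> insert x R" by (induction rule: cluster_induct) auto
qed

lemma cluster_subset': "x \<in> R \<Longrightarrow> cluster R x \<subseteq> R"
  using cluster_subset[of R x] by auto

lemma finite_cluster: "finite R \<Longrightarrow> finite (cluster R x)"
  by (rule finite_subset[OF cluster_subset]) simp

lemma cluster_trans:
  assumes "y \<in> cluster R x" "z \<in> cluster R y"
  shows "z \<in> cluster R x"
  using assms(2) by (induction rule: cluster_induct) (use assms(1) cluster_step in auto)

lemma cluster_mono:
  assumes "R \<subseteq> R'" "y \<in> cluster R x"
  shows "y \<in> cluster R' x"
  using assms(2) by (induction rule: cluster_induct) (use assms(1) cluster_step in auto)

lemma cluster_sym:
  assumes "x \<in> R" "y \<in> cluster R x"
  shows "x \<in> cluster R y"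
  using assms(2)
proof (induction rule: cluster_induct)
  case (step y z)
  have "y \<in> R" using step cluster_subset' assms(1) by auto
  then have "y \<in> cluster R z"
    by (rule cluster_step[OF cluster_refl adj_sym[OF \<open>adj y z\<close>]])
  then show ?case by (rule cluster_trans) (rule step.IH)
qed auto

lemma cluster_eq:
  assumes "x \<in> R" "y \<in> cluster R x"
  shows "cluster R y = cluster R x"
  using cluster_trans[OF assms(2)] cluster_trans[OF cluster_sym[OF assms]] by blast

text \<open>Allows vertices avoided by a cluster to be deleted: a final component that misses
  \<open>B\<close> is already a component before \<open>B\<close> is revealed.\<close>

lemma cluster_closed_eq:
  assumes "R' \<subseteq> R" "x \<in> R" "cluster R x \<subseteq> R'"
  shows "cluster R' x = cluster R x"
proof
  show "cluster R' x \<subseteq> cluster R x" using cluster_mono[OF assms(1)] by blast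
  show "cluster R x \<subseteq> cluster R' x"
  proof
    fix y assume "y \<in> cluster R x"
    then show "y \<in> cluster R' x"
    proof (induction rule: cluster_induct)
      case (step y z)
      have "z \<in> cluster R x" by (rule cluster_step[OF \<open>y \<in> cluster R x\<close> \<open>adj y z\<close> \<open>z \<in> R\<close>])
      then have "z \<in> R'" using assms(3) by blast
      then show ?case by (rule cluster_step[OF step.IH \<open>adj y z\<close>])
    qed auto
  qed
qed

lemma large_mono:
  assumes "R \<subseteq> R'" "finite R'" "w \<in> large R s"
  shows "w \<in> large R' s"
proof -
  have "card (cluster R w) \<le> card (cluster R' w)"
    using cluster_mono[OF assms(1)] assms(2) by (intro card_mono finite_cluster) blast+
  then show ?thesis using assms by (auto simp: large_def)
qed

lemma large_cluster:
  assumes "w \<in> large R s" "y \<in> cluster R w"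
  shows "y \<in> large R s"
  using assms cluster_eq[of w R y] cluster_subset' by (auto simp: large_def)

lemma cluster_first_step:
  "cluster R u \<subseteq> insert u (\<Union>y\<in>{y\<in>R. adj u y}. cluster R y)"
proof
  fix y assume "y \<in> cluster R u"
  then show "y \<in> insert u (\<Union>y\<in>{y\<in>R. adj u y}. cluster R y)"
  proof (induction rule: cluster_induct)
    case (step y z)
    show ?case
    proof (cases "y = u")
      case True
      then show ?thesis using step by auto
    next
      case False
      then obtain y' where "y' \<in> R" "adj u y'" "y \<in> cluster R y'" using step by auto
      then show ?thesis using step cluster_step[of y R y' z] by blast
    qed
  qed auto
qed

text \<open>Pigeonhole: the cluster of \<open>u\<close> is covered by \<open>u\<close> and the
  clusters of its at most \<open>card J\<close> neighbours in \<open>R\<close>. The price is one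
  factor of the dimension in the size.\<close>

lemma adj_large:
  fixes s :: real
  assumes "finite J" "R \<subseteq> cube u J" "1 + card J * s < card (cluster R u)" "0 \<le> s"
  shows "\<exists>w\<in>large R s. adj u w"
proof (rule ccontr)
  assume neg: "\<not> ?thesis"
  let ?Y = "{y\<in>R. adj u y}"
  have fin: "finite R" by (rule finite_subset[OF assms(2)]) (simp add: assms)
  have sub: "?Y \<subseteq> (\<lambda>i. flip i u) ` J"
    using assms(2) adj_in_cubeE[of u _ u J] by force
  have "card ?Y \<le> card J"
    using card_mono[OF _ sub] assms(1) by simp
  have "card (cluster R u) \<le> card (insert u (\<Union>y\<in>?Y. cluster R y))"
    using cluster_first_step fin finite_cluster by (intro card_mono) auto
  also have "\<dots> \<le> Suc (card (\<Union>y\<in>?Y. cluster R y))"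
    by (rule card_insert_le_m1) auto
  also have "\<dots> \<le> Suc (\<Sum>y\<in>?Y. card (cluster R y))"
    using fin by (auto intro!: card_UN_le)
  finally have "real (card (cluster R u)) \<le> 1 + (\<Sum>y\<in>?Y. real (card (cluster R y)))"
    by (metis of_nat_Suc of_nat_le_iff of_nat_sum)
  also have "\<dots> \<le> 1 + (\<Sum>y\<in>?Y. s)"
    using neg by (intro add_left_mono sum_mono) (force simp: large_def not_le)
  also have "\<dots> \<le> 1 + card J * s"
    using \<open>card ?Y \<le> card J\<close> assms(4) by (simp add: mult_right_mono)
  finally show False using assms(3) by simp
qed

text \<open>By injectivity a new vertex collides on \<open>I\<close> with at most one old vertex,
  and one coordinate in which the two differ repairs this. Freezing the coordinates of
  \<open>I\<close> later puts the vertices into disjoint subcubes.\<close>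

lemma distinguishing_coordinates:
  assumes "finite T" "T \<subseteq> cube v J"
  shows "\<exists>I\<subseteq>J. finite I \<and> card I \<le> card T \<and> inj_on (\<lambda>t. t \<inter> I) T"
  using assms
proof (induction T rule: finite_induct)
  case (insert t T)
  then obtain I where I: "I \<subseteq> J" "finite I" "card I \<le> card T" "inj_on (\<lambda>t. t \<inter> I) T"
    by auto
  show ?case
  proof (cases "\<exists>t'\<in>T. t' \<inter> I = t \<inter> I")
    case False
    then have "inj_on (\<lambda>t. t \<inter> I) (insert t T)"
      using I(4) by (auto simp: inj_on_def)
    then show ?thesis using I insert by (intro exI[of _ I]) auto
  next
    case True
    then obtain t' where t': "t' \<in> T" "t' \<inter> I = t \<inter> I" by auto
    then have "t \<noteq> t'" using insert by auto
    then obtain k where k: "(k \<in> t) \<noteq> (k \<in> t')" by auto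
    have "t - J = t' - J" using insert.prems t' by (auto simp: cube_def)
    then have "k \<in> J" using k by (auto simp: set_eq_iff)
    have *: "x \<inter> I = y \<inter> I" if "x \<inter> insert k I = y \<inter> insert k I" for x y :: "nat set"
      using that by (auto simp: set_eq_iff)
    have kk: "(k \<in> x) = (k \<in> y)" if "x \<inter> insert k I = y \<inter> insert k I" for x y :: "nat set"
      using that by (auto simp: set_eq_iff)
    have ne: "x \<inter> insert k I \<noteq> t \<inter> insert k I" if x: "x \<in> T" for x
    proof
      assume eq: "x \<inter> insert k I = t \<inter> insert k I"
      then have "x \<inter> I = t' \<inter> I" using *[OF eq] t'(2) by simp
      then have "x = t'" by (rule inj_onD[OF I(4) _ x t'(1)])
      then show False using kk[OF eq] k by auto
    qed
    have "inj_on (\<lambda>t. t \<inter> insert k I) T"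
    proof (rule inj_onI)
      fix x y assume xy: "x \<in> T" "y \<in> T" "x \<inter> insert k I = y \<inter> insert k I"
      show "x = y" by (rule inj_onD[OF I(4) _ xy(1,2)]) (rule *[OF xy(3)])
    qed
    moreover have "t \<inter> insert k I \<notin> (\<lambda>t. t \<inter> insert k I) ` (T - {t})"
    proof
      assume "t \<inter> insert k I \<in> (\<lambda>t. t \<inter> insert k I) ` (T - {t})"
      then obtain x where x: "x \<in> T" "t \<inter> insert k I = x \<inter> insert k I" by blast
      then show False using ne[OF x(1)] by simp
    qed
    ultimately have "inj_on (\<lambda>t. t \<inter> insert k I) (insert t T)"
      unfolding inj_on_insert by (rule conjI)
    moreover have "card (insert k I) \<le> card (insert t T)"
      using insert.hyps I by (simp add: card_insert_if)
    ultimately have "insert k I \<subseteq> J \<and> finite (insert k I) \<and> card (insert k I) \<le> card (insert t T)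
        \<and> inj_on (\<lambda>t. t \<inter> insert k I) (insert t T)"
      using I(1,2) \<open>k \<in> J\<close> by simp
    then show ?thesis by blast
  qed
qed auto

section \<open>Growth of clusters\<close>

abbreviation nbrs :: "nat set \<Rightarrow> nat set \<Rightarrow> nat set set" where
  "nbrs J x \<equiv> (\<lambda>i. flip i x) ` J"

lemma cluster_insert_root: "cluster (insert u R) u = cluster R u"
proof
  show "cluster (insert u R) u \<subseteq> cluster R u"
  proof
    fix y assume "y \<in> cluster (insert u R) u"
    then show "y \<in> cluster R u"
    proof (induction rule: cluster_induct)
      case (step y z)
      then show ?case using cluster_step[of y R u z] by auto
    qed auto
  qed
  show "cluster R u \<subseteq> cluster (insert u R) u"
    using cluster_mono[of R "insert u R"] by blast
qed

lemma sprob_root_cluster: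
  assumes "finite V" "u \<in> V"
  shows "sprob V p (\<lambda>R. u \<in> R \<and> P (cluster R u)) = p * sprob V p (\<lambda>R. P (cluster R u))"
proof -
  obtain V' where V: "V = insert u V'" "u \<notin> V'" "finite V'"
    using assms by (metis finite_insert mk_disjoint_insert)
  have "expect V' p (\<lambda>R. of_bool (u \<in> R \<and> P (cluster R u))) = expect V' p (\<lambda>_. 0)"
    using V by (intro expect_cong) auto
  then show ?thesis
    using V by (simp add: sprob_def expect_insert expect_const cluster_insert_root algebra_simps)
qed

lemma exploration_step_region:
  assumes "Y \<subseteq> N - (A \<union> X \<union> M)" "x \<in> X"
  shows "V - (A \<union> X \<union> M) - (N - (A \<union> X \<union> M)) =
    V - (insert x A \<union> ((X - {x}) \<union> Y) \<union> (N \<union> M))"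
  using assms by blast

text \<open>Each active vertex has at least \<open>card J - 3 * m\<close> unexplored neighbours while fewer than
  \<open>m\<close> vertices are known, because two vertices have at most two common neighbours.\<close>

lemma exploration:
  assumes "finite J" "0 \<le> p" "p \<le> 1" "0 \<le> l" "l \<le> 1"
    and drift: "(1 - p * (1 - l)) ^ (card J - 3 * m) \<le> l"
    and "A \<subseteq> cube v J" "X \<subseteq> cube v J" "A \<inter> X = {}"
  shows "sprob (cube v J - (A \<union> X \<union> \<Union> (nbrs J ` A))) p
      (\<lambda>R. card (A \<union> \<Union> (cluster R ` X)) < m) \<le> l ^ card X"
  using assms(7-9)
proof (induction "m - card A" arbitrary: A X rule: less_induct)
  \<comment> \<open>\<open>A\<close> holds the processed vertices, \<open>X\<close> the active ones.
    By \<open>drift\<close>, l is at least the value at l of the generating function of Bin(card J -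
    3 * m, p), so \<open>l ^ card X\<close> does not grow on average in one step. This is the
    extinction bound of a branching process.\<close>
  case less
  let ?V = "cube v J"
  let ?NA = "\<Union> (nbrs J ` A)"
  let ?F = "?V - (A \<union> X \<union> ?NA)"
  have finV: "finite ?V" using assms by simp
  have finA: "finite A" and finX: "finite X" using less.prems finV finite_subset by blast+
  have finF: "finite ?F" using finV by simp
  consider (big) "m \<le> card A + card X" | (empty) "X = {}" | (step) x where "card A + card X < m" "x \<in> X"
    by fastforce
  then show ?case
  proof cases
    case big
    have many: "card A + card X \<le> card (A \<union> \<Union> (cluster R ` X))" if "R \<subseteq> ?F" for R
    proof -
      have "finite R" by (rule finite_subset[OF that finF])
      then have "finite (A \<union> \<Union> (cluster R ` X))" using finA finX finite_cluster by auto
      moreover have "A \<union> X \<subseteq> A \<union> \<Union> (cluster R ` X)"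
        using cluster_refl by blast
      ultimately have "card (A \<union> X) \<le> card (A \<union> \<Union> (cluster R ` X))" by (rule card_mono)
      then show ?thesis using card_Un_disjoint[OF finA finX less.prems(3)] by simp
    qed
    have "sprob ?F p (\<lambda>R. card (A \<union> \<Union> (cluster R ` X)) < m) = sprob ?F p (\<lambda>R. False)"
    proof (rule sprob_cong)
      fix R assume "R \<subseteq> ?F"
      from many[OF this] show "(card (A \<union> \<Union> (cluster R ` X)) < m) = False" using big by simp
    qed
    also have "\<dots> = 0" using finF by (simp add: sprob_def expect_const)
    finally show ?thesis using assms by simp
  next
    case empty
    then show ?thesis using sprob_le_1[OF assms(2,3) finF] by simp
  next
    case step
    let ?N = "nbrs J x - (A \<union> X \<union> ?NA)"
    have xV: "x \<in> ?V" and xA: "x \<notin> A" using step less.prems by auto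
    have NV: "nbrs J x \<subseteq> ?V" using xV by auto
    have NF: "?N \<subseteq> ?F" using NV by auto
    have finN: "finite ?N" using assms by simp
    have "card (nbrs J x \<inter> ?NA) \<le> (\<Sum>a\<in>A. card (nbrs J x \<inter> nbrs J a))"
      unfolding Int_UN_distrib by (rule card_UN_le[OF finA])
    also have "\<dots> \<le> (\<Sum>a\<in>A. 2)"
      by (rule sum_mono, rule common_neighbours) (use xA in auto)
    finally have c1: "card (nbrs J x \<inter> ?NA) \<le> 2 * card A" by simp
    have "nbrs J x \<inter> (A \<union> X \<union> ?NA) \<subseteq> A \<union> X \<union> (nbrs J x \<inter> ?NA)" by auto
    then have "card (nbrs J x \<inter> (A \<union> X \<union> ?NA)) \<le> card (A \<union> X \<union> (nbrs J x \<inter> ?NA))"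
      using finA finX assms by (intro card_mono) auto
    also have "\<dots> \<le> card A + card X + card (nbrs J x \<inter> ?NA)"
      by (meson add_le_mono1 card_Un_le le_trans)
    finally have "card (nbrs J x \<inter> (A \<union> X \<union> ?NA)) \<le> 3 * m" using c1 step by linarith
    moreover have "card ?N = card J - card (nbrs J x \<inter> (A \<union> X \<union> ?NA))"
      using assms(1) by (subst card_Diff_subset_Int) auto
    ultimately have cN: "card J - 3 * m \<le> card ?N" by linarith
    \<comment> \<open>Exposing the new neighbours of \<open>x\<close> as \<open>Y\<close> moves
      \<open>x\<close> to \<open>A\<close> and adds \<open>Y\<close> to \<open>X\<close>. The rest
      of \<open>?N\<close> is now known to be absent, and \<open>?F - ?N\<close> is exactly the
      unexplored region of the new state.\<close>
    have bound: "sprob (?F - ?N) p (\<lambda>R. card (A \<union> \<Union> (cluster (Y \<union> R) ` X)) < m)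
        \<le> l ^ (card X - 1) * l ^ card Y" if Y: "Y \<subseteq> ?N" for Y
    proof -
      let ?A = "insert x A" and ?X = "(X - {x}) \<union> Y"
      have finY: "finite Y" by (rule finite_subset[OF Y finN])
      have F': "?F - ?N = ?V - (?A \<union> ?X \<union> \<Union> (nbrs J ` ?A))"
        using exploration_step_region[OF Y step(2)] by (simp only: UN_insert)
      have "sprob (?F - ?N) p (\<lambda>R. card (A \<union> \<Union> (cluster (Y \<union> R) ` X)) < m)
          \<le> sprob (?F - ?N) p (\<lambda>R. card (?A \<union> \<Union> (cluster R ` ?X)) < m)"
      proof (rule sprob_mono[OF assms(2,3)])
        fix R assume R: "R \<subseteq> ?F - ?N" and lt: "card (A \<union> \<Union> (cluster (Y \<union> R) ` X)) < m"
        have "finite R" by (rule finite_subset[OF R]) (simp add: finF)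
        then have fin: "finite (A \<union> \<Union> (cluster (Y \<union> R) ` X))"
          using finA finX finY finite_cluster by auto
        have mono: "cluster R z \<subseteq> cluster (Y \<union> R) z" for z
          using cluster_mono[of R "Y \<union> R"] by blast
        have Yx: "cluster R y \<subseteq> cluster (Y \<union> R) x" if "y \<in> Y" for y
        proof -
          have "adj x y" using that Y by auto
          then have "y \<in> cluster (Y \<union> R) x"
            using that by (intro cluster_step[OF cluster_refl]) auto
          then show ?thesis using mono[of y] cluster_trans[of y "Y \<union> R" x] by blast
        qed
        have "?A \<union> \<Union> (cluster R ` ?X) \<subseteq> A \<union> \<Union> (cluster (Y \<union> R) ` X)"
        proof
          fix z assume "z \<in> ?A \<union> \<Union> (cluster R ` ?X)"
          then consider "z \<in> A" | "z = x" | x' where "x' \<in> X" "z \<in> cluster R x'"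
            | y where "y \<in> Y" "z \<in> cluster R y" by blast
          then show "z \<in> A \<union> \<Union> (cluster (Y \<union> R) ` X)"
          proof cases
            case 2
            then show ?thesis using step(2) cluster_refl[of x "Y \<union> R"] by blast
          next
            case 3
            then show ?thesis using mono[of x'] by blast
          next
            case 4
            then show ?thesis using Yx[of y] step(2) by blast
          qed simp
        qed
        then have "card (?A \<union> \<Union> (cluster R ` ?X)) \<le> card (A \<union> \<Union> (cluster (Y \<union> R) ` X))"
          by (rule card_mono[OF fin])
        then show "card (?A \<union> \<Union> (cluster R ` ?X)) < m" using lt by simp
      qed
      also have "\<dots> \<le> l ^ card ?X"
        unfolding F'
      proof (rule less.hyps)
        show "m - card ?A < m - card A" using xA finA step by simp
        show "?A \<subseteq> ?V" using xV less.prems by auto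
        show "?X \<subseteq> ?V" using Y NV less.prems by auto
        show "?A \<inter> ?X = {}" using Y less.prems step by auto
      qed
      also have "card ?X = (card X - 1) + card Y"
        using Y finX finY step by (subst card_Un_disjoint) auto
      finally show ?thesis by (simp add: power_add)
    qed
    have "sprob ?F p (\<lambda>R. card (A \<union> \<Union> (cluster R ` X)) < m)
        \<le> expect ?N p (\<lambda>Y. l ^ (card X - 1) * l ^ card Y)"
      unfolding sprob_split[OF finF NF] by (rule expect_mono[OF assms(2,3) bound])
    also have "\<dots> = l ^ (card X - 1) * (1 - p * (1 - l)) ^ card ?N"
      by (simp add: expect_cmult expect_power_card[OF finN])
    also have "\<dots> \<le> l ^ (card X - 1) * l"
    proof (rule mult_left_mono)
      have "p * (1 - l) \<le> 1 * 1" by (rule mult_mono) (use assms in auto)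
      moreover have "0 \<le> p * (1 - l)" using assms by simp
      ultimately have "(1 - p * (1 - l)) ^ card ?N \<le> (1 - p * (1 - l)) ^ (card J - 3 * m)"
        by (intro power_decreasing[OF cN]) auto
      then show "(1 - p * (1 - l)) ^ card ?N \<le> l" using drift by linarith
    qed (use assms in auto)
    also have "\<dots> = l ^ card X"
    proof -
      have "0 < card X" using step(2) finX by (auto simp: card_gt_0_iff)
      then show ?thesis by (metis power_minus_mult)
    qed
    finally show ?thesis .
  qed
qed

lemma cluster_small:
  assumes "finite J" "0 \<le> p" "p \<le> 1" "0 \<le> l" "l \<le> 1"
    and drift: "(1 - p * (1 - l)) ^ (card J - 3 * m) \<le> l"
  shows "sprob (cube v J) p (\<lambda>R. card (cluster R v) < m) \<le> l"
proof -
  have fin: "finite (cube v J - {v})" using assms by simp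
  have "sprob (cube v J) p (\<lambda>R. card (cluster R v) < m) =
      expect {v} p (\<lambda>X. sprob (cube v J - {v}) p (\<lambda>Y. card (cluster (X \<union> Y) v) < m))"
    by (rule sprob_split) (use assms in auto)
  also have "\<dots> \<le> expect {v} p (\<lambda>X. l)"
  proof (rule expect_mono[OF assms(2,3)])
    fix X assume X: "X \<subseteq> {v}"
    have "sprob (cube v J - {v}) p (\<lambda>Y. card (cluster (X \<union> Y) v) < m)
        \<le> sprob (cube v J - ({} \<union> {v} \<union> \<Union> (nbrs J ` {}))) p
            (\<lambda>R. card ({} \<union> \<Union> (cluster R ` {v})) < m)"
      unfolding Un_empty_left image_empty Union_empty Un_empty_right
    proof (rule sprob_mono[OF assms(2,3)])
      fix R assume R: "R \<subseteq> cube v J - {v}" "card (cluster (X \<union> R) v) < m"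
      have "finite R" by (rule finite_subset[OF R(1) fin])
      moreover have "finite X" by (rule finite_subset[OF X]) simp
      ultimately have "card (cluster R v) \<le> card (cluster (X \<union> R) v)"
        using cluster_mono[of R "X \<union> R"] by (intro card_mono finite_cluster) blast+
      then show "card (\<Union> (cluster R ` {v})) < m" using R by simp
    qed
    also have "\<dots> \<le> l ^ card {v}"
      by (rule exploration) (use assms in auto)
    finally show "sprob (cube v J - {v}) p (\<lambda>Y. card (cluster (X \<union> Y) v) < m) \<le> l" by simp
  qed
  also have "\<dots> = l" by (rule expect_const) simp
  finally show ?thesis .
qed

text \<open>One constant \<open>c\<close> serves both as probability and as factor of the size.
  Since \<open>J\<close> is arbitrary and \<open>p * card J\<close> is only bounded from below, the
  property passes to subcubes with the same p and a smaller excess.\<close>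

definition grows :: "nat \<Rightarrow> bool" where
  "grows j \<longleftrightarrow> (\<forall>\<epsilon>>0. \<exists>c>0::real. \<exists>D. \<forall>J v. \<forall>p::real. finite J \<and> D \<le> card J \<and> 0 \<le> p \<and> p \<le> 1
     \<and> 1 + \<epsilon> \<le> p * real (card J) \<longrightarrow>
     c \<le> sprob (cube v J) p (\<lambda>R. c * real (card J) ^ j \<le> card (cluster R v)))"

text \<open>Giving up a fraction e/4 of the directions at most halves the excess over 1, because (1
  + e)(1 - e/4) = 1 + e/2 + e (1 - e)/4.\<close>

lemma supercritical_rescale:
  fixes e p d x :: real
  assumes "0 < e" "e \<le> 1" "0 \<le> p" "1 + e \<le> p * d" "d - e * d / 4 \<le> x"
  shows "1 + e / 2 \<le> p * x"
proof -
  have "(1 + e) * (1 - e / 4) \<le> (p * d) * (1 - e / 4)"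
    using assms by (intro mult_right_mono) auto
  also have "\<dots> = p * (d - e * d / 4)" by (simp add: algebra_simps)
  also have "\<dots> \<le> p * x" using assms by (intro mult_left_mono) auto
  finally have "(1 + e) * (1 - e / 4) \<le> p * x" .
  moreover have "(1 + e) * (1 - e / 4) = 1 + e / 2 + e * (1 - e) / 4" by (simp add: field_simps)
  moreover have "0 \<le> e * (1 - e) / 4" using assms by simp
  ultimately show ?thesis by simp
qed

lemma grows_1: "grows 1"
  unfolding grows_def
proof (intro allI impI)
  fix \<epsilon> :: real assume "\<epsilon> > 0"
  define e where "e = min \<epsilon> 1"
  have e: "0 < e" "e \<le> 1" "e \<le> \<epsilon>" using \<open>\<epsilon> > 0\<close> by (auto simp: e_def)
  \<comment> \<open>A branching process with mean offspring at least 1 + e/2 survives with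
    probability at least e/4, so this l can bound the extinction probability.\<close>
  define l where "l = 1 - e / 4"
  show "\<exists>c>0::real. \<exists>D. \<forall>J v. \<forall>p::real. finite J \<and> D \<le> card J \<and> 0 \<le> p \<and> p \<le> 1 \<and> 1 + \<epsilon> \<le> p * real (card J) \<longrightarrow>
     c \<le> sprob (cube v J) p (\<lambda>R. c * real (card J) ^ 1 \<le> card (cluster R v))"
  proof (rule exI[of _ "e / 24"], intro conjI exI[of _ "nat \<lceil>24 / e\<rceil>"] allI impI)
    show "0 < e / 24" using e by simp
    fix J :: "nat set" and v and p :: real
    assume asm: "finite J \<and> nat \<lceil>24 / e\<rceil> \<le> card J \<and> 0 \<le> p \<and> p \<le> 1 \<and> 1 + \<epsilon> \<le> p * real (card J)"
    define d where "d = real (card J)"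
    \<comment> \<open>The 3 * m directions lost in the exploration, including the rounding, number
      at most e * d / 4 because 24 \<le> e * d.\<close>
    define m where "m = nat \<lceil>e / 24 * d\<rceil>"
    have d: "24 / e \<le> d" using asm unfolding d_def by linarith
    then have "24 \<le> e * d" using e by (simp add: field_simps)
    then have ed: "3 \<le> e * d / 8" and d0: "0 < d" using e d by (auto intro: order_less_le_trans[OF _ d])
    have "real m \<le> e / 24 * d + 1" "e / 24 * d \<le> real m"
      unfolding m_def using e d0 by (auto intro: real_nat_ceiling_ge)
    then have m: "3 * real m \<le> e * d / 4" "e / 24 * d \<le> real m" using ed by auto
    have "3 * m \<le> card J"
    proof -
      have "e * d / 4 \<le> d" using e d0 by simp
      then show ?thesis using m unfolding d_def by linarith
    qed
    then have D: "real (card J - 3 * m) = d - 3 * real m" by (simp add: d_def of_nat_diff)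
    have pd: "1 + e \<le> p * d" using asm e by (simp add: d_def)
    have drift1: "1 + e / 2 \<le> p * real (card J - 3 * m)"
      by (rule supercritical_rescale[OF e(1,2) _ pd]) (use asm m D in auto)
    have pos: "0 \<le> 1 - p * (1 - l)"
    proof -
      have "p * (e / 4) \<le> 1 * 1" by (rule mult_mono) (use asm e in auto)
      then show ?thesis by (simp add: l_def)
    qed
    let ?y = "(1 + e / 2) * (e / 4)"
    have "(1 - p * (1 - l)) ^ (card J - 3 * m) \<le> exp (- (p * (1 - l))) ^ (card J - 3 * m)"
      using exp_ge_add_one_self[of "- (p * (1 - l))"] pos by (intro power_mono) auto
    also have "\<dots> = exp (- ((p * real (card J - 3 * m)) * (e / 4)))"
      by (simp add: exp_of_nat_mult[symmetric] l_def algebra_simps)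
    also have "\<dots> \<le> exp (- ?y)"
      unfolding exp_le_cancel_iff neg_le_iff_le by (rule mult_right_mono[OF drift1]) (use e in simp)
    \<comment> \<open>Write y for \<open>?y\<close>. Then l (1 + y) = 1 + e^2/8 - (e/4) y, which is
      at least 1 since y \<le> e/2; now exp y \<ge> 1 + y gives exp(-y) \<le> l.\<close>
    also have "\<dots> \<le> l"
    proof -
      have "e * e \<le> 1 * e" using e by (intro mult_right_mono) auto
      then have "?y \<le> 3 * e / 8" by (simp add: algebra_simps)
      then have "?y * (e / 4) \<le> (e / 2) * (e / 4)" using e by (intro mult_right_mono) auto
      then have "1 \<le> l * (1 + ?y)" by (simp add: l_def algebra_simps)
      also have "\<dots> \<le> l * exp ?y"
        using e exp_ge_add_one_self[of ?y] by (intro mult_left_mono) (auto simp: l_def)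
      finally show ?thesis by (simp add: exp_minus field_simps)
    qed
    finally have drift: "(1 - p * (1 - l)) ^ (card J - 3 * m) \<le> l" .
    have "sprob (cube v J) p (\<lambda>R. card (cluster R v) < m) \<le> l"
      by (rule cluster_small[OF _ _ _ _ _ drift]) (use asm e in \<open>auto simp: l_def\<close>)
    then have "e / 4 \<le> sprob (cube v J) p (\<lambda>R. \<not> card (cluster R v) < m)"
      using asm by (subst sprob_not) (auto simp: l_def)
    also have "\<dots> \<le> sprob (cube v J) p (\<lambda>R. e / 24 * real (card J) ^ 1 \<le> card (cluster R v))"
      by (rule sprob_mono) (use asm m in \<open>auto simp: d_def\<close>)
    finally show "e / 24 \<le> sprob (cube v J) p (\<lambda>R. e / 24 * real (card J) ^ 1 \<le> card (cluster R v))"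
      using e by simp
  qed
qed

lemma cube_disjoint_coordinate:
  assumes "i \<notin> J" "i \<notin> J'" "(i \<in> u) \<noteq> (i \<in> u')"
  shows "cube u J \<inter> cube u' J' = {}"
  using assms by (auto simp: cube_def set_eq_iff)

text \<open>Centres coming from different \<open>t\<close> differ on \<open>I\<close>, which is
  neither flipped nor free. Centres coming from the same \<open>t\<close> differ in coordinate
  \<open>i\<close>, which is flipped in only one of them and is not free in
  \<open>C t\<close>.\<close>

lemma disjoint_subcubes:
  assumes inj: "inj_on (\<lambda>t. t \<inter> I) T" and DI: "\<And>t. t \<in> T \<Longrightarrow> D t \<inter> I = {}"
    and C: "\<And>t. I \<inter> C t = {}" "\<And>t. D t \<inter> C t = {}"
  shows "disjoint_family_on (\<lambda>(t, i). cube (flip i t) (C t)) (Sigma T D)"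
  unfolding disjoint_family_on_def
proof (intro ballI impI)
  fix u u' assume uu: "u \<in> Sigma T D" "u' \<in> Sigma T D" "u \<noteq> u'"
  then obtain t i t' i' where u: "u = (t, i)" "u' = (t', i')" "t \<in> T" "t' \<in> T" "i \<in> D t" "i' \<in> D t'"
    by auto
  have "cube (flip i t) (C t) \<inter> cube (flip i' t') (C t') = {}"
  proof (cases "t = t'")
    case False
    then have ne: "t \<inter> I \<noteq> t' \<inter> I" using inj_onD[OF inj _ u(3,4)] by metis
    have "i \<notin> I" "i' \<notin> I" using DI[OF u(3)] DI[OF u(4)] u(5,6) by auto
    then have "flip i t \<inter> I = t \<inter> I" "flip i' t' \<inter> I = t' \<inter> I" by (auto simp: mem_flip)
    then have "flip i t \<inter> I \<noteq> flip i' t' \<inter> I" using ne by metis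
    then show ?thesis by (rule cube_disjoint[OF C(1) C(1)])
  next
    case True
    then have "i \<noteq> i'" using uu u(1,2) by simp
    moreover have "i \<notin> C t" "i \<notin> C t'" using u(5) C(2)[of t] True by auto
    ultimately show ?thesis
      using True by (intro cube_disjoint_coordinate[of i]) (auto simp: mem_flip)
  qed
  then show "(case u of (t, i) \<Rightarrow> cube (flip i t) (C t)) \<inter> (case u' of (t, i) \<Rightarrow> cube (flip i t) (C t)) = {}"
    unfolding u(1,2) case_prod_conv .
qed

text \<open>A cluster of linear size is grown without a reserved set \<open>I'\<close> of
  directions. Its vertices and the reserved directions yield of order d^2 neighbours outside the
  explored subcube, each in a fresh subcube of its own. A fraction of order p of them, hence of
  order d, is present with a cluster of order d^j, which gains one power of d.\<close>

lemma grows_Suc: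
  assumes "grows 1" "grows j"
  shows "grows (Suc j)"
  unfolding grows_def
proof (intro allI impI)
  fix \<epsilon> :: real assume "\<epsilon> > 0"
  define e where "e = min \<epsilon> 1"
  have e: "0 < e" "e \<le> 1" "e \<le> \<epsilon>" using \<open>\<epsilon> > 0\<close> by (auto simp: e_def)
  then have e2: "0 < e / 2" by simp
  obtain c1 D1 where c1: "0 < c1" and D1: "\<And>J v p. finite J \<Longrightarrow> D1 \<le> card J \<Longrightarrow> 0 \<le> p \<Longrightarrow>
      p \<le> 1 \<Longrightarrow> 1 + e / 2 \<le> p * real (card J) \<Longrightarrow>
      c1 \<le> sprob (cube v J) p (\<lambda>R. c1 * real (card J) ^ 1 \<le> card (cluster R v))"
    using assms(1) e2 unfolding grows_def by meson
  obtain c2 D2 where c2: "0 < c2" and D2: "\<And>J v p. finite J \<Longrightarrow> D2 \<le> card J \<Longrightarrow> 0 \<le> p \<Longrightarrow>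
      p \<le> 1 \<Longrightarrow> 1 + e / 2 \<le> p * real (card J) \<Longrightarrow>
      c2 \<le> sprob (cube v J) p (\<lambda>R. c2 * real (card J) ^ j \<le> card (cluster R v))"
    using assms(2) e2 unfolding grows_def by meson
  \<comment> \<open>The reserved directions (at most e * d / 12 + 1) and the distinguishing ones (at
    most a * d) together cost at most e * d / 4. The bound a \<le> c1 / 2 lets the first cluster
    supply \<open>h\<close> vertices, c3 * d is a lower bound for the number of successes, and 2 ^ j
    pays for \<open>card J2\<close> being only at least d / 2.\<close>
  define g0 where "g0 = e / 12"
  define a where "a = min (c1 / 2) g0"
  define c3 where "c3 = c2 * a * g0 / 8"
  define c where "c = min (c1 / 2) (c3 * (c2 / 2 ^ j))"
  have pos: "0 < g0" "0 < a" "a \<le> g0" "a \<le> c1 / 2" "0 < c3" "0 < c" "g0 \<le> 1 / 12"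
    using e c1 c2 by (auto simp: g0_def a_def c3_def c_def)
  define D where "D = nat \<lceil>12 / e + 2 / a + 1 / c3 + real (2 * D1) + real (2 * D2)\<rceil>"
  show "\<exists>c>0::real. \<exists>D. \<forall>J v. \<forall>p::real. finite J \<and> D \<le> card J \<and> 0 \<le> p \<and> p \<le> 1
      \<and> 1 + \<epsilon> \<le> p * real (card J) \<longrightarrow>
      c \<le> sprob (cube v J) p (\<lambda>R. c * real (card J) ^ Suc j \<le> card (cluster R v))"
  proof (rule exI[of _ c], intro conjI exI[of _ D] allI impI)
    show "0 < c" by (rule pos)
    fix J :: "nat set" and v and p :: real
    assume asm: "finite J \<and> D \<le> card J \<and> 0 \<le> p \<and> p \<le> 1 \<and> 1 + \<epsilon> \<le> p * real (card J)"
    then have J: "finite J" and p: "0 \<le> p" "p \<le> 1" by auto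
    define d where "d = real (card J)"
    define g where "g = nat \<lceil>g0 * d\<rceil>"
    define h where "h = nat \<lfloor>a * d\<rfloor>"
    have "12 / e + 2 / a + 1 / c3 + real (2 * D1) + real (2 * D2) \<le> d"
      using asm unfolding D_def d_def by linarith
    moreover have "0 < 12 / e" "0 < 2 / a" "0 < 1 / c3" using pos e by auto
    ultimately have d: "12 / e \<le> d" "2 / a \<le> d" "1 / c3 \<le> d" "2 * real D1 \<le> d" "2 * real D2 \<le> d"
      "0 < d" by linarith+
    have ed: "12 \<le> e * d" using d(1) e by (simp add: field_simps)
    have ad: "2 \<le> a * d" using d(2) pos by (simp add: field_simps)
    have cd: "1 \<le> c3 * d" using d(3) pos by (simp add: field_simps)
    have pd: "1 + e \<le> p * d" using asm e by (simp add: d_def)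
    have g: "g0 * d \<le> real g" "real g \<le> g0 * d + 1"
      unfolding g_def using pos d by (auto intro: real_nat_ceiling_ge)
    have h: "real h \<le> a * d" "a * d / 2 \<le> real h"
      unfolding h_def using ad by linarith+
    have ag: "a * d \<le> g0 * d" using pos d by (intro mult_right_mono) auto
    have edd: "e * d \<le> d" using e d by simp
    have gd: "g0 * d = e * d / 12" by (simp add: g0_def)
    have gh: "real g + real h \<le> e * d / 4" using g h ag gd ed by linarith
    have "g \<le> card J" using gh edd d(6) unfolding d_def by linarith
    then obtain I' where I': "I' \<subseteq> J" "card I' = g" "finite I'"
      using obtain_subset_with_card_n by metis
    define J1 where "J1 = J - I'"
    have J1: "finite J1" "J1 \<subseteq> J" "J1 \<inter> I' = {}" using J by (auto simp: J1_def)
    have dJ1: "real (card J1) = d - real g"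
      unfolding J1_def using I' \<open>g \<le> card J\<close> by (simp add: card_Diff_subset d_def of_nat_diff)
    note pe = supercritical_rescale[OF e(1,2) p(1) pd]
    let ?V = "cube v J" and ?V1 = "cube v J1"
    have V1V: "?V1 \<subseteq> ?V" by (rule cube_mono) (use J1 in auto)
    have finV: "finite ?V" using J by simp
    have "c1 \<le> sprob ?V1 p (\<lambda>X. c1 * real (card J1) ^ 1 \<le> card (cluster X v))"
    proof (rule D1)
      show "D1 \<le> card J1" using dJ1 gh edd d(4) by linarith
      show "1 + e / 2 \<le> p * real (card J1)" by (rule pe) (use dJ1 gh in linarith)
    qed (use J1 p in auto)
    also have "\<dots> \<le> sprob ?V1 p (\<lambda>X. h \<le> card (cluster X v))"
    proof (rule sprob_mono[OF p])
      fix X assume X: "c1 * real (card J1) ^ 1 \<le> card (cluster X v)"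
      have "real h \<le> c1 / 2 * d" using h pos d by (smt (verit) mult_right_mono)
      also have "\<dots> = c1 * (d / 2)" by simp
      also have "\<dots> \<le> c1 * real (card J1)"
        using c1 dJ1 gh edd by (intro mult_left_mono) auto
      finally show "h \<le> card (cluster X v)" using X by simp
    qed
    finally have first: "c1 \<le> sprob ?V1 p (\<lambda>X. h \<le> card (cluster X v))" .
    let ?big = "\<lambda>R. c * real (card J) ^ Suc j \<le> card (cluster R v)"
    \<comment> \<open>Once the first round is exposed as \<open>X\<close> inside \<open>?V1\<close>,
      everything in \<open>?V - ?V1\<close> is still fresh. All trials live there, since their
      centres have a reserved coordinate flipped that stays fixed in their subcubes.\<close>
    have second: "1 / 2 \<le> sprob (?V - ?V1) p (\<lambda>Y. ?big (X \<union> Y))"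
      if X: "X \<subseteq> ?V1" "h \<le> card (cluster X v)" for X
    proof -
      obtain T where T: "T \<subseteq> cluster X v" "card T = h" "finite T"
        using obtain_subset_with_card_n[OF X(2)] by metis
      have TV: "T \<subseteq> ?V1" using T X cluster_subset[of X v] by force
      obtain I where I: "I \<subseteq> J1" "finite I" "card I \<le> h" "inj_on (\<lambda>t. t \<inter> I) T"
        using distinguishing_coordinates[OF T(3) TV] T(2) by auto
      define J2 where "J2 = J1 - I"
      have J2: "finite J2" "J2 \<subseteq> J" "J2 \<subseteq> J1" "J2 \<inter> I' = {}" "I \<inter> J2 = {}"
        using J1 by (auto simp: J2_def)
      have "card J1 - card I \<le> card J2" unfolding J2_def by (rule diff_card_le_card_Diff[OF I(2)])
      then have dJ2: "d - real g - real h \<le> real (card J2)" using dJ1 I(3) by linarith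
      have J2d: "d / 2 \<le> real (card J2)" using dJ2 gh edd d(6) by linarith
      define U where "U = T \<times> I'"
      define Q where "Q = (\<lambda>(t, i). cube (flip i t) J2)"
      define S where "S = (\<lambda>(t, i) Y. flip i t \<in> Y \<and> c2 * real (card J2) ^ j \<le> card (cluster Y (flip i t)))"
      have cU: "card U = h * g" by (simp add: U_def card_cartesian_product T I')
      have finU: "finite U" using T I' by (simp add: U_def)
      have sp: "c2 \<le> sprob (cube u J2) p (\<lambda>Y. c2 * real (card J2) ^ j \<le> card (cluster Y u))" for u
        by (rule D2) (use J2 p pe dJ2 gh d J2d in auto)
      have c21: "c2 \<le> 1" using sp[of v] sprob_le_1[OF p finite_cube[OF J2(1)]] by (meson order_trans)
      have QV: "Q u \<subseteq> ?V - ?V1" if uU: "u \<in> U" for u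
      proof -
        obtain t i where u: "u = (t, i)" "t \<in> T" "i \<in> I'" using uU by (auto simp: U_def)
        have "t \<in> ?V" using u TV V1V by auto
        then have "flip i t \<in> ?V" using u I' by auto
        then have "Q u \<subseteq> ?V" unfolding u Q_def using J2 cube_mono by auto
        moreover have "Q u \<inter> ?V1 = {}" unfolding u Q_def case_prod_conv
        proof (rule cube_disjoint_coordinate)
          show i: "i \<notin> J1" using u(3) J1(3) by auto
          then show "i \<notin> J2" using J2(3) by auto
          have "t - J1 = v - J1" using u(2) TV by (auto simp: cube_def)
          then have "i \<in> t \<longleftrightarrow> i \<in> v" using i by (auto simp: set_eq_iff)
          then show "(i \<in> flip i t) \<noteq> (i \<in> v)" by (simp add: mem_flip)
        qed
        ultimately show ?thesis by auto
      qed
      have "I' \<inter> I = {}" using I(1) J1(3) by auto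
      then have disj: "disjoint_family_on Q U"
        unfolding Q_def U_def using J2(4,5) by (intro disjoint_subcubes[OF I(4)]) auto
      have suc: "p * c2 \<le> sprob (Q u) p (S u)" if "u \<in> U" for u
      proof -
        obtain t i where u: "u = (t, i)" by (cases u)
        show ?thesis unfolding u Q_def S_def case_prod_conv
          using sprob_root_cluster[of "cube (flip i t) J2" "flip i t" p "\<lambda>C. c2 * real (card J2) ^ j \<le> card C"]
            sp[of "flip i t"] J2 p by (simp add: mult_left_mono)
      qed
      let ?N = "\<lambda>Y. card {u\<in>U. S u (Y \<inter> Q u)}"
      have N: "c3 * d \<le> p * c2 * card U / 4"
      proof -
        have "(a * d / 2) * (g0 * d) \<le> real h * real g"
          using h g pos d by (intro mult_mono) auto
        then have "c2 / 4 * ((a * d / 2) * (g0 * d)) \<le> c2 / 4 * real (card U)"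
          using c2 cU by (intro mult_left_mono) auto
        then have "p * (c2 / 4 * ((a * d / 2) * (g0 * d))) \<le> p * (c2 / 4 * real (card U))"
          using p(1) by (rule mult_left_mono)
        moreover have "p * (c2 / 4 * ((a * d / 2) * (g0 * d))) = (p * d) * (c3 * d)"
          by (simp add: c3_def field_simps)
        moreover have "1 * (c3 * d) \<le> (p * d) * (c3 * d)"
          using pd e pos d by (intro mult_right_mono) auto
        ultimately have "c3 * d \<le> p * (c2 / 4 * real (card U))" by linarith
        then show ?thesis by (simp add: mult.assoc)
      qed
      have "sprob (?V - ?V1) p (\<lambda>Y. real (?N Y) < p * c2 * card U / 4) \<le> exp (- (p * c2) * card U / 4)"
        by (rule few_successes)
          (use finV finU p QV disj suc c2 mult_le_one[OF p(2) less_imp_le[OF c2] c21] in auto)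
      also have "\<dots> \<le> exp (- 1)" using N cd by simp
      also have "\<dots> \<le> 1 / 2"
        using exp_ge_add_one_self[of "1::real"] by (simp add: exp_minus field_simps)
      finally have "1 / 2 \<le> sprob (?V - ?V1) p (\<lambda>Y. \<not> real (?N Y) < p * c2 * card U / 4)"
        using finV by (subst sprob_not) auto
      also have "\<dots> \<le> sprob (?V - ?V1) p (\<lambda>Y. ?big (X \<union> Y))"
      proof (rule sprob_mono[OF p])
        fix Y assume Y: "Y \<subseteq> ?V - ?V1" "\<not> real (?N Y) < p * c2 * card U / 4"
        let ?W = "{u\<in>U. S u (Y \<inter> Q u)}"
        let ?C = "\<lambda>(t, i). cluster (Y \<inter> Q (t, i)) (flip i t)"
        have "finite X" by (rule finite_subset[OF X(1)]) (simp add: J1)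
        moreover have "finite Y" by (rule finite_subset[OF Y(1)]) (simp add: finV)
        ultimately have finXY: "finite (X \<union> Y)" by simp
        have CQ: "?C u \<subseteq> Q u" if "u \<in> ?W" for u
        proof -
          obtain t i where u: "u = (t, i)" by (cases u)
          then have "flip i t \<in> Y \<inter> Q (t, i)" using that by (auto simp: S_def)
          from cluster_subset'[OF this] show ?thesis unfolding u case_prod_conv by (rule le_infE)
        qed
        have CC: "?C u \<subseteq> cluster (X \<union> Y) v" if uW: "u \<in> ?W" for u
        proof -
          obtain t i where u: "u = (t, i)" "t \<in> T" using uW by (auto simp: U_def)
          then have "flip i t \<in> Y" using uW by (auto simp: S_def)
          have "t \<in> cluster X v" using u(2) T(1) by blast
          then have "t \<in> cluster (X \<union> Y) v" by (rule cluster_mono[OF Un_upper1])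
          then have ft: "flip i t \<in> cluster (X \<union> Y) v"
            by (rule cluster_step[OF _ adj_flip(1)]) (simp add: \<open>flip i t \<in> Y\<close>)
          show ?thesis unfolding u case_prod_conv
          proof
            fix z assume "z \<in> cluster (Y \<inter> Q (t, i)) (flip i t)"
            then have "z \<in> cluster (X \<union> Y) (flip i t)" by (rule cluster_mono[rotated]) auto
            then show "z \<in> cluster (X \<union> Y) v" by (rule cluster_trans[OF ft])
          qed
        qed
        have finW: "finite ?W" using finU by simp
        have "(c3 * d) * (c2 * (d / 2) ^ j) \<le> real (card ?W) * (c2 * real (card J2) ^ j)"
        proof (rule mult_mono)
          show "c3 * d \<le> real (card ?W)" using Y N by linarith
          show "c2 * (d / 2) ^ j \<le> c2 * real (card J2) ^ j"
            using c2 J2d d by (intro mult_left_mono power_mono) auto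
        qed (use c2 d in auto)
        also have "\<dots> = (\<Sum>u\<in>?W. c2 * real (card J2) ^ j)" by simp
        also have "\<dots> \<le> (\<Sum>u\<in>?W. real (card (?C u)))"
          by (rule sum_mono) (auto simp: S_def)
        also have "\<dots> = real (card (\<Union>u\<in>?W. ?C u))"
        proof -
          have "card (\<Union>u\<in>?W. ?C u) = (\<Sum>u\<in>?W. card (?C u))"
          proof (rule card_UN_disjoint[OF finW])
            show "\<forall>u\<in>?W. finite (?C u)"
              using finite_subset[OF CC finite_cluster[OF finXY]] by blast
            show "\<forall>u\<in>?W. \<forall>u'\<in>?W. u \<noteq> u' \<longrightarrow> ?C u \<inter> ?C u' = {}"
            proof (intro ballI impI)
              fix u u' assume "u \<in> ?W" "u' \<in> ?W" "u \<noteq> u'"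
              moreover then have "Q u \<inter> Q u' = {}" using disj by (auto simp: disjoint_family_on_def)
              ultimately show "?C u \<inter> ?C u' = {}" using CQ[of u] CQ[of u'] by blast
            qed
          qed
          then show ?thesis by simp
        qed
        also have "\<dots> \<le> real (card (cluster (X \<union> Y) v))"
          unfolding of_nat_le_iff by (rule card_mono[OF finite_cluster[OF finXY]]) (use CC in blast)
        finally have "(c3 * d) * (c2 * (d / 2) ^ j) \<le> real (card (cluster (X \<union> Y) v))" .
        moreover have "c * d ^ Suc j \<le> (c3 * (c2 / 2 ^ j)) * d ^ Suc j"
          using d by (intro mult_right_mono) (auto simp: c_def)
        moreover have "(c3 * (c2 / 2 ^ j)) * d ^ Suc j = (c3 * d) * (c2 * (d / 2) ^ j)"
          by (simp add: power_divide)
        ultimately show "?big (X \<union> Y)" by (simp add: d_def)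
      qed
      finally show ?thesis .
    qed
    have "c \<le> c1 * (1 / 2)" unfolding c_def by (rule order_trans[OF min.cobounded1]) simp
    also have "\<dots> \<le> 1 / 2 * sprob ?V1 p (\<lambda>X. h \<le> card (cluster X v))" using first by simp
    also have "\<dots> = expect ?V1 p (\<lambda>X. 1 / 2 * of_bool (h \<le> card (cluster X v)))"
      unfolding sprob_def expect_cmult ..
    also have "\<dots> \<le> expect ?V1 p (\<lambda>X. sprob (?V - ?V1) p (\<lambda>Y. ?big (X \<union> Y)))"
    proof (rule expect_mono[OF p])
      fix X assume X: "X \<subseteq> ?V1"
      show "1 / 2 * of_bool (h \<le> card (cluster X v)) \<le> sprob (?V - ?V1) p (\<lambda>Y. ?big (X \<union> Y))"
        using second[OF X] sprob_nonneg[OF p] by (cases "h \<le> card (cluster X v)") auto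
    qed
    also have "\<dots> = sprob ?V p ?big" by (rule sprob_split[OF finV V1V, symmetric])
    finally show "c \<le> sprob ?V p ?big" .
  qed
qed

lemma grows: "grows (Suc j)"
  by (induction j) (use grows_1 grows_Suc in auto)

section \<open>Isoperimetry\<close>

lemma flip_commute: "flip i (flip j x) = flip j (flip i x)"
  by (auto simp: flip_def)

text \<open>Cauchy-Schwarz for a bipartite graph: the left side counts edges, the double sum on the
  right counts pairs of edges meeting in \<open>B\<close>.\<close>

lemma sum_card_squared_le:
  fixes r :: "'a \<Rightarrow> 'b \<Rightarrow> bool"
  assumes "finite A" "finite B"
  shows "(\<Sum>a\<in>A. real (card {b\<in>B. r a b}))\<^sup>2 \<le>
    real (card B) * (\<Sum>a\<in>A. \<Sum>a'\<in>A. real (card {b\<in>B. r a b \<and> r a' b}))"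
proof -
  define f where "f = (\<lambda>b. \<Sum>a\<in>A. (of_bool (r a b) :: real))"
  have card_eq: "real (card {b\<in>B. Q b}) = (\<Sum>b\<in>B. of_bool (Q b))" for Q
    using assms(2) by (simp add: of_bool_def sum.If_cases Int_def)
  have "(\<Sum>a\<in>A. real (card {b\<in>B. r a b})) = (\<Sum>b\<in>B. f b)"
    unfolding card_eq f_def by (rule sum.swap)
  then have "(\<Sum>a\<in>A. real (card {b\<in>B. r a b}))\<^sup>2 \<le> (\<Sum>b\<in>B. (f b)\<^sup>2) * card B"
    using sum_squared_le_sum_of_squares[of f B] by simp
  also have "(\<Sum>b\<in>B. (f b)\<^sup>2) = (\<Sum>b\<in>B. \<Sum>a\<in>A. \<Sum>a'\<in>A. of_bool (r a b \<and> r a' b))"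
    unfolding power2_eq_square f_def sum_product by (simp add: of_bool_conj)
  also have "\<dots> = (\<Sum>a\<in>A. \<Sum>b\<in>B. \<Sum>a'\<in>A. of_bool (r a b \<and> r a' b))" by (rule sum.swap)
  also have "\<dots> = (\<Sum>a\<in>A. \<Sum>a'\<in>A. \<Sum>b\<in>B. of_bool (r a b \<and> r a' b))"
    by (intro sum.cong refl sum.swap)
  finally show ?thesis unfolding card_eq by (simp add: mult.commute)
qed

definition two_apart :: "nat set \<Rightarrow> nat set \<Rightarrow> bool" where
  "two_apart x y \<longleftrightarrow> (\<exists>i j. i \<noteq> j \<and> y = flip i (flip j x))"

lemma common_neighbours_two_apart:
  assumes "x \<noteq> y" "u \<in> nbrs J x" "u \<in> nbrs J y"
  shows "two_apart x y"
proof -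
  obtain i j where "u = flip i x" "u = flip j y" using assms by auto
  then have "y = flip j (flip i x)" by (metis flip_flip)
  moreover then have "j \<noteq> i" using assms(1) by auto
  ultimately show ?thesis unfolding two_apart_def by blast
qed

lemma diff_two_flips:
  assumes "flip i (flip j s) = flip a (flip b s')"
  shows "(k \<in> s) \<noteq> (k \<in> s') \<longleftrightarrow> ((k = i) \<noteq> (k = j)) \<noteq> ((k = a) \<noteq> (k = b))"
  using assms[unfolded set_eq_iff, rule_format, of k] by (auto simp: mem_flip)

text \<open>If \<open>s\<close> and \<open>s'\<close> have a common point at distance 2, they differ
  in two or four coordinates. With four, both flips from \<open>s\<close> to \<open>t\<close> use
  differing coordinates, at most 4 * 4 ordered pairs. With two, at least one flip does, which leaves
  at most 2 * card J pairs up to order.\<close>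

lemma common_two_apart:
  assumes "finite J" "S \<subseteq> cube v J" "s \<in> S" "s' \<in> S" "s \<noteq> s'"
  shows "card {t\<in>S. two_apart s t \<and> two_apart s' t} \<le> (if two_apart s s' then 2 * card J else 0) + 16"
proof (cases "{t\<in>S. two_apart s t \<and> two_apart s' t} = {}")
  case False
  let ?T = "{t\<in>S. two_apart s t \<and> two_apart s' t}"
  let ?\<Delta> = "{k. (k \<in> s) \<noteq> (k \<in> s')}"
  let ?f = "\<lambda>(i, j). flip i (flip j s)"
  have rep: "\<exists>i j a b. t = flip i (flip j s) \<and> i \<noteq> j \<and> a \<noteq> b \<and> i \<in> J \<and> j \<in> J
      \<and> flip i (flip j s) = flip a (flip b s')" if tT: "t \<in> ?T" for t
  proof -
    obtain i j where ij: "i \<noteq> j" "t = flip i (flip j s)" using tT by (auto simp: two_apart_def)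
    obtain a b where ab: "a \<noteq> b" "t = flip a (flip b s')" using tT by (auto simp: two_apart_def)
    have "t \<in> cube v J" "s \<in> cube v J" using tT assms(2,3) by auto
    then have "t - J = s - J" by (simp add: cube_def)
    then have "i \<in> J" "j \<in> J" using ij by (auto simp: set_eq_iff mem_flip)
    then show ?thesis using ij ab by metis
  qed
  obtain t0 where "t0 \<in> ?T" using False by blast
  then obtain i0 j0 a0 b0 where r0: "i0 \<noteq> j0" "a0 \<noteq> b0" "flip i0 (flip j0 s) = flip a0 (flip b0 s')"
    using rep by metis
  have D0: "?\<Delta> = ({i0, j0} - {a0, b0}) \<union> ({a0, b0} - {i0, j0})"
    using diff_two_flips[OF r0(3)] r0(1,2) by auto
  have ne: "{i0, j0} \<noteq> {a0, b0}"
  proof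
    assume "{i0, j0} = {a0, b0}"
    then have "?\<Delta> = {}" using D0 by simp
    then show False using assms(5) by auto
  qed
  show ?thesis
  proof (cases "{i0, j0} \<inter> {a0, b0} = {}")
    case True
    then have D4: "?\<Delta> = {i0, j0, a0, b0}" and c4: "card {i0, j0, a0, b0} = 4" using D0 r0 by auto
    have "?T \<subseteq> ?f ` (?\<Delta> \<times> ?\<Delta>)"
    proof
      fix t assume t: "t \<in> ?T"
      obtain i j a b where r: "t = flip i (flip j s)" "i \<noteq> j" "a \<noteq> b"
          "flip i (flip j s) = flip a (flip b s')" using rep[OF t] by metis
      have "?\<Delta> = ({i, j} - {a, b}) \<union> ({a, b} - {i, j})"
        using diff_two_flips[OF r(4)] r(2,3) by auto
      then have e: "card (({i, j} - {a, b}) \<union> ({a, b} - {i, j})) = 4" using D4 c4 by simp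
      have "{i, j} \<inter> {a, b} = {}"
      proof (rule ccontr)
        assume "{i, j} \<inter> {a, b} \<noteq> {}"
        then have "card ({i, j} - {a, b}) < card {i, j}" by (intro psubset_card_mono) auto
        moreover have "card {i, j} \<le> 2" "card ({a, b} - {i, j}) \<le> 2"
          by (auto simp: card_insert_if intro: order_trans[OF card_Diff1_le] order_trans[OF card_mono[of "{a, b}"]])
        moreover have "card (({i, j} - {a, b}) \<union> ({a, b} - {i, j})) \<le>
            card ({i, j} - {a, b}) + card ({a, b} - {i, j})" by (rule card_Un_le)
        ultimately show False using e by linarith
      qed
      then have "i \<in> ?\<Delta>" "j \<in> ?\<Delta>"
        using diff_two_flips[OF r(4)] r(2,3) by auto
      then show "t \<in> ?f ` (?\<Delta> \<times> ?\<Delta>)" using r(1) by auto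
    qed
    then have "card ?T \<le> card (?f ` (?\<Delta> \<times> ?\<Delta>))" unfolding D4 by (intro card_mono) auto
    also have "\<dots> \<le> card (?\<Delta> \<times> ?\<Delta>)" unfolding D4 by (rule card_image_le) auto
    also have "\<dots> = 16" unfolding card_cartesian_product unfolding D4 c4 by simp
    finally show ?thesis by simp
  next
    case False
    consider "i0 = a0" "j0 \<noteq> b0" | "i0 = b0" "j0 \<noteq> a0" | "j0 = a0" "i0 \<noteq> b0" | "j0 = b0" "i0 \<noteq> a0"
      using False ne by auto
    then have "\<exists>k l. ?\<Delta> = {k, l} \<and> k \<noteq> l"
    proof cases
      case 1 then show ?thesis unfolding D0 using r0(1,2) by (intro exI[of _ j0] exI[of _ b0]) auto
    next
      case 2 then show ?thesis unfolding D0 using r0(1,2) by (intro exI[of _ j0] exI[of _ a0]) auto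
    next
      case 3 then show ?thesis unfolding D0 using r0(1,2) by (intro exI[of _ i0] exI[of _ b0]) auto
    next
      case 4 then show ?thesis unfolding D0 using r0(1,2) by (intro exI[of _ i0] exI[of _ a0]) auto
    qed
    then obtain k l where D2: "?\<Delta> = {k, l}" "k \<noteq> l" by blast
    have two: "two_apart s s'"
      unfolding two_apart_def
    proof (intro exI conjI)
      show "k \<noteq> l" by (rule D2)
      show "s' = flip k (flip l s)" using D2 by (auto simp: mem_flip set_eq_iff)
    qed
    have "?T \<subseteq> ?f ` (?\<Delta> \<times> J)"
    proof
      fix t assume t: "t \<in> ?T"
      obtain i j a b where r: "t = flip i (flip j s)" "i \<noteq> j" "a \<noteq> b" "i \<in> J" "j \<in> J"
          "flip i (flip j s) = flip a (flip b s')" using rep[OF t] by metis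
      note D = diff_two_flips[OF r(6)]
      have "i \<in> ?\<Delta> \<or> j \<in> ?\<Delta>"
      proof (rule ccontr)
        assume "\<not> (i \<in> ?\<Delta> \<or> j \<in> ?\<Delta>)"
        then have "{i, j} \<subseteq> {a, b}" using D[of i] D[of j] r(2,3) by auto
        then have "{i, j} = {a, b}" using r(2) by (auto simp: doubleton_eq_iff)
        then have "?\<Delta> = {}" using D r(2,3) by (auto simp: doubleton_eq_iff)
        then show False using D2 by simp
      qed
      moreover have "t = ?f (j, i)" using r(1) flip_commute by simp
      moreover have "t = ?f (i, j)" using r(1) by simp
      ultimately show "t \<in> ?f ` (?\<Delta> \<times> J)" using r(4,5) by blast
    qed
    then have "card ?T \<le> card (?f ` (?\<Delta> \<times> J))" unfolding D2 by (intro card_mono) (use assms in auto)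
    also have "\<dots> \<le> card (?\<Delta> \<times> J)" unfolding D2 by (rule card_image_le) (use assms in auto)
    also have "\<dots> = 2 * card J" unfolding card_cartesian_product unfolding D2 using D2 by simp
    finally show ?thesis using two by simp
  qed
qed (simp only: card.empty le0)

text \<open>Cauchy-Schwarz twice: two vertices have few common points at distance 2, so on average a point of \<open>S\<close>
  has only \<open>O(d)\<close> points of \<open>S\<close> at distance 2; hence the second moment of the number of neighbours
  in \<open>S\<close> of a vertex is small.\<close>

lemma sum_two_apart:
  assumes "finite J" "S \<subseteq> cube v J" "4 * card S \<le> (card J)\<^sup>2" "J \<noteq> {}"
  shows "(\<Sum>s\<in>S. real (card {t\<in>S. two_apart s t})) \<le> 4 * real (card J) * real (card S)"
proof (rule ccontr)
  assume neg: "\<not> ?thesis"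
  have finS: "finite S" by (rule finite_subset[OF assms(2)]) (simp add: assms)
  let ?D = "\<lambda>s. real (card {t\<in>S. two_apart s t})"
  define P where "P = (\<Sum>s\<in>S. ?D s)"
  define N where "N = real (card S)"
  define d where "d = real (card J)"
  have d: "1 \<le> d" using assms by (simp add: d_def Suc_le_eq card_gt_0_iff)
  have Nd: "4 * N \<le> d * d" using assms(3) by (simp add: N_def d_def power2_eq_square flip: of_nat_mult)
  have big: "4 * d * N < P" using neg by (simp add: P_def N_def d_def)
  have "P\<^sup>2 \<le> N * (\<Sum>s\<in>S. \<Sum>s'\<in>S. real (card {t\<in>S. two_apart s t \<and> two_apart s' t}))"
    unfolding P_def N_def by (rule sum_card_squared_le[OF finS finS])
  also have "\<dots> \<le> N * (\<Sum>s\<in>S. \<Sum>s'\<in>S. of_bool (s' = s) * ?D s + (of_bool (two_apart s s') * (2 * d) + 16))"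
  proof (intro mult_left_mono sum_mono)
    fix s s' assume s: "s \<in> S" "s' \<in> S"
    show "real (card {t\<in>S. two_apart s t \<and> two_apart s' t}) \<le>
        of_bool (s' = s) * ?D s + (of_bool (two_apart s s') * (2 * d) + 16)"
    proof (cases "s = s'")
      case False
      have "real (card {t\<in>S. two_apart s t \<and> two_apart s' t}) \<le>
          real ((if two_apart s s' then 2 * card J else 0) + 16)"
        using common_two_apart[OF assms(1,2) s False] by (rule of_nat_mono)
      then show ?thesis using False by (auto simp: d_def)
    qed (use d in auto)
  qed (simp add: N_def)
  also have "(\<Sum>s\<in>S. \<Sum>s'\<in>S. of_bool (s' = s) * ?D s + (of_bool (two_apart s s') * (2 * d) + 16)) =
     P + P * (2 * d) + 16 * N * N"
  proof -
    have "(\<Sum>s'\<in>S. of_bool (s' = s) * ?D s) = ?D s" if "s \<in> S" for s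
      using that finS by (simp add: of_bool_def if_distrib[of "\<lambda>x. x * _"] sum.delta cong: if_cong)
    moreover have "(\<Sum>s'\<in>S. of_bool (two_apart s s') * (2 * d)) = ?D s * (2 * d)" for s
      unfolding sum_distrib_right[symmetric] using finS by (simp add: of_bool_def sum.If_cases Int_def)
    ultimately show ?thesis
      by (simp add: sum.distrib P_def N_def sum_distrib_right)
  qed
  finally have le: "P * P \<le> N * (P + P * (2 * d) + 16 * N * N)" by (simp add: power2_eq_square)
  have "0 \<le> N" by (simp add: N_def)
  have P0: "0 < P" using big d \<open>0 \<le> N\<close> by (smt (verit) mult_nonneg_nonneg)
  have N0: "0 < N"
  proof (rule ccontr)
    assume "\<not> 0 < N"
    then have "N = 0" using \<open>0 \<le> N\<close> by simp
    then have "S = {}" using finS by (simp add: N_def)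
    then show False using P0 by (simp add: P_def)
  qed
  \<comment> \<open>Here the size restriction on \<open>S\<close> enters: with 4 N \<le> d^2 the
    constant term 16 N^2 is at most P d. The inequality then collapses to P \<le> N (1 + 3 d),
    against the assumption P > 4 d N.\<close>
  have "16 * N * N \<le> 4 * N * (d * d)" using Nd N0 by simp
  also have "\<dots> \<le> P * d" using mult_right_mono[OF less_imp_le[OF big], of d] d by (simp add: algebra_simps)
  finally have "P * P \<le> N * (P + P * (2 * d) + P * d)"
    using le N0 by (smt (verit) mult_left_mono)
  then have "P * P \<le> P * (N * (1 + 3 * d))" by (simp add: algebra_simps)
  then have "P \<le> N * (1 + 3 * d)" using P0 by simp
  also have "\<dots> \<le> N * (4 * d)" using d N0 by (intro mult_left_mono) auto
  finally show False using big by (simp add: algebra_simps)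
qed

text \<open>The 9 is 1 + 2 * 4: the diagonal contributes d per vertex of \<open>S\<close>, and each
  of the at most 4 d |S| ordered pairs at distance 2 contributes at most two common
  neighbours.\<close>

lemma card_neighbourhood_ge:
  assumes "finite J" "S \<subseteq> cube v J" "4 * card S \<le> (card J)\<^sup>2" "J \<noteq> {}"
  shows "real (card S) * real (card J) \<le> 9 * real (card (\<Union> (nbrs J ` S)))"
proof (cases "S = {}")
  case False
  have finS: "finite S" by (rule finite_subset[OF assms(2)]) (simp add: assms)
  let ?B = "\<Union> (nbrs J ` S)"
  define N where "N = real (card S)"
  define d where "d = real (card J)"
  have d: "1 \<le> d" using assms by (simp add: d_def Suc_le_eq card_gt_0_iff)
  have N: "0 < N" using False finS by (simp add: N_def card_gt_0_iff)
  have B: "{b\<in>?B. b \<in> nbrs J s} = nbrs J s" if "s \<in> S" for s using that by auto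
  have finB: "finite ?B" using finS assms by auto
  have "(\<Sum>s\<in>S. real (card {b\<in>?B. b \<in> nbrs J s})) = N * d"
  proof -
    have "(\<Sum>s\<in>S. real (card {b\<in>?B. b \<in> nbrs J s})) = (\<Sum>s\<in>S. d)"
      by (rule sum.cong[OF refl]) (simp only: B card_neighbours d_def)
    then show ?thesis by (simp add: N_def)
  qed
  then have "(N * d)\<^sup>2 \<le> real (card ?B) * (\<Sum>s\<in>S. \<Sum>s'\<in>S. real (card {b\<in>?B. b \<in> nbrs J s \<and> b \<in> nbrs J s'}))"
    using sum_card_squared_le[OF finS finB, of "\<lambda>s b. b \<in> nbrs J s"] by simp
  also have "\<dots> \<le> real (card ?B) * (\<Sum>s\<in>S. \<Sum>s'\<in>S. of_bool (s' = s) * d + of_bool (two_apart s s') * 2)"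
  proof (intro mult_left_mono sum_mono)
    fix s s' assume s: "s \<in> S" "s' \<in> S"
    have eq: "{b\<in>?B. b \<in> nbrs J s \<and> b \<in> nbrs J s'} = nbrs J s \<inter> nbrs J s'" using s by auto
    show "real (card {b\<in>?B. b \<in> nbrs J s \<and> b \<in> nbrs J s'}) \<le>
        of_bool (s' = s) * d + of_bool (two_apart s s') * 2"
    proof (cases "s = s'")
      case False
      show ?thesis
      proof (cases "two_apart s s'")
        case True
        then show ?thesis unfolding eq using common_neighbours[OF False, of J] False by simp
      next
        case nt: False
        then have "nbrs J s \<inter> nbrs J s' = {}"
          using common_neighbours_two_apart[OF False] by blast
        then show ?thesis unfolding eq using nt d by simp
      qed
    next
      case True
      show ?thesis unfolding eq using True by (simp add: d_def)
    qed
  qed simp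
  also have "(\<Sum>s\<in>S. \<Sum>s'\<in>S. of_bool (s' = s) * d + of_bool (two_apart s s') * 2) =
     N * d + (\<Sum>s\<in>S. real (card {t\<in>S. two_apart s t})) * 2"
  proof -
    have "(\<Sum>s'\<in>S. of_bool (s' = s) * d) = d" if "s \<in> S" for s
      using that finS by (simp add: of_bool_def if_distrib[of "\<lambda>x. x * _"] sum.delta cong: if_cong)
    moreover have "(\<Sum>s'\<in>S. of_bool (two_apart s s') * 2) = real (card {t\<in>S. two_apart s t}) * 2" for s
      unfolding sum_distrib_right[symmetric] using finS by (simp add: of_bool_def sum.If_cases Int_def)
    ultimately show ?thesis
      by (simp add: sum.distrib N_def sum_distrib_right)
  qed
  also have "real (card ?B) * \<dots> \<le> real (card ?B) * (9 * (N * d))"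
    using sum_two_apart[OF assms] by (intro mult_left_mono) (auto simp: N_def d_def algebra_simps)
  finally have "(N * d) * (N * d) \<le> (9 * real (card ?B)) * (N * d)"
    by (simp add: power2_eq_square algebra_simps)
  then show ?thesis using N d by (simp add: N_def d_def)
qed simp

text \<open>At least |S| d / 9 neighbours are charged. Vertices with fewer than d / 18 of them
  account for at most half, and the others for at most d each, so there are at least |S| / 18 of
  these. Injectivity makes counting pairs the same as counting neighbours.\<close>

lemma private_directions:
  assumes "finite J" "S \<subseteq> cube v J" "4 * card S \<le> (card J)\<^sup>2" "J \<noteq> {}"
  obtains S' dirs where "S' \<subseteq> S" "real (card S) / 18 \<le> real (card S')"
    "\<And>t. t \<in> S' \<Longrightarrow> dirs t \<subseteq> J" "\<And>t. t \<in> S' \<Longrightarrow> real (card J) / 18 \<le> real (card (dirs t))"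
    "inj_on (\<lambda>(t, i). flip i t) (Sigma S' dirs)"
proof -
  have finS: "finite S" by (rule finite_subset[OF assms(2)]) (simp add: assms)
  define d where "d = real (card J)"
  have d: "1 \<le> d" using assms by (simp add: d_def Suc_le_eq card_gt_0_iff)
  \<comment> \<open>Each neighbour of \<open>S\<close> is charged to one vertex of \<open>S\<close> only.\<close>
  define par where "par u = (SOME x. x \<in> S \<and> u \<in> nbrs J x)" for u
  have par: "par u \<in> S \<and> u \<in> nbrs J (par u)" if "u \<in> \<Union> (nbrs J ` S)" for u
    unfolding par_def by (rule someI_ex) (use that in blast)
  define dirs where "dirs t = {i\<in>J. par (flip i t) = t}" for t
  define S' where "S' = {t\<in>S. d / 18 \<le> real (card (dirs t))}"
  have fd: "finite (dirs t)" "card (dirs t) \<le> card J" for t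
    using assms(1) by (auto simp: dirs_def intro: card_mono)
  have inj: "inj_on (\<lambda>(t, i). flip i t) (Sigma A dirs)" for A
    unfolding inj_on_def dirs_def by (auto; metis flip_eq_iff)
  have "\<Union> (nbrs J ` S) \<subseteq> (\<lambda>(t, i). flip i t) ` Sigma S dirs"
  proof
    fix u assume u: "u \<in> \<Union> (nbrs J ` S)"
    then obtain i where i: "i \<in> J" "u = flip i (par u)" using par[OF u] by auto
    then have "(par u, i) \<in> Sigma S dirs" using par[OF u] by (auto simp: dirs_def)
    then show "u \<in> (\<lambda>(t, i). flip i t) ` Sigma S dirs" using i(2) by force
  qed
  then have "card (\<Union> (nbrs J ` S)) \<le> card (Sigma S dirs)"
    using finS fd by (intro surj_card_le) auto
  moreover have "card (Sigma S dirs) = (\<Sum>t\<in>S. card (dirs t))" using finS fd by simp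
  ultimately have "real (card (\<Union> (nbrs J ` S))) \<le> real (\<Sum>t\<in>S. card (dirs t))"
    unfolding of_nat_le_iff by (rule ord_le_eq_trans)
  also have "\<dots> = (\<Sum>t\<in>S. real (card (dirs t)))" by simp
  also have "\<dots> \<le> (\<Sum>t\<in>S. of_bool (t \<in> S') * d + d / 18)"
  proof (rule sum_mono)
    fix t assume "t \<in> S"
    then show "real (card (dirs t)) \<le> of_bool (t \<in> S') * d + d / 18"
      using fd[of t] d by (auto simp: S'_def d_def)
  qed
  also have "\<dots> = real (card S') * d + real (card S) * (d / 18)"
  proof -
    have "S \<inter> {t. t \<in> S'} = S'" by (auto simp: S'_def)
    then have "(\<Sum>t\<in>S. of_bool (t \<in> S')) = real (card S')"
      using finS by (simp add: of_bool_def sum.If_cases)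
    then show ?thesis by (simp add: sum.distrib flip: sum_distrib_right)
  qed
  finally have F: "real (card (\<Union> (nbrs J ` S))) \<le> real (card S') * d + real (card S) * (d / 18)" .
  have "real (card S) * d \<le> 9 * real (card (\<Union> (nbrs J ` S)))"
    using card_neighbourhood_ge[OF assms] by (simp only: d_def)
  also have "\<dots> \<le> 9 * (real (card S') * d + real (card S) * (d / 18))"
    by (rule mult_left_mono[OF F]) simp
  finally have "real (card S) * d \<le> 9 * (real (card S') * d + real (card S) * (d / 18))" .
  then have "(real (card S) / 18) * d \<le> real (card S') * d" by (simp add: field_simps)
  then have "real (card S) / 18 \<le> real (card S')" using d by simp
  moreover have "S' \<subseteq> S" by (auto simp: S'_def)
  moreover have "dirs t \<subseteq> J" "real (card J) / 18 \<le> real (card (dirs t))" if "t \<in> S'" for t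
    using that by (auto simp: S'_def d_def dirs_def)
  ultimately show ?thesis
    using that[of S' dirs] inj[of S'] by blast
qed

section \<open>Edge and vertex boundaries in the cube\<close>

definition cut :: "nat set \<Rightarrow> nat set set \<Rightarrow> nat" where
  "cut J P = (\<Sum>x\<in>P. card {i\<in>J. flip i x \<notin> P})"

lemma cube_insert: "cube v (insert a J) = cube v J \<union> cube (flip a v) J"
proof (intro equalityI subsetI)
  fix w assume w: "w \<in> cube v (insert a J)"
  show "w \<in> cube v J \<union> cube (flip a v) J"
  proof (cases "a \<in> w \<longleftrightarrow> a \<in> v")
    case True
    then have "w \<in> cube v J" using w by (auto simp: cube_def set_eq_iff)
    then show ?thesis by simp
  next
    case False
    then have "w \<in> cube (flip a v) J" using w by (auto simp: cube_def set_eq_iff mem_flip)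
    then show ?thesis by simp
  qed
next
  fix w assume "w \<in> cube v J \<union> cube (flip a v) J"
  then show "w \<in> cube v (insert a J)" by (auto simp: cube_def set_eq_iff mem_flip)
qed

text \<open>Halving the cube along a coordinate \<open>a\<close> splits the cut into the cuts of the
  two halves and the edges in direction \<open>a\<close>; the latter number at least the difference
  of the sizes of the two halves of \<open>P\<close>.\<close>

lemma edge_isoperimetry:
  assumes "finite J" "P \<subseteq> cube v J"
  shows "min (card P) (2 ^ card J - card P) \<le> cut J P"
  using assms
proof (induction J arbitrary: v P rule: finite_induct)
  case empty
  then have "P \<subseteq> {v}" by (auto simp: cube_def)
  then have "P = {} \<or> P = {v}" by blast
  then show ?case by auto
next
  case (insert a J)
  let ?A = "cube v J" and ?B = "cube (flip a v) J"
  have AB: "?A \<inter> ?B = {}" by (rule cube_disjoint_coordinate[of a]) (use insert in \<open>auto simp: mem_flip\<close>)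
  let ?P = "P \<inter> ?A" and ?Q = "P \<inter> ?B"
  have P: "P = ?P \<union> ?Q" using insert.prems by (auto simp: cube_insert)
  have finA: "finite ?A" "finite ?B" using insert by auto
  have finP: "finite ?P" "finite ?Q" using finA by auto
  have disj: "?P \<inter> ?Q = {}" using AB by auto
  have finPP: "finite P" using P finP by (metis finite_Un)
  have cP: "card P = card ?P + card ?Q" using card_Un_disjoint[OF finP disj] P by simp
  have le: "card ?P \<le> 2 ^ card J" "card ?Q \<le> 2 ^ card J"
    using card_mono[OF finA(1), of ?P] card_mono[OF finA(2), of ?Q] insert.hyps by (auto simp: card_cube)
  let ?X = "\<lambda>P x. card {i\<in>J. flip i x \<notin> P}"
  have split: "card {i\<in>insert a J. flip i x \<notin> P} = ?X P x + of_bool (flip a x \<notin> P)" for x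
  proof -
    have "{i\<in>insert a J. flip i x \<notin> P} = (if flip a x \<notin> P then insert a {i\<in>J. flip i x \<notin> P} else {i\<in>J. flip i x \<notin> P})"
      by auto
    then show ?thesis using insert.hyps by auto
  qed
  have X1: "?X P x = ?X ?P x" if "x \<in> ?P" for x
    by (rule arg_cong[of _ _ card]) (use that in auto)
  have X2: "?X P x = ?X ?Q x" if "x \<in> ?Q" for x
    by (rule arg_cong[of _ _ card]) (use that in auto)
  let ?E = "\<Sum>x\<in>P. of_bool (flip a x \<notin> P)"
  have "cut (insert a J) P = (\<Sum>x\<in>P. ?X P x) + ?E"
    unfolding cut_def split sum.distrib ..
  also have "(\<Sum>x\<in>P. ?X P x) = (\<Sum>x\<in>?P. ?X P x) + (\<Sum>x\<in>?Q. ?X P x)"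
    using sum.union_disjoint[OF finP disj, of "?X P"] P by simp
  also have "(\<Sum>x\<in>?P. ?X P x) = cut J ?P" unfolding cut_def by (rule sum.cong[OF refl X1])
  also have "(\<Sum>x\<in>?Q. ?X P x) = cut J ?Q" unfolding cut_def by (rule sum.cong[OF refl X2])
  finally have cut: "cut (insert a J) P = cut J ?P + cut J ?Q + ?E" .
  have E: "?E = card {x\<in>P. flip a x \<notin> P}"
    using finPP by (simp add: of_bool_def sum.If_cases Int_def)
  have sideE: "card C \<le> card C' + card {x\<in>P. flip a x \<notin> P}"
    if "C \<subseteq> P" "finite C" "finite C'" "\<And>x. x \<in> C \<Longrightarrow> flip a x \<in> P \<Longrightarrow> flip a x \<in> C'" for C C'
  proof -
    have "flip a ` C \<subseteq> C' \<union> flip a ` {x\<in>P. flip a x \<notin> P}" using that by auto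
    then have "card (flip a ` C) \<le> card (C' \<union> flip a ` {x\<in>P. flip a x \<notin> P})"
      using that finPP by (intro card_mono) auto
    also have "\<dots> \<le> card C' + card (flip a ` {x\<in>P. flip a x \<notin> P})" by (rule card_Un_le)
    finally show ?thesis by (simp add: card_image inj_on_def)
  qed
  have inA: "flip a x \<in> ?B" if "x \<in> ?A" for x
    using that insert.hyps by (auto simp: cube_def set_eq_iff mem_flip)
  have inB: "flip a x \<in> ?A" if "x \<in> ?B" for x
    using that insert.hyps by (auto simp: cube_def set_eq_iff mem_flip)
  have e1: "card ?P \<le> card ?Q + ?E" unfolding E by (rule sideE) (use finP inA in auto)
  have e2: "card ?Q \<le> card ?P + ?E" unfolding E by (rule sideE) (use finP inB in auto)
  have IH1: "min (card ?P) (2 ^ card J - card ?P) \<le> cut J ?P" by (rule insert.IH[OF Int_lower2])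
  have IH2: "min (card ?Q) (2 ^ card J - card ?Q) \<le> cut J ?Q" by (rule insert.IH[OF Int_lower2])
  have c: "(2::nat) ^ card (insert a J) = 2 * 2 ^ card J" using insert.hyps by simp
  define M where "M = (2::nat) ^ card J"
  \<comment> \<open>With sizes p and q in halves of M vertices: if both are at most M/2, or both at
    least M/2, the two induction hypotheses add up. If p \<le> M/2 \<le> q, the total is at least p
    + (M - q) + (q - p) = M.\<close>
  show ?case
    unfolding cP cut c using le e1 e2 IH1 IH2 unfolding M_def[symmetric] min_def
    by (auto split: if_splits)
qed

text \<open>A boundary vertex carries at most \<open>card J\<close> boundary edges, so passing from
  edges to vertices costs one factor of the dimension.\<close>

lemma vertex_boundary:
  assumes "finite J" "P \<subseteq> cube v J"
  shows "min (card P) (2 ^ card J - card P) \<le> card {x\<in>P. \<exists>i\<in>J. flip i x \<notin> P} * card J"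
proof -
  have finP: "finite P" by (rule finite_subset[OF assms(2)]) (simp add: assms)
  have "cut J P \<le> (\<Sum>x\<in>P. of_bool (\<exists>i\<in>J. flip i x \<notin> P) * card J)"
    unfolding cut_def
  proof (rule sum_mono)
    fix x
    show "card {i\<in>J. flip i x \<notin> P} \<le> of_bool (\<exists>i\<in>J. flip i x \<notin> P) * card J"
    proof (cases "\<exists>i\<in>J. flip i x \<notin> P")
      case False
      then have "{i\<in>J. flip i x \<notin> P} = {}" by auto
      then show ?thesis by (simp only: card.empty le0)
    qed (use card_mono[OF assms(1), of "{i\<in>J. flip i x \<notin> P}"] in auto)
  qed
  also have "\<dots> = card {x\<in>P. \<exists>i\<in>J. flip i x \<notin> P} * card J"
    unfolding sum_distrib_right[symmetric] using finP by (simp add: of_bool_def sum.If_cases Int_def)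
  finally show ?thesis using edge_isoperimetry[OF assms] by linarith
qed

section \<open>Touching large clusters\<close>

definition touches :: "nat set set \<Rightarrow> real \<Rightarrow> nat set \<Rightarrow> bool" where
  "touches R s u \<longleftrightarrow> (\<exists>w\<in>large R s. adj u w)"

abbreviation touching_pairs where
  "touching_pairs T dirs s R \<equiv> {(t, i). (t, i) \<in> Sigma T dirs \<and> touches R s (flip i t)}"

text \<open>\<open>T\<close> has at most \<gamma> d vertices because telling them apart may use up
  as many coordinates. For |T| of order d the failure probability is exp(-\<Omega>(d^2)), small
  enough for a union bound over connected sets.\<close>

definition batch_bound :: "real \<Rightarrow> nat \<Rightarrow> real \<Rightarrow> real \<Rightarrow> nat \<Rightarrow> bool" where
  "batch_bound \<epsilon> j c \<gamma> D \<longleftrightarrow> (\<forall>J v T dirs. \<forall>p::real. finite J \<and> D \<le> card J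
      \<and> 0 \<le> p \<and> p \<le> 1 \<and> 1 + \<epsilon> \<le> p * real (card J) \<and> T \<subseteq> cube v J \<and> real (card T) \<le> \<gamma> * real (card J)
      \<and> (\<forall>t\<in>T. dirs t \<subseteq> J \<and> 4 * \<gamma> * real (card J) \<le> real (card (dirs t))) \<longrightarrow>
     sprob (cube v J) p (\<lambda>R. real (card (touching_pairs T dirs (c * real (card J) ^ j) R))
        < c * real (card T) * real (card J)) \<le> exp (- (c * real (card T) * real (card J))))"

text \<open>The vertex \<open>flip i t\<close> need not lie in \<open>R\<close>, so a trial succeeds
  with probability bounded below instead of one of order p; this makes the exponent quadratic. Its
  cluster has order d^(j+1), and by pigeonhole one of its neighbours has a cluster of order
  d^j.\<close>

lemma batch:
  fixes \<epsilon> :: real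
  assumes "0 < \<epsilon>"
  shows "\<exists>c>0. \<exists>\<gamma>>0. \<gamma> \<le> 1 / 72 \<and> (\<exists>D. batch_bound \<epsilon> j c \<gamma> D)"
proof -
  define e where "e = min \<epsilon> 1"
  have e: "0 < e" "e \<le> 1" "e \<le> \<epsilon>" using assms by (auto simp: e_def)
  then have e2: "0 < e / 2" by simp
  obtain c2 D2 where c2: "0 < c2" and D2: "\<And>J v p. finite J \<Longrightarrow> D2 \<le> card J \<Longrightarrow> 0 \<le> p \<Longrightarrow>
      p \<le> 1 \<Longrightarrow> 1 + e / 2 \<le> p * real (card J) \<Longrightarrow>
      c2 \<le> sprob (cube v J) p (\<lambda>R. c2 * real (card J) ^ Suc j \<le> card (cluster R v))"
    using grows[of j] e2 unfolding grows_def by meson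
  \<comment> \<open>Distinguishing coordinates (at most \<gamma> d) and chosen directions (at most 2
    \<gamma> d) stay below e * d / 4. The entry 1/72 gives 4 \<gamma> \<le> 1/18, the fraction that
    \<open>private_directions\<close> supplies. In \<open>c\<close>, the first entry is the
    threshold of \<open>few_successes\<close>; the second pays for (d/2)^(j+1) with a factor 4 to
    spare.\<close>
  define \<gamma> where "\<gamma> = min (e / 16) (1 / 72)"
  define c where "c = min (c2 * \<gamma> / 4) (c2 / 2 ^ (j + 3))"
  have pos: "0 < \<gamma>" "\<gamma> \<le> e / 16" "\<gamma> \<le> 1 / 72" "0 < c" "c \<le> c2 * \<gamma> / 4" "c \<le> c2 / 2 ^ (j + 3)"
    using e c2 by (auto simp: \<gamma>_def c_def)
  define D where "D = nat \<lceil>1 / \<gamma> + real (2 * D2) + 2 ^ (j + 3) / c2 + 1\<rceil>"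
  show ?thesis
    unfolding batch_bound_def
  proof (rule exI[of _ c], intro conjI exI[of _ \<gamma>] exI[of _ D] allI impI)
    show "0 < c" "0 < \<gamma>" "\<gamma> \<le> 1 / 72" using pos by auto
    fix J v T dirs and p :: real
    assume asm: "finite J \<and> D \<le> card J
      \<and> 0 \<le> p \<and> p \<le> 1 \<and> 1 + \<epsilon> \<le> p * real (card J) \<and> T \<subseteq> cube v J \<and> real (card T) \<le> \<gamma> * real (card J)
      \<and> (\<forall>t\<in>T. dirs t \<subseteq> J \<and> 4 * \<gamma> * real (card J) \<le> real (card (dirs t)))"
    then have J: "finite J" and p: "0 \<le> p" "p \<le> 1" and TV: "T \<subseteq> cube v J" by auto
    have dirs: "dirs t \<subseteq> J" "4 * \<gamma> * real (card J) \<le> real (card (dirs t))" if "t \<in> T" for t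
      using asm that by auto
    define d where "d = real (card J)"
    have "1 / \<gamma> + real (2 * D2) + 2 ^ (j + 3) / c2 + 1 \<le> d"
      using asm unfolding D_def d_def by linarith
    moreover have "0 < 1 / \<gamma>" "0 < 2 ^ (j + 3) / c2" using pos c2 by auto
    ultimately have d: "1 / \<gamma> \<le> d" "2 * real D2 \<le> d" "2 ^ (j + 3) / c2 < d" "1 \<le> d" by linarith+
    have gd: "1 \<le> \<gamma> * d" using d(1) pos by (simp add: field_simps)
    have Td: "real (card T) \<le> \<gamma> * d" using asm by (simp add: d_def)
    have pd: "1 + e \<le> p * d" using asm e by (simp add: d_def)
    note pe = supercritical_rescale[OF e(1,2) p(1) pd]
    define g where "g = nat \<lceil>\<gamma> * d\<rceil>"
    have g: "\<gamma> * d \<le> real g" "real g \<le> 2 * (\<gamma> * d)"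
      unfolding g_def using gd by (linarith, linarith)
    let ?V = "cube v J"
    have finV: "finite ?V" using J by simp
    have finT: "finite T" by (rule finite_subset[OF TV finV])
    obtain I where I: "I \<subseteq> J" "finite I" "card I \<le> card T" "inj_on (\<lambda>t. t \<inter> I) T"
      using distinguishing_coordinates[OF finT TV] by auto
    have "\<exists>D'. D' \<subseteq> dirs t - I \<and> card D' = g \<and> finite D'" if t: "t \<in> T" for t
    proof -
      have "finite (dirs t)" by (rule finite_subset[OF dirs(1)[OF t] J])
      have "card (dirs t) - card I \<le> card (dirs t - I)" by (rule diff_card_le_card_Diff[OF I(2)])
      then have "real (card (dirs t)) - real (card I) \<le> real (card (dirs t - I))" by linarith
      then have "g \<le> card (dirs t - I)"
        using dirs(2)[OF t] I(3) Td g(2) gd unfolding d_def[symmetric] by linarith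
      then show ?thesis using obtain_subset_with_card_n by metis
    qed
    then obtain D' where D': "\<And>t. t \<in> T \<Longrightarrow> D' t \<subseteq> dirs t - I" "\<And>t. t \<in> T \<Longrightarrow> card (D' t) = g"
      "\<And>t. t \<in> T \<Longrightarrow> finite (D' t)" by metis
    define J2 where "J2 t = J - I - D' t" for t
    have J2: "finite (J2 t)" "J2 t \<subseteq> J" "I \<inter> J2 t = {}" "D' t \<inter> J2 t = {}" for t
      using J by (auto simp: J2_def)
    have dJ2: "d - e * d / 4 \<le> real (card (J2 t))" "d / 2 \<le> real (card (J2 t))" if t: "t \<in> T" for t
    proof -
      have "card J - card I \<le> card (J - I)" by (rule diff_card_le_card_Diff[OF I(2)])
      moreover have "card (J - I) - card (D' t) \<le> card (J2 t)"
        unfolding J2_def by (rule diff_card_le_card_Diff[OF D'(3)[OF t]])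
      ultimately have "d - real (card I) - real g \<le> real (card (J2 t))"
        using D'(2)[OF t] unfolding d_def by linarith
      then have a: "d - 3 * (\<gamma> * d) \<le> real (card (J2 t))" using I(3) Td g by linarith
      have "\<gamma> * d \<le> e / 16 * d" "\<gamma> * d \<le> 1 / 72 * d" using pos d by (auto intro: mult_right_mono)
      moreover have "0 \<le> e * d" using e d by simp
      ultimately show "d - e * d / 4 \<le> real (card (J2 t))" "d / 2 \<le> real (card (J2 t))"
        using a d(4) by linarith+
    qed
    define U where "U = Sigma T D'"
    define Q where "Q = (\<lambda>(t, i). cube (flip i t) (J2 t))"
    define S where "S = (\<lambda>(t, i) Y. c2 * real (card (J2 t)) ^ Suc j \<le> card (cluster Y (flip i t)))"
    have finU: "finite U" using finT D'(3) by (simp add: U_def)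
    have cU: "card U = card T * g" using finT D'(2,3) by (simp add: U_def)
    have sp: "c2 \<le> sprob (Q u) p (S u)" if uU: "u \<in> U" for u
    proof -
      obtain t i where u: "u = (t, i)" "t \<in> T" using uU by (auto simp: U_def)
      show ?thesis unfolding u(1) Q_def S_def case_prod_conv
      proof (rule D2)
        show "D2 \<le> card (J2 t)" using dJ2(2)[OF u(2)] d(2) by linarith
        show "1 + e / 2 \<le> p * real (card (J2 t))" by (rule pe[OF dJ2(1)[OF u(2)]])
      qed (use J2 p in auto)
    qed
    have QV: "Q u \<subseteq> ?V" if uU: "u \<in> U" for u
    proof -
      obtain t i where u: "u = (t, i)" "t \<in> T" "i \<in> D' t" using uU by (auto simp: U_def)
      have "i \<in> J" using D'(1)[OF u(2)] dirs(1)[OF u(2)] u(3) by auto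
      then have "flip i t \<in> ?V" using u(2) TV by auto
      then show ?thesis unfolding u(1) Q_def case_prod_conv using J2(2) by (rule cube_mono)
    qed
    have disj: "disjoint_family_on Q U"
      unfolding Q_def U_def by (rule disjoint_subcubes[OF I(4) _ J2(3,4)]) (use D'(1) in blast)
    let ?N = "\<lambda>R. card {u\<in>U. S u (R \<inter> Q u)}"
    let ?s = "c * d ^ j"
    have hit: "touches R ?s (flip i t)" if R: "R \<subseteq> ?V" and u: "(t, i) \<in> U" "S (t, i) (R \<inter> Q (t, i))" for R t i
    proof -
      have t: "t \<in> T" using u(1) by (simp add: U_def)
      have RV: "finite R" by (rule finite_subset[OF R finV])
      have s0: "0 \<le> ?s" using pos d by simp
      have "card (J2 t) \<le> card J" by (rule card_mono[OF J J2(2)])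
      then have "real (card (J2 t)) * ?s \<le> d * ?s" unfolding d_def using s0 by (intro mult_right_mono) (auto simp: d_def)
      also have "\<dots> \<le> d * (c2 / 2 ^ (j + 3) * d ^ j)"
        using pos d by (intro mult_left_mono mult_right_mono) auto
      finally have 1: "real (card (J2 t)) * ?s \<le> c2 / 2 ^ (j + 3) * d ^ Suc j" by (simp add: algebra_simps)
      have "1 < c2 / 2 ^ (j + 3) * d"
        using d(3) c2 by (simp add: field_simps)
      also have "\<dots> \<le> c2 / 2 ^ (j + 3) * d ^ Suc j"
        using d(4) c2 self_le_power[of d "Suc j"] by (intro mult_left_mono) auto
      finally have 2: "1 < c2 / 2 ^ (j + 3) * d ^ Suc j" .
      have half: "c2 * (d / 2) ^ Suc j = c2 / 2 ^ Suc j * d ^ Suc j" by (simp add: power_divide)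
      have quarter: "c2 / 2 ^ (j + 3) * d ^ Suc j = (c2 / 2 ^ Suc j * d ^ Suc j) / 4" by (simp add: power_add)
      have "0 \<le> c2 / 2 ^ Suc j * d ^ Suc j" using c2 d by simp
      moreover have "1 + x < z" if "0 \<le> z" "x \<le> z / 4" "1 < z / 4" for x z :: real
        using that by linarith
      ultimately have "1 + real (card (J2 t)) * ?s < c2 * (d / 2) ^ Suc j"
        using 1 2 unfolding half quarter by blast
      also have "\<dots> \<le> c2 * real (card (J2 t)) ^ Suc j"
        using c2 d dJ2(2)[OF t] by (intro mult_left_mono power_mono) auto
      also have "\<dots> \<le> card (cluster (R \<inter> Q (t, i)) (flip i t))" using u(2) by (simp add: S_def)
      finally have "\<exists>w\<in>large (R \<inter> Q (t, i)) ?s. adj (flip i t) w"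
        by (intro adj_large[OF J2(1)[of t] _ _ s0]) (auto simp: Q_def)
      then show ?thesis unfolding touches_def using large_mono[OF Int_lower1 RV] by blast
    qed
    have N: "4 * (c * real (card T) * d) \<le> c2 * real (card U)"
    proof -
      have "4 * c * (real (card T) * d) \<le> c2 * \<gamma> * (real (card T) * d)"
        using pos d by (intro mult_right_mono) auto
      also have "\<dots> = c2 * real (card T) * (\<gamma> * d)" by simp
      also have "\<dots> \<le> c2 * real (card T) * real g" using c2 g by (intro mult_left_mono) auto
      finally show ?thesis unfolding cU by (simp add: algebra_simps)
    qed
    \<comment> \<open>That c2 is at most 1 is read off from the probability of a trial, so the case
      without trials is treated apart; there the event asks for a negative number of
      successes.\<close>
    have c21: "c2 \<le> 1" if "u \<in> U" for u
      using sp[OF that] sprob_le_1[OF p finite_subset[OF QV[OF that] finV]] by (rule order_trans)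
    have "sprob ?V p (\<lambda>R. real (card (touching_pairs T dirs ?s R))
        < c * real (card T) * d) \<le> sprob ?V p (\<lambda>R. real (?N R) < c2 * card U / 4)"
    proof (rule sprob_mono[OF p])
      fix R assume R: "R \<subseteq> ?V" and lt: "real (card (touching_pairs T dirs ?s R))
        < c * real (card T) * d"
      have "finite (Sigma T dirs)"
        by (rule finite_SigmaI[OF finT]) (rule finite_subset[OF dirs(1) J])
      then have "finite (touching_pairs T dirs ?s R)"
        by (rule finite_subset[rotated]) auto
      moreover have "{u\<in>U. S u (R \<inter> Q u)} \<subseteq> (touching_pairs T dirs ?s R)"
      proof
        fix u assume u: "u \<in> {u\<in>U. S u (R \<inter> Q u)}"
        obtain t i where ti: "u = (t, i)" by (cases u)
        have "touches R ?s (flip i t)" by (rule hit[OF R]) (use u ti in auto)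
        moreover have "t \<in> T" "i \<in> dirs t" using u ti D'(1)[of t] by (auto simp: U_def)
        ultimately show "u \<in> (touching_pairs T dirs ?s R)"
          using ti by simp
      qed
      ultimately have "?N R \<le> card (touching_pairs T dirs ?s R)"
        by (rule card_mono)
      then show "real (?N R) < c2 * card U / 4" using lt N by linarith
    qed
    also have "\<dots> \<le> exp (- (c * real (card T) * d))"
    proof (cases "U = {}")
      case True
      have "sprob ?V p (\<lambda>R. real (?N R) < c2 * card U / 4) \<le> sprob ?V p (\<lambda>R. False)"
        by (rule sprob_mono[OF p]) (simp add: True)
      also have "\<dots> = 0" using finV by (simp add: sprob_def expect_const)
      finally show ?thesis by (rule order_trans) simp
    next
      case False
      then have "c2 \<le> 1" using c21 by auto
      then have "sprob ?V p (\<lambda>R. real (?N R) < c2 * card U / 4) \<le> exp (- c2 * card U / 4)"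
        using c2 by (intro few_successes[OF finV finU p QV disj sp]) auto
      also have "\<dots> \<le> exp (- (c * real (card T) * d))" using N by simp
      finally show ?thesis .
    qed
    finally show "sprob ?V p (\<lambda>R. real (card (touching_pairs T dirs (c * real (card J) ^ j) R)) < c * real (card T) * real (card J))
        \<le> exp (- (c * real (card T) * real (card J)))"
      by (simp only: d_def)
  qed
qed

text \<open>Contains all connected sets of \<open>Suc k\<close> vertices, but also smaller ones, as \<open>flip i x\<close> may be old.\<close>

primrec conn :: "nat set \<Rightarrow> nat set \<Rightarrow> nat \<Rightarrow> nat set set set" where
  "conn v J 0 = (\<lambda>x. {x}) ` cube v J"
| "conn v J (Suc k) = (\<Union>S\<in>conn v J k. (\<lambda>(x, i). insert (flip i x) S) ` (S \<times> J))"

lemma conn_props: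
  assumes "S \<in> conn v J k"
  shows "S \<subseteq> cube v J" "finite S" "card S \<le> Suc k"
proof -
  have "S \<subseteq> cube v J \<and> finite S \<and> card S \<le> Suc k"
    using assms
  proof (induction k arbitrary: S)
    case (Suc k)
    then obtain S' x i where S': "S' \<in> conn v J k" "x \<in> S'" "i \<in> J" "S = insert (flip i x) S'" by auto
    then show ?case using Suc.IH[OF S'(1)] by (auto simp: card_insert_if)
  qed auto
  then show "S \<subseteq> cube v J" "finite S" "card S \<le> Suc k" by auto
qed

lemma finite_conn: "finite J \<Longrightarrow> finite (conn v J k)"
  by (induction k) (auto intro!: finite_cartesian_product conn_props)

text \<open>A root, then k times a vertex of the current set and a direction. For k of order d this
  crude count is exp(O(d log d)), negligible against exp(\<Omega>(d^2)).\<close>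

lemma card_conn_le:
  assumes "finite J"
  shows "card (conn v J k) \<le> 2 ^ card J * (Suc k * card J) ^ k"
proof (induction k)
  case 0
  have "card (conn v J 0) \<le> card (cube v J)" unfolding conn.simps by (rule card_image_le) (simp add: assms)
  then show ?case by (simp add: card_cube assms)
next
  case (Suc k)
  let ?B = "\<lambda>S. (\<lambda>(x, i). insert (flip i x) S) ` (S \<times> J)"
  have "card (conn v J (Suc k)) \<le> (\<Sum>S\<in>conn v J k. card (?B S))"
    unfolding conn.simps by (rule card_UN_le[OF finite_conn[OF assms]])
  also have "\<dots> \<le> (\<Sum>S\<in>conn v J k. Suc k * card J)"
  proof (rule sum_mono)
    fix S assume S: "S \<in> conn v J k"
    have "card (?B S) \<le> card (S \<times> J)"
      by (rule card_image_le) (use assms conn_props[OF S] in auto)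
    also have "\<dots> \<le> Suc k * card J"
      unfolding card_cartesian_product by (rule mult_right_mono[OF conn_props(3)[OF S]]) simp
    finally show "card (?B S) \<le> Suc k * card J" .
  qed
  also have "\<dots> = card (conn v J k) * (Suc k * card J)" by simp
  also have "\<dots> \<le> (2 ^ card J * (Suc k * card J) ^ k) * (Suc k * card J)"
    by (rule mult_right_mono[OF Suc.IH]) simp
  also have "\<dots> = 2 ^ card J * (Suc k * card J) ^ Suc k" by simp
  also have "\<dots> \<le> 2 ^ card J * (Suc (Suc k) * card J) ^ Suc k"
    by (intro mult_left_mono power_mono mult_right_mono) auto
  finally show ?case .
qed

text \<open>A set containing \<open>x\<close> that is not yet the whole cluster has an edge leaving
  it into \<open>R\<close>, otherwise it would be closed and contain the cluster. Hence the set can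
  grow by a genuinely new vertex each time.\<close>

lemma conn_in_cluster:
  assumes "finite J" "R \<subseteq> cube v J" "x \<in> cube v J" "k < card (cluster R x)"
  shows "\<exists>S\<in>conn v J k. S \<subseteq> cluster R x \<and> card S = Suc k \<and> x \<in> S"
  using assms(4)
proof (induction k)
  case 0
  then show ?case using assms(3) by (intro bexI[of _ "{x}"]) auto
next
  case (Suc k)
  then obtain S where S: "S \<in> conn v J k" "S \<subseteq> cluster R x" "card S = Suc k" "x \<in> S" by auto
  have "\<not> cluster R x \<subseteq> S"
    using card_mono[OF conn_props(2)[OF S(1)], of "cluster R x"] S(3) Suc.prems by auto
  have "\<exists>y z. y \<in> S \<and> adj y z \<and> z \<in> R \<and> z \<notin> S"
  proof (rule ccontr)
    assume neg: "\<not> ?thesis"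
    have "y \<in> S" if "y \<in> cluster R x" for y
      using that by (induction rule: cluster_induct) (use S(4) neg in blast)+
    then show False using \<open>\<not> cluster R x \<subseteq> S\<close> by blast
  qed
  then obtain y z where yz: "y \<in> S" "adj y z" "z \<in> R" "z \<notin> S" by blast
  have "y \<in> cube v J" "z \<in> cube v J" using yz conn_props(1)[OF S(1)] assms(2) by auto
  then obtain i where i: "i \<in> J" "z = flip i y" using adj_in_cubeE[OF yz(2)] by metis
  have zc: "z \<in> cluster R x" by (rule cluster_step[OF _ yz(2,3)]) (use yz(1) S(2) in blast)
  have "insert z S \<in> conn v J (Suc k)" unfolding conn.simps
    using S(1) yz(1) i by force
  moreover have "insert z S \<subseteq> cluster R x" using zc S(2) by simp
  moreover have "card (insert z S) = Suc (Suc k)" using yz(4) S(3) conn_props(2)[OF S(1)] by simp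
  moreover have "x \<in> insert z S" using S(4) by simp
  ultimately show ?case by blast
qed

lemma touches_antimono: "touches R s u \<Longrightarrow> s' \<le> s \<Longrightarrow> touches R s' u"
  unfolding touches_def large_def by force

lemma equal_blocks:
  assumes "finite X" "m * h \<le> card X"
  shows "\<exists>B. (\<forall>i<m. B i \<subseteq> X \<and> card (B i) = h) \<and> disjoint_family_on B {..<m}"
  using assms
proof (induction m arbitrary: X)
  case 0
  then show ?case by (auto simp: disjoint_family_on_def)
next
  case (Suc m)
  then have "h \<le> card X" by simp
  then obtain Y where Y: "Y \<subseteq> X" "card Y = h" "finite Y" using obtain_subset_with_card_n by metis
  have "m * h \<le> card (X - Y)" using Suc.prems Y by (simp add: card_Diff_subset)
  then obtain B where B: "\<And>i. i < m \<Longrightarrow> B i \<subseteq> X - Y \<and> card (B i) = h" "disjoint_family_on B {..<m}"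
    using Suc.IH[of "X - Y"] Suc.prems by auto
  let ?B = "B(m := Y)"
  have "disjoint_family_on ?B {..<Suc m}"
    unfolding disjoint_family_on_def
  proof (intro ballI impI)
    fix i j assume ij: "i \<in> {..<Suc m}" "j \<in> {..<Suc m}" "i \<noteq> j"
    then consider "i < m" "j < m" | "i = m" "j < m" | "i < m" "j = m" by fastforce
    then show "?B i \<inter> ?B j = {}"
    proof cases
      case 1
      then show ?thesis using B(2) ij by (auto simp: disjoint_family_on_def)
    next
      case 2
      then show ?thesis using B(1)[of j] by auto
    next
      case 3
      then show ?thesis using B(1)[of i] by auto
    qed
  qed
  moreover have "\<forall>i<Suc m. ?B i \<subseteq> X \<and> card (?B i) = h"
    using B(1) Y by (auto simp: less_Suc_eq)
  ultimately show ?case by blast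
qed

text \<open>The bad event of the first round. The first alternative would spoil the attaching of
  components; the second would leave a vertex without a walk of length 3 into a large cluster, as
  needed for merging.\<close>

abbreviation untouched ::
    "nat set \<Rightarrow> nat set \<Rightarrow> nat \<Rightarrow> real \<Rightarrow> real \<Rightarrow> nat set set \<Rightarrow> bool" where
  "untouched v J k s a R \<equiv>
      (\<exists>S\<in>{S\<in>conn v J k. card S = Suc k}. real (card {u\<in>\<Union> (nbrs J ` S). touches R s u}) < a)
    \<or> (\<exists>x\<in>cube v J. \<forall>t\<in>nbrs J x. \<forall>i\<in>J. \<not> touches R s (flip i t))"

text \<open>The lower bound on \<open>Suc k\<close> makes the vertices with private directions fill
  at least two batches; the upper bound is the range of the neighbourhood estimate. The first term
  of the estimate is sets times batches times failure of a batch, the second has one batch for each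
  vertex of the cube.\<close>

definition touching_bound :: "real \<Rightarrow> nat \<Rightarrow> real \<Rightarrow> real \<Rightarrow> nat \<Rightarrow> bool" where
  "touching_bound \<epsilon> j c \<gamma> D \<longleftrightarrow> (\<forall>J v k. \<forall>p::real. finite J \<and> D \<le> card J
      \<and> 0 \<le> p \<and> p \<le> 1 \<and> 1 + \<epsilon> \<le> p * real (card J) \<and> 36 * \<gamma> * real (card J) \<le> real (Suc k)
      \<and> 4 * Suc k \<le> (card J)\<^sup>2 \<longrightarrow>
     sprob (cube v J) p (untouched v J k (c * real (card J) ^ j) (c * real (Suc k) * real (card J)))
     \<le> 2 ^ card J * (real (Suc k) * real (card J)) ^ k * real (Suc k) * exp (- (c * real (card J) * real (card J)))
       + 2 ^ card J * exp (- (c * real (card J) * real (card J))))"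

text \<open>A connected set of order Kd is too large for one batch, so its vertices with private
  directions are cut into blocks of \<open>h\<close> vertices. If no block fails, the hits add up in
  proportion to the size of the set.\<close>

lemma touching_structure:
  fixes \<epsilon> :: real
  assumes "0 < \<epsilon>"
  shows "\<exists>c>0. \<exists>\<gamma>>0. \<exists>D. touching_bound \<epsilon> j c \<gamma> D"
proof -
  obtain c0 \<gamma> D0 where c0: "0 < c0" and \<gamma>: "0 < \<gamma>" "\<gamma> \<le> 1 / 72" and H: "batch_bound \<epsilon> j c0 \<gamma> D0"
    using batch[OF assms] by blast
  have batch: "sprob (cube v J) p (\<lambda>R. real (card (touching_pairs T dirs (c0 * real (card J) ^ j) R))
        < c0 * real (card T) * real (card J)) \<le> exp (- (c0 * real (card T) * real (card J)))"
    if "finite J" "D0 \<le> card J" "0 \<le> p" "p \<le> 1" "1 + \<epsilon> \<le> p * real (card J)"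
      "T \<subseteq> cube v J" "real (card T) \<le> \<gamma> * real (card J)"
      "\<And>t. t \<in> T \<Longrightarrow> dirs t \<subseteq> J \<and> 4 * \<gamma> * real (card J) \<le> real (card (dirs t))" for J v T dirs p
    by (rule H[unfolded batch_bound_def, rule_format]) (use that in auto)
  \<comment> \<open>36 is 18 * 2: \<open>S'\<close> keeps 1/18 of \<open>S\<close>, and the full
    blocks cover half of \<open>S'\<close>. The other entry comes from h \<ge> \<gamma> d / 2 and
    bounds the failure of a block by exp(-c d^2).\<close>
  define c where "c = min (c0 / 36) (c0 * \<gamma> / 2)"
  have c: "0 < c" "c \<le> c0 / 36" "c \<le> c0 * \<gamma> / 2" using c0 \<gamma> by (auto simp: c_def)
  define D where "D = max D0 (nat \<lceil>2 / \<gamma>\<rceil>)"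
  show ?thesis
    unfolding touching_bound_def
  proof (rule exI[of _ c], intro conjI exI[of _ \<gamma>] exI[of _ D] allI impI)
    show "0 < c" "0 < \<gamma>" using c \<gamma> by auto
    fix J v :: "nat set" and k :: nat and p :: real
    assume asm: "finite J \<and> D \<le> card J
      \<and> 0 \<le> p \<and> p \<le> 1 \<and> 1 + \<epsilon> \<le> p * real (card J) \<and> 36 * \<gamma> * real (card J) \<le> real (Suc k) \<and> 4 * Suc k \<le> (card J)\<^sup>2"
    then have J: "finite J" and p: "0 \<le> p" "p \<le> 1" and D0: "D0 \<le> card J" and pd: "1 + \<epsilon> \<le> p * real (card J)"
      by (auto simp: D_def)
    define d where "d = real (card J)"
    have "nat \<lceil>2 / \<gamma>\<rceil> \<le> card J" using asm by (simp add: D_def)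
    then have "2 / \<gamma> \<le> d" unfolding d_def by linarith
    then have gd: "2 \<le> \<gamma> * d" using \<gamma> by (simp add: field_simps)
    then have "d \<noteq> 0" by auto
    then have d: "0 < d" by (simp add: d_def)
    have Jne: "J \<noteq> {}" using d by (auto simp: d_def)
    define h where "h = nat \<lfloor>\<gamma> * d\<rfloor>"
    have h: "real h \<le> \<gamma> * d" "\<gamma> * d / 2 \<le> real h" "0 < h"
      unfolding h_def using gd by (linarith, linarith, linarith)
    let ?V = "cube v J"
    have finV: "finite ?V" using J by simp
    let ?s = "c * d ^ j" and ?sb = "c0 * d ^ j"
    have "c \<le> c0" using c c0 by linarith
    then have ss: "?s \<le> ?sb" using d by (intro mult_right_mono) auto
    have ch: "c * d * d \<le> c0 * real h * d"
    proof -
      have "c * (d * d) \<le> c0 * \<gamma> / 2 * (d * d)" using c d by (intro mult_right_mono) auto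
      also have "\<dots> = c0 * (\<gamma> * d / 2) * d" by simp
      also have "\<dots> \<le> c0 * real h * d" using h c0 d by (intro mult_right_mono mult_left_mono) auto
      finally show ?thesis by (simp add: mult.assoc)
    qed
    have batch': "sprob ?V p (\<lambda>R. real (card (touching_pairs T dirs ?sb R))
        < c0 * real h * d) \<le> exp (- (c * d * d))"
      if "T \<subseteq> ?V" "card T = h" "\<And>t. t \<in> T \<Longrightarrow> dirs t \<subseteq> J \<and> 4 * \<gamma> * d \<le> real (card (dirs t))" for T dirs
    proof -
      have "sprob ?V p (\<lambda>R. real (card (touching_pairs T dirs ?sb R))
        < c0 * real h * d) \<le> exp (- (c0 * real h * d))"
        using batch[OF J D0 p pd that(1), of dirs] that(2,3) h(1) by (simp add: d_def)
      also have "\<dots> \<le> exp (- (c * d * d))" using ch by simp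
      finally show ?thesis .
    qed
    have one: "sprob ?V p (\<lambda>R. real (card {u\<in>\<Union> (nbrs J ` S). touches R ?s u}) < c * real (Suc k) * d)
        \<le> real (Suc k) * exp (- (c * d * d))" if S: "S \<in> conn v J k" "card S = Suc k" for S
    proof -
      note SV = conn_props(1)[OF S(1)]
      have "4 * card S \<le> (card J)\<^sup>2" using asm S(2) by simp
      from private_directions[OF J SV this Jne] obtain S' dirs where S': "S' \<subseteq> S"
        "real (card S) / 18 \<le> real (card S')" "\<And>t. t \<in> S' \<Longrightarrow> dirs t \<subseteq> J"
        "\<And>t. t \<in> S' \<Longrightarrow> real (card J) / 18 \<le> real (card (dirs t))"
        "inj_on (\<lambda>(t, i). flip i t) (Sigma S' dirs)" by metis
      have finS': "finite S'" by (rule finite_subset[OF S'(1) conn_props(2)[OF S(1)]])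
      define m where "m = card S' div h"
      have mh: "m * h \<le> card S'" by (simp add: m_def)
      have "2 * (\<gamma> * d) \<le> real (card S')" using asm S'(2) S(2) unfolding d_def by linarith
      then have "2 * real h \<le> real (card S')" using h by linarith
      moreover have "card S' \<le> m * h + h"
        using div_mult_mod_eq[of "card S'" h] mod_less_divisor[OF h(3), of "card S'"] unfolding m_def by linarith
      then have "real (card S') \<le> real (m * h) + real h" by (metis of_nat_add of_nat_le_iff)
      ultimately have mh2: "real (card S') / 2 \<le> real (m * h)" by linarith
      have mk: "m \<le> Suc k"
      proof -
        have "m \<le> card S'" by (simp add: m_def)
        also have "\<dots> \<le> card S" by (rule card_mono[OF conn_props(2)[OF S(1)] S'(1)])
        finally show ?thesis using S(2) by simp
      qed
      obtain B where B: "\<And>i. i < m \<Longrightarrow> B i \<subseteq> S'" "\<And>i. i < m \<Longrightarrow> card (B i) = h"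
        "disjoint_family_on B {..<m}" using equal_blocks[OF finS' mh] by metis
      let ?A = "\<lambda>R b. (touching_pairs (B b) dirs ?sb R)"
      have finA: "finite (?A R b)" if "b < m" for R b
      proof -
        have "finite (Sigma (B b) dirs)"
        proof (rule finite_SigmaI)
          show "finite (B b)" by (rule finite_subset[OF B(1)[OF that] finS'])
          fix t assume "t \<in> B b"
          then have "dirs t \<subseteq> J" using B(1)[OF that] S'(3) by blast
          then show "finite (dirs t)" using J by (rule finite_subset)
        qed
        then show ?thesis by (rule finite_subset[rotated]) auto
      qed
      have "sprob ?V p (\<lambda>R. real (card {u\<in>\<Union> (nbrs J ` S). touches R ?s u}) < c * real (Suc k) * d)
          \<le> sprob ?V p (\<lambda>R. \<exists>b\<in>{..<m}. real (card (?A R b)) < c0 * real h * d)"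
      proof (rule sprob_mono[OF p], rule ccontr)
        fix R assume lt: "real (card {u\<in>\<Union> (nbrs J ` S). touches R ?s u}) < c * real (Suc k) * d"
          and "\<not> (\<exists>b\<in>{..<m}. real (card (?A R b)) < c0 * real h * d)"
        then have ge: "c0 * real h * d \<le> real (card (?A R b))" if "b \<in> {..<m}" for b
          using that by (meson not_le)
        let ?N = "{u\<in>\<Union> (nbrs J ` S). touches R ?s u}"
        have finN: "finite ?N" using J conn_props(2)[OF S(1)] by auto
        have sub: "(\<Union>b\<in>{..<m}. ?A R b) \<subseteq> Sigma S' dirs" using B(1) by fast
        have img: "(\<lambda>(t, i). flip i t) ` (\<Union>b\<in>{..<m}. ?A R b) \<subseteq> ?N"
        proof
          fix u assume "u \<in> (\<lambda>(t, i). flip i t) ` (\<Union>b\<in>{..<m}. ?A R b)"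
          then obtain b t i where u: "b < m" "t \<in> B b" "i \<in> dirs t" "touches R ?sb (flip i t)" "u = flip i t"
            by auto
          have "t \<in> S'" using u(2) B(1)[OF u(1)] by blast
          then have "t \<in> S" "i \<in> J" using S'(1,3) u(3) by blast+
          then show "u \<in> ?N" using u(4,5) touches_antimono[OF _ ss] by blast
        qed
        have "real m * (c0 * real h * d) = (\<Sum>b\<in>{..<m}. c0 * real h * d)" by simp
        also have "\<dots> \<le> (\<Sum>b\<in>{..<m}. real (card (?A R b)))" by (rule sum_mono[OF ge])
        also have "\<dots> = real (card (\<Union>b\<in>{..<m}. ?A R b))"
        proof -
          have "card (\<Union>b\<in>{..<m}. ?A R b) = (\<Sum>b\<in>{..<m}. card (?A R b))"
          proof (rule card_UN_disjoint)
            show "\<forall>b\<in>{..<m}. finite (?A R b)" using finA by blast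
            show "\<forall>b\<in>{..<m}. \<forall>b'\<in>{..<m}. b \<noteq> b' \<longrightarrow> ?A R b \<inter> ?A R b' = {}"
              using B(3) unfolding disjoint_family_on_def by fast
          qed simp
          then show ?thesis by simp
        qed
        \<comment> \<open>Private directions: no neighbour of \<open>S\<close> is counted for two
          pairs.\<close>
        also have "\<dots> = real (card ((\<lambda>(t, i). flip i t) ` (\<Union>b\<in>{..<m}. ?A R b)))"
          by (subst card_image[OF inj_on_subset[OF S'(5) sub]]) simp
        also have "\<dots> \<le> real (card ?N)" unfolding of_nat_le_iff by (rule card_mono[OF finN img])
        finally have "c0 * d * real (m * h) \<le> real (card ?N)" by (simp add: mult.commute mult.left_commute)
        moreover have "c0 * d * (real (card S) / 36) \<le> c0 * d * real (m * h)"
          using mh2 S'(2) c0 d by (intro mult_left_mono) auto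
        moreover have "c * (real (card S) * d) \<le> c0 / 36 * (real (card S) * d)"
          using c d by (intro mult_right_mono) auto
        ultimately have "c * real (card S) * d \<le> real (card ?N)" by (simp add: mult.commute mult.left_commute)
        then show False using lt S(2) by simp
      qed
      also have "\<dots> \<le> real (card {..<m}) * exp (- (c * d * d))"
      proof (rule sprob_UN_le[OF p])
        fix b assume "b \<in> {..<m}"
        then have b: "b < m" by simp
        show "sprob ?V p (\<lambda>R. real (card (?A R b)) < c0 * real h * d) \<le> exp (- (c * d * d))"
        proof (rule batch')
          show "B b \<subseteq> ?V" using B(1)[OF b] S'(1) SV by blast
          show "card (B b) = h" by (rule B(2)[OF b])
          fix t assume "t \<in> B b"
          then have t: "t \<in> S'" using B(1)[OF b] by blast
          have "4 * \<gamma> * d \<le> 1 / 18 * d" using \<gamma> d by (intro mult_right_mono) auto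
          then show "dirs t \<subseteq> J \<and> 4 * \<gamma> * d \<le> real (card (dirs t))"
            using S'(3)[OF t] S'(4)[OF t] unfolding d_def by auto
        qed
      qed simp
      also have "\<dots> \<le> real (Suc k) * exp (- (c * d * d))"
        using mk by (intro mult_right_mono) auto
      finally show ?thesis .
    qed
    \<comment> \<open>A single batch of \<open>h\<close> neighbours of \<open>x\<close>, with all
      directions allowed; finding no touching vertex at all is fewer than the batch
      guarantees.\<close>
    have near: "sprob ?V p (\<lambda>R. \<forall>t\<in>nbrs J x. \<forall>i\<in>J. \<not> touches R ?s (flip i t)) \<le> exp (- (c * d * d))"
      if x: "x \<in> ?V" for x
    proof -
      have "\<gamma> * d \<le> 1 * d" using \<gamma> d by (intro mult_right_mono) auto
      then have "h \<le> card (nbrs J x)" using h unfolding card_neighbours d_def by linarith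
      then obtain T where T: "T \<subseteq> nbrs J x" "card T = h" using obtain_subset_with_card_n by metis
      have "sprob ?V p (\<lambda>R. \<forall>t\<in>nbrs J x. \<forall>i\<in>J. \<not> touches R ?s (flip i t)) \<le>
        sprob ?V p (\<lambda>R. real (card (touching_pairs T (\<lambda>_. J) ?sb R)) < c0 * real h * d)"
      proof (rule sprob_mono[OF p])
        fix R assume no: "\<forall>t\<in>nbrs J x. \<forall>i\<in>J. \<not> touches R ?s (flip i t)"
        have "(touching_pairs T (\<lambda>_. J) ?sb R) = {}"
          using no T(1) touches_antimono[OF _ ss] by blast
        then show "real (card (touching_pairs T (\<lambda>_. J) ?sb R)) < c0 * real h * d"
          using c0 h d by (simp only: card.empty) simp
      qed
      also have "\<dots> \<le> exp (- (c * d * d))"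
      proof (rule batch')
        show "T \<subseteq> ?V" using T(1) x by auto
        fix t
        have "4 * \<gamma> * d \<le> 1 * d" using \<gamma> d by (intro mult_right_mono) auto
        then show "J \<subseteq> J \<and> 4 * \<gamma> * d \<le> real (card J)" by (simp add: d_def)
      qed (rule T(2))
      finally show ?thesis .
    qed
    let ?C = "{S\<in>conn v J k. card S = Suc k}"
    have finC: "finite ?C" using finite_conn[OF J] by simp
    have "real (card ?C) \<le> real (card (conn v J k))"
      unfolding of_nat_le_iff by (rule card_mono[OF finite_conn[OF J]]) auto
    also have "\<dots> \<le> real (2 ^ card J * (Suc k * card J) ^ k)"
      unfolding of_nat_le_iff by (rule card_conn_le[OF J])
    finally have cC: "real (card ?C) \<le> 2 ^ card J * (real (Suc k) * d) ^ k"
      unfolding d_def by (simp only: of_nat_mult of_nat_power of_nat_numeral)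
    have "sprob ?V p (untouched v J k ?s (c * real (Suc k) * d))
      \<le> real (card ?C) * (real (Suc k) * exp (- (c * d * d))) + real (card ?V) * exp (- (c * d * d))"
      by (intro order_trans[OF sprob_disj[OF p]] add_mono sprob_UN_le[OF p]) (use one near finC finV in auto)
    also have "\<dots> \<le> (2 ^ card J * (real (Suc k) * d) ^ k) * (real (Suc k) * exp (- (c * d * d))) + 2 ^ card J * exp (- (c * d * d))"
      by (intro add_mono mult_right_mono[OF cC]) (auto simp: card_cube J)
    finally show "sprob ?V p (untouched v J k (c * real (card J) ^ j) (c * real (Suc k) * real (card J)))
     \<le> 2 ^ card J * (real (Suc k) * real (card J)) ^ k * real (Suc k) * exp (- (c * real (card J) * real (card J)))
       + 2 ^ card J * exp (- (c * real (card J) * real (card J)))"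
      by (simp only: d_def mult.assoc)
  qed
qed

section \<open>Sprinkling\<close>

text \<open>For a fixed root, exposing \<open>R2\<close> off \<open>B\<close> determines the
  cluster. If it is big and misses the large clusters, it has at least \<open>a\<close> neighbours
  in \<open>B\<close>, and the independent rest of \<open>R2\<close> avoids them all with
  probability at most exp(-q a). Only the root is subject to a union bound.\<close>

lemma attach:
  assumes J: "finite J" and R1: "R1 \<subseteq> cube v J" and q: "0 \<le> q" "q \<le> 1"
    and good: "\<And>S. S \<in> conn v J k \<Longrightarrow> card S = Suc k \<Longrightarrow>
      a \<le> real (card {u\<in>\<Union> (nbrs J ` S). touches R1 s u})"
    and B: "B = {u\<in>cube v J. touches R1 s u} - R1"
  shows "sprob (cube v J) q (\<lambda>R2. \<exists>x\<in>cube v J. x \<in> R1 \<union> (R2 - B)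
      \<and> cluster (R1 \<union> (R2 - B)) x \<inter> large R1 s = {} \<and> k < card (cluster (R1 \<union> (R2 - B)) x)
      \<and> (R2 \<inter> B) \<inter> \<Union> (nbrs J ` cluster (R1 \<union> (R2 - B)) x) = {}) \<le> 2 ^ card J * exp (- q * a)"
proof -
  let ?V = "cube v J"
  let ?bad = "\<lambda>x R' Y. x \<in> R1 \<union> R' \<and> cluster (R1 \<union> R') x \<inter> large R1 s = {} \<and> k < card (cluster (R1 \<union> R') x)
      \<and> Y \<inter> \<Union> (nbrs J ` cluster (R1 \<union> R') x) = {}"
  have finV: "finite ?V" using J by simp
  have BV: "B \<subseteq> ?V" using B by auto
  have finB: "finite B" by (rule finite_subset[OF BV finV])
  have main: "sprob ?V q (\<lambda>R2. ?bad x (R2 - B) (R2 \<inter> B)) \<le> exp (- q * a)" if x: "x \<in> ?V" for x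
  proof -
    have VB: "?V - (?V - B) = B" using BV by auto
    have "sprob ?V q (\<lambda>R2. ?bad x (R2 - B) (R2 \<inter> B)) =
        expect (?V - B) q (\<lambda>X. sprob B q (\<lambda>Y. ?bad x ((X \<union> Y) - B) ((X \<union> Y) \<inter> B)))"
      using sprob_split[OF finV, of "?V - B" q] unfolding VB by simp
    also have "\<dots> = expect (?V - B) q (\<lambda>X. sprob B q (\<lambda>Y. ?bad x X Y))"
    proof (intro expect_cong sprob_cong)
      fix X Y assume "X \<subseteq> ?V - B" "Y \<subseteq> B"
      then have "(X \<union> Y) - B = X" "(X \<union> Y) \<inter> B = Y" by auto
      then show "?bad x ((X \<union> Y) - B) ((X \<union> Y) \<inter> B) = ?bad x X Y" by simp
    qed
    also have "\<dots> \<le> expect (?V - B) q (\<lambda>X. exp (- q * a))"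
    proof (rule expect_mono[OF q])
      fix X assume X: "X \<subseteq> ?V - B"
      let ?R = "R1 \<union> X" and ?C = "cluster (R1 \<union> X) x"
      show "sprob B q (\<lambda>Y. ?bad x X Y) \<le> exp (- q * a)"
      proof (cases "x \<in> ?R \<and> ?C \<inter> large R1 s = {} \<and> k < card ?C")
        case False
        then have "sprob B q (\<lambda>Y. ?bad x X Y) = sprob B q (\<lambda>Y. False)"
          by (intro sprob_cong) auto
        also have "\<dots> = 0" using finB by (simp add: sprob_def expect_const)
        finally show ?thesis by simp
      next
        case True
        have RV: "?R \<subseteq> ?V" using R1 X by auto
        obtain S where S: "S \<in> conn v J k" "S \<subseteq> ?C" "card S = Suc k"
          using conn_in_cluster[OF J RV x] True by blast
        let ?F = "B \<inter> \<Union> (nbrs J ` ?C)"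
        have "{u\<in>\<Union> (nbrs J ` S). touches R1 s u} \<subseteq> ?F"
        proof
          fix u assume "u \<in> {u\<in>\<Union> (nbrs J ` S). touches R1 s u}"
          then obtain y i where u: "y \<in> S" "i \<in> J" "u = flip i y" "touches R1 s u" by auto
          have "y \<in> ?V" using u(1) conn_props(1)[OF S(1)] by blast
          then have uV: "u \<in> ?V" using u(2,3) by simp
          \<comment> \<open>A touching vertex in \<open>R1\<close> would itself belong to a large
            cluster; being adjacent to the cluster of \<open>x\<close>, it would also lie in that
            cluster, which misses the large ones.\<close>
          have "u \<notin> R1"
          proof
            assume uR: "u \<in> R1"
            obtain w where w: "w \<in> large R1 s" "adj u w" using u(4) by (auto simp: touches_def)
            have "u \<in> cluster R1 w" by (rule cluster_step[OF cluster_refl adj_sym[OF w(2)] uR])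
            then have "u \<in> large R1 s" by (rule large_cluster[OF w(1)])
            moreover have "u \<in> ?C"
              by (rule cluster_step[of y]) (use u S(2) uR in auto)
            ultimately show False using True by blast
          qed
          then have "u \<in> B" using B uV u(4) by blast
          moreover have "u \<in> nbrs J y" using u(2,3) by blast
          ultimately show "u \<in> ?F" using u(1) S(2) by blast
        qed
        then have "card {u\<in>\<Union> (nbrs J ` S). touches R1 s u} \<le> card ?F"
          using finB by (intro card_mono) auto
        then have aF: "a \<le> real (card ?F)" using good[OF S(1,3)] by linarith
        have "sprob B q (\<lambda>Y. ?bad x X Y) \<le> sprob B q (\<lambda>Y. Y \<inter> ?F = {})"
          by (rule sprob_mono[OF q]) blast
        also have "\<dots> = (1 - q) ^ card ?F" by (rule sprob_disjoint[OF finB]) simp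
        also have "\<dots> \<le> exp (- q) ^ card ?F"
          using exp_ge_add_one_self[of "- q"] q by (intro power_mono) auto
        also have "\<dots> = exp (- q * card ?F)" by (simp add: exp_of_nat_mult[symmetric] mult.commute)
        also have "\<dots> \<le> exp (- q * a)" using aF q by (simp add: mult_left_mono)
        finally show ?thesis .
      qed
    qed
    also have "\<dots> = exp (- q * a)" by (rule expect_const) (simp add: finV)
    finally show ?thesis .
  qed
  have "sprob ?V q (\<lambda>R2. \<exists>x\<in>?V. ?bad x (R2 - B) (R2 \<inter> B)) \<le> real (card ?V) * exp (- q * a)"
    by (rule sprob_UN_le[OF q finV main])
  then show ?thesis by (simp add: card_cube[OF J])
qed

section \<open>Joining the large clusters along short disjoint paths\<close>

primrec bl :: "nat set \<Rightarrow> nat \<Rightarrow> nat set \<Rightarrow> nat set set" where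
  "bl J 0 x = {x}"
| "bl J (Suc r) x = bl J r x \<union> \<Union> (nbrs J ` bl J r x)"

lemma finite_bl: "finite J \<Longrightarrow> finite (bl J r x)"
  by (induction r) auto

lemma card_bl:
  assumes "finite J"
  shows "card (bl J r x) \<le> Suc (card J) ^ r"
proof (induction r)
  case (Suc r)
  have "card (bl J (Suc r) x) \<le> card (bl J r x) + card (\<Union> (nbrs J ` bl J r x))"
    unfolding bl.simps by (rule card_Un_le)
  also have "card (\<Union> (nbrs J ` bl J r x)) \<le> (\<Sum>y\<in>bl J r x. card (nbrs J y))"
    by (rule card_UN_le[OF finite_bl[OF assms]])
  also have "card (bl J r x) + \<dots> = card (bl J r x) * Suc (card J)" by simp
  also have "\<dots> \<le> Suc (card J) ^ r * Suc (card J)" by (rule mult_right_mono[OF Suc.IH]) simp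
  finally show ?case by (simp add: mult.commute)
qed simp

lemma bl_subset_cube: "x \<in> cube v J \<Longrightarrow> bl J r x \<subseteq> cube v J"
  by (induction r) auto

lemma bl_trans: "z \<in> bl J s y \<Longrightarrow> y \<in> bl J r x \<Longrightarrow> z \<in> bl J (r + s) x"
  by (induction s arbitrary: z) auto

lemma bl_sym: "z \<in> bl J r x \<Longrightarrow> x \<in> bl J r z"
proof (induction r arbitrary: z)
  case (Suc r)
  show ?case
  proof (cases "z \<in> bl J r x")
    case True
    then show ?thesis using Suc.IH by simp
  next
    case False
    then obtain y i where y: "y \<in> bl J r x" "i \<in> J" "z = flip i y" using Suc.prems by auto
    have "y \<in> nbrs J z" using y(2,3) by (metis flip_flip imageI)
    then have "y \<in> bl J 1 z" by simp
    then show ?thesis using bl_trans[OF Suc.IH[OF y(1)], of 1 z] by simp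
  qed
qed simp

lemma bl_mono: "r \<le> s \<Longrightarrow> bl J r x \<subseteq> bl J s x"
  by (induction s) (auto simp: le_Suc_eq)

text \<open>Greedy choice: keep a vertex, discard its ball, repeat. Each kept vertex accounts for at
  most the size of one ball.\<close>

lemma separated_subset:
  assumes "finite J" "finite M"
  shows "\<exists>M'\<subseteq>M. (\<forall>x\<in>M'. \<forall>y\<in>M'. x \<noteq> y \<longrightarrow> y \<notin> bl J r x) \<and> card M \<le> card M' * Suc (card J) ^ r"
  using assms(2)
proof (induction "card M" arbitrary: M rule: less_induct)
  case less
  show ?case
  proof (cases "M = {}")
    case False
    then obtain x where x: "x \<in> M" by blast
    have xb: "x \<in> bl J r x" using bl_mono[of 0 r] by auto
    have "card (M - bl J r x) < card M"
      by (rule psubset_card_mono[OF less.prems]) (use x xb in blast)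
    then obtain M' where M': "M' \<subseteq> M - bl J r x" "\<forall>x\<in>M'. \<forall>y\<in>M'. x \<noteq> y \<longrightarrow> y \<notin> bl J r x"
      "card (M - bl J r x) \<le> card M' * Suc (card J) ^ r"
      using less.hyps[of "M - bl J r x"] less.prems by auto
    have finM': "finite M'" using M'(1) less.prems by (meson finite_Diff finite_subset)
    have "x \<notin> M'" using M'(1) xb by auto
    have "card M \<le> card (M - bl J r x) + card (bl J r x)"
      using diff_card_le_card_Diff[OF finite_bl[OF assms(1)], of M r x] by linarith
    also have "\<dots> \<le> card M' * Suc (card J) ^ r + Suc (card J) ^ r"
      using M'(3) card_bl[OF assms(1)] by (intro add_mono)
    also have "\<dots> = card (insert x M') * Suc (card J) ^ r" using \<open>x \<notin> M'\<close> finM' by simp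
    finally have c: "card M \<le> card (insert x M') * Suc (card J) ^ r" .
    have "y \<notin> bl J r x \<and> x \<notin> bl J r y" if "y \<in> M'" for y
      using that M'(1) bl_sym[of x J r y] by blast
    then have "\<forall>y\<in>insert x M'. \<forall>z\<in>insert x M'. y \<noteq> z \<longrightarrow> z \<notin> bl J r y" using M'(2) by blast
    moreover have "insert x M' \<subseteq> M" using x M'(1) by blast
    ultimately show ?thesis using c by blast
  qed auto
qed

text \<open>Exactly three steps, but backtracking is allowed, so every neighbour of \<open>A\<close>
  qualifies as well.\<close>

definition walk3 :: "nat set \<Rightarrow> nat set set \<Rightarrow> nat set \<Rightarrow> bool" where
  "walk3 J A x \<longleftrightarrow> (\<exists>t\<in>nbrs J x. \<exists>u\<in>nbrs J t. \<exists>a\<in>nbrs J u. a \<in> A)"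

text \<open>Two walks of length 3 meet at \<open>x\<close>, or at the edge from \<open>x\<close> to
  \<open>y\<close>, and form a path of at most 8 vertices. Radius 4 is one step to \<open>y\<close>
  followed by three more.\<close>

lemma connecting_set:
  assumes x: "x \<in> cube v J" and A: "walk3 J A x" and y: "y = x \<or> y \<in> nbrs J x" and B: "walk3 J B y"
  shows "\<exists>F\<subseteq>cube v J. F \<subseteq> bl J 4 x \<and> card F \<le> 8 \<and> finite F \<and> (\<exists>a\<in>A. \<exists>b\<in>B. a \<in> F \<and> b \<in> cluster F a)"
proof -
  obtain t u a where A': "t \<in> nbrs J x" "u \<in> nbrs J t" "a \<in> nbrs J u" "a \<in> A"
    using A by (auto simp: walk3_def)
  obtain t' u' b where B': "t' \<in> nbrs J y" "u' \<in> nbrs J t'" "b \<in> nbrs J u'" "b \<in> B"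
    using B by (auto simp: walk3_def)
  have nadj: "adj w z" "adj z w" if "z \<in> nbrs J w" for z w using that by auto
  have nbl: "z \<in> bl J (Suc r) x" if "z \<in> nbrs J w" "w \<in> bl J r x" for z w r
    using that by auto
  let ?F = "set [a, u, t, x, y, t', u', b]"
  have F4: "?F \<subseteq> bl J 4 x"
  proof -
    have x0: "x \<in> bl J 0 x" by simp
    have t1: "t \<in> bl J (Suc 0) x" by (rule nbl[OF A'(1) x0])
    have u1: "u \<in> bl J (Suc (Suc 0)) x" by (rule nbl[OF A'(2) t1])
    have a1: "a \<in> bl J (Suc (Suc (Suc 0))) x" by (rule nbl[OF A'(3) u1])
    have y1: "y \<in> bl J (Suc 0) x" using y nbl[OF _ x0, of y] by auto
    have t2: "t' \<in> bl J (Suc (Suc 0)) x" by (rule nbl[OF B'(1) y1])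
    have u2: "u' \<in> bl J (Suc (Suc (Suc 0))) x" by (rule nbl[OF B'(2) t2])
    have b2: "b \<in> bl J (Suc (Suc (Suc (Suc 0)))) x" by (rule nbl[OF B'(3) u2])
    have "z \<in> bl J 4 x" if "z \<in> bl J r x" "r \<le> 4" for z r
      using bl_mono[OF that(2)] that(1) by blast
    from this[OF x0] this[OF t1] this[OF u1] this[OF a1] this[OF y1] this[OF t2] this[OF u2] this[OF b2]
    show ?thesis by simp
  qed
  moreover have "?F \<subseteq> cube v J" using F4 bl_subset_cube[OF x] by (rule subset_trans)
  moreover have "b \<in> cluster ?F a"
  proof -
    have "u \<in> cluster ?F a" by (rule cluster_step[OF cluster_refl nadj(2)[OF A'(3)]]) simp
    then have "t \<in> cluster ?F a" by (rule cluster_step[OF _ nadj(2)[OF A'(2)]]) simp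
    then have xc: "x \<in> cluster ?F a" by (rule cluster_step[OF _ nadj(2)[OF A'(1)]]) simp
    have "y \<in> cluster ?F a"
    proof (cases "y = x")
      case False
      then have "y \<in> nbrs J x" using y by simp
      then show ?thesis by (rule cluster_step[OF xc nadj(1)]) simp
    qed (use xc in simp)
    then have "t' \<in> cluster ?F a" by (rule cluster_step[OF _ nadj(1)[OF B'(1)]]) simp
    then have "u' \<in> cluster ?F a" by (rule cluster_step[OF _ nadj(1)[OF B'(2)]]) simp
    then show ?thesis by (rule cluster_step[OF _ nadj(1)[OF B'(3)]]) simp
  qed
  moreover have "card ?F \<le> 8" by (rule order_trans[OF card_length]) simp
  moreover have "a \<in> ?F" by simp
  ultimately show ?thesis using F4 A'(4) B'(4) by blast
qed

text \<open>The vertices with walks to \<open>A\<close> and those with walks to \<open>B\<close>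
  cover the cube. If at least |A|/2 have both, these suffice. Otherwise those with a walk to
  \<open>A\<close> only number at least |A|/2 and leave at least |B| \<ge> |A| outside, so
  isoperimetry gives many boundary vertices, each with a neighbour that walks to
  \<open>B\<close>.\<close>

lemma interface:
  assumes J: "finite J" "J \<noteq> {}" and AB: "A \<subseteq> cube v J" "B \<subseteq> cube v J" "A \<inter> B = {}" "card A \<le> card B"
    and cover: "\<And>x. x \<in> cube v J \<Longrightarrow> walk3 J A x \<or> walk3 J B x"
  shows "card A \<le> 2 * card {x\<in>cube v J. walk3 J A x \<and> (\<exists>y. (y = x \<or> y \<in> nbrs J x) \<and> walk3 J B y)} * card J"
proof -
  let ?V = "cube v J"
  let ?X = "{x\<in>?V. walk3 J A x}" and ?Z = "{x\<in>?V. walk3 J B x}"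
  let ?M = "{x\<in>?V. walk3 J A x \<and> (\<exists>y. (y = x \<or> y \<in> nbrs J x) \<and> walk3 J B y)}"
  have finV: "finite ?V" using J by simp
  \<comment> \<open>A vertex c of \<open>C\<close> may fail to have a walk of exactly three steps
    into \<open>C\<close>, but \<open>flip i c\<close> has one: go to c, back, and to c again. So
    \<open>C\<close> is compared with its image under a flip.\<close>
  have size: "card C \<le> card {x\<in>?V. walk3 J C x}" if C: "C \<subseteq> ?V" for C
  proof -
    obtain i where i: "i \<in> J" using J by blast
    have "flip i ` C \<subseteq> {x\<in>?V. walk3 J C x}"
    proof
      fix x assume "x \<in> flip i ` C"
      then obtain c where c: "c \<in> C" "x = flip i c" by blast
      have n: "c \<in> nbrs J x" "x \<in> nbrs J c" using c i by (auto intro: image_eqI[of _ _ i])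
      have "x \<in> ?V" using c C i by auto
      moreover have "walk3 J C x" unfolding walk3_def using n c(1) by blast
      ultimately show "x \<in> {x\<in>?V. walk3 J C x}" by simp
    qed
    then have "card (flip i ` C) \<le> card {x\<in>?V. walk3 J C x}" by (rule card_mono[rotated]) (simp add: finV)
    then show ?thesis by (simp add: card_image inj_on_def)
  qed
  have d1: "1 \<le> card J" using J by (simp add: Suc_le_eq card_gt_0_iff)
  show ?thesis
  proof (cases "card A \<le> 2 * card (?X \<inter> ?Z)")
    case True
    have "card (?X \<inter> ?Z) \<le> card ?M" by (rule card_mono) (use finV in auto)
    then have AM: "card A \<le> 2 * card ?M" using True by linarith
    have "2 * card ?M * 1 \<le> 2 * card ?M * card J" by (rule mult_le_mono2[OF d1])
    then show ?thesis unfolding mult_1_right by (rule order_trans[OF AM])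
  next
    case False
    let ?P = "?X - ?Z"
    have PV: "?P \<subseteq> ?V" by auto
    have "card ?X = card (?X \<inter> ?Z) + card ?P"
      using finV by (subst card_Un_disjoint[symmetric]) (auto intro: arg_cong[of _ _ card])
    then have P: "card A \<le> 2 * card ?P" using size[OF AB(1)] False by linarith
    have "?V - ?P = ?Z" using cover by auto
    then have "card ?Z = 2 ^ card J - card ?P"
      using card_Diff_subset[of ?P ?V] finV PV by (simp add: card_cube[OF J(1)])
    then have "card A \<le> 2 ^ card J - card ?P" using size[OF AB(2)] AB(4) by linarith
    then have "card A \<le> 2 * (card {x\<in>?P. \<exists>i\<in>J. flip i x \<notin> ?P} * card J)"
      using vertex_boundary[OF J(1) PV] P by (auto simp: min_def split: if_splits)
    also have "card {x\<in>?P. \<exists>i\<in>J. flip i x \<notin> ?P} \<le> card ?M"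
    proof (rule card_mono)
      show "{x\<in>?P. \<exists>i\<in>J. flip i x \<notin> ?P} \<subseteq> ?M"
      proof
        fix x assume "x \<in> {x\<in>?P. \<exists>i\<in>J. flip i x \<notin> ?P}"
        then obtain i where x: "x \<in> ?P" "i \<in> J" "flip i x \<notin> ?P" by blast
        have "flip i x \<in> ?V" using x by auto
        then have "walk3 J B (flip i x)" using x(3) cover by blast
        moreover have "flip i x \<in> nbrs J x" using x(2) by blast
        ultimately show "x \<in> ?M" using x(1) by blast
      qed
    qed (simp add: finV)
    finally show ?thesis by (simp add: mult.assoc)
  qed
qed

lemma sum_Pow_power_card:
  assumes "finite A"
  shows "(\<Sum>X\<in>Pow A. (c::real) ^ card X) = (1 + c) ^ card A"
  using prod_add[OF assms, of "\<lambda>_. c" "\<lambda>_. 1"] by (simp add: add.commute)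

text \<open>The loss between the size of \<open>A\<close> and the number of disjoint connecting
  paths: 2 d from \<open>interface\<close>, and the bound on a ball of radius 8 from making balls of
  radius 4 disjoint.\<close>

abbreviation spread :: "nat set \<Rightarrow> real" where
  "spread J \<equiv> 2 * real (card J) * real (Suc (card J)) ^ 8"

text \<open>Interface vertices thinned to pairwise distance above 8 carry disjoint connecting sets.
  Each lies in \<open>R2\<close> with probability at least q^8, and a single one joins the two
  sides.\<close>

lemma not_joined:
  assumes J: "finite J" "J \<noteq> {}" and AB: "A \<subseteq> cube v J" "B \<subseteq> cube v J" "A \<inter> B = {}" "card A \<le> card B"
    and cover: "\<And>x. x \<in> cube v J \<Longrightarrow> walk3 J A x \<or> walk3 J B x"
    and q: "0 \<le> q" "q \<le> 1"
  shows "sprob (cube v J) q (\<lambda>R2. \<forall>a\<in>A. \<forall>b\<in>B. b \<notin> cluster (R1 \<union> R2) a)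
    \<le> exp (- (q ^ 8 * (real (card A) / (spread J))))"
proof -
  let ?V = "cube v J"
  let ?M = "{x\<in>?V. walk3 J A x \<and> (\<exists>y. (y = x \<or> y \<in> nbrs J x) \<and> walk3 J B y)}"
  have finV: "finite ?V" using J by simp
  have finM: "finite ?M" using finV by simp
  obtain M' where M': "M' \<subseteq> ?M" "\<forall>x\<in>M'. \<forall>y\<in>M'. x \<noteq> y \<longrightarrow> y \<notin> bl J 8 x"
    "card ?M \<le> card M' * Suc (card J) ^ 8"
    using separated_subset[OF J(1) finM, of 8] by (elim exE conjE) (rule that)
  have finM': "finite M'" by (rule finite_subset[OF M'(1) finM])
  have "\<forall>x\<in>M'. \<exists>F\<subseteq>?V. F \<subseteq> bl J 4 x \<and> card F \<le> 8 \<and> finite F \<and> (\<exists>a\<in>A. \<exists>b\<in>B. a \<in> F \<and> b \<in> cluster F a)"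
  proof
    fix x assume "x \<in> M'"
    then have "x \<in> ?M" using M'(1) by blast
    then obtain y where "x \<in> ?V" "walk3 J A x" "y = x \<or> y \<in> nbrs J x" "walk3 J B y" by blast
    then show "\<exists>F\<subseteq>?V. F \<subseteq> bl J 4 x \<and> card F \<le> 8 \<and> finite F \<and> (\<exists>a\<in>A. \<exists>b\<in>B. a \<in> F \<and> b \<in> cluster F a)"
      by (rule connecting_set)
  qed
  from bchoice[OF this] obtain F where F: "\<forall>x\<in>M'. F x \<subseteq> ?V \<and> F x \<subseteq> bl J 4 x \<and> card (F x) \<le> 8 \<and> finite (F x) \<and>
      (\<exists>a\<in>A. \<exists>b\<in>B. a \<in> F x \<and> b \<in> cluster (F x) a)"
    by (elim exE) (rule that)
  have disj: "disjoint_family_on F M'"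
    unfolding disjoint_family_on_def
  proof (intro ballI impI)
    fix x y assume xy: "x \<in> M'" "y \<in> M'" "x \<noteq> y"
    show "F x \<inter> F y = {}"
    proof (rule ccontr)
      assume "F x \<inter> F y \<noteq> {}"
      then obtain z where "z \<in> F x" "z \<in> F y" by blast
      then have "z \<in> bl J 4 x" "z \<in> bl J 4 y" using F xy by blast+
      then have "y \<in> bl J (4 + 4) x" using bl_trans[OF bl_sym] by blast
      then show False using M'(2) xy by auto
    qed
  qed
  have "sprob ?V q (\<lambda>R2. \<forall>a\<in>A. \<forall>b\<in>B. b \<notin> cluster (R1 \<union> R2) a)
      \<le> sprob ?V q (\<lambda>R2. \<forall>x\<in>M'. \<not> F x \<subseteq> R2 \<inter> F x)"
  proof (rule sprob_mono[OF q], intro ballI notI)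
    fix R2 x assume no: "\<forall>a\<in>A. \<forall>b\<in>B. b \<notin> cluster (R1 \<union> R2) a" and x: "x \<in> M'" "F x \<subseteq> R2 \<inter> F x"
    obtain a b where ab: "a \<in> A" "b \<in> B" "b \<in> cluster (F x) a" using F x(1) by blast
    have "F x \<subseteq> R1 \<union> R2" using x(2) by blast
    then have "b \<in> cluster (R1 \<union> R2) a" using ab(3) by (rule cluster_mono)
    then show False using no ab by blast
  qed
  also have "\<dots> \<le> exp (- (q ^ 8) * card M')"
  proof (rule no_success[OF finV finM' q _ disj])
    fix x assume x: "x \<in> M'"
    show "F x \<subseteq> ?V" using F x by blast
    have "q ^ 8 \<le> q ^ card (F x)" using F x q by (intro power_decreasing) auto
    also have "\<dots> = sprob (F x) q (\<lambda>X. F x \<subseteq> X)"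
      using F x by (intro sprob_superset[symmetric]) auto
    finally show "q ^ 8 \<le> sprob (F x) q (\<lambda>X. F x \<subseteq> X)" .
  qed (use q in \<open>auto intro: power_le_one\<close>)
  also have "\<dots> \<le> exp (- (q ^ 8 * (real (card A) / (spread J))))"
  proof -
    have "card A \<le> 2 * card ?M * card J" by (rule interface[OF J AB cover])
    also have "\<dots> \<le> 2 * (card M' * Suc (card J) ^ 8) * card J"
      using M'(3) by (intro mult_le_mono) auto
    finally have "real (card A) \<le> real (2 * (card M' * Suc (card J) ^ 8) * card J)"
      unfolding of_nat_le_iff .
    also have "\<dots> = real (card M') * (spread J)"
      by (simp del: of_nat_Suc)
    finally have M'A: "real (card A) / (spread J) \<le> real (card M')"
    proof -
      have "0 < real (card J)" using J by (simp add: card_gt_0_iff)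
      then have "0 < spread J" by simp
      then show ?thesis if "real (card A) \<le> real (card M') * (spread J)"
        using that by (simp only: pos_divide_le_eq)
    qed
    show ?thesis
      unfolding exp_le_cancel_iff mult_minus_left neg_le_iff_le
      by (rule mult_left_mono[OF M'A]) (use q in simp)
  qed
  finally show ?thesis .
qed

text \<open>There may be exponentially many large clusters and so doubly exponentially many
  bipartitions. A side of i clusters has at least i s vertices, so failing to join it costs
  \<theta>^i. Summing over all nonempty sides gives (1 + \<theta>)^N - 1 with N \<le> 2^d, which is
  small as soon as 2^d \<theta> is.\<close>

lemma merge:
  assumes J: "finite J" "J \<noteq> {}" and R1: "R1 \<subseteq> cube v J" and q: "0 \<le> q" "q \<le> 1" and s: "0 < s"
    and cover: "\<And>x. x \<in> cube v J \<Longrightarrow> walk3 J (large R1 s) x"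
  shows "sprob (cube v J) q (\<lambda>R2. \<exists>w\<in>large R1 s. \<exists>w'\<in>large R1 s. w' \<notin> cluster (R1 \<union> R2) w)
    \<le> exp (2 ^ card J * exp (- (q ^ 8 * (s / (spread J))))) - 1"
proof -
  let ?V = "cube v J" and ?W = "large R1 s"
  define \<theta> where "\<theta> = exp (- (q ^ 8 * (s / (spread J))))"
  define CC where "CC = cluster R1 ` ?W"
  have finV: "finite ?V" using J by simp
  have WR: "?W \<subseteq> R1" by (auto simp: large_def)
  have WV: "?W \<subseteq> ?V" using WR R1 by blast
  have finR: "finite R1" by (rule finite_subset[OF R1 finV])
  have finW: "finite ?W" by (rule finite_subset[OF WV finV])
  have finCC: "finite CC" using finW by (simp add: CC_def)
  have CW: "C \<subseteq> ?W" "s \<le> real (card C)" "finite C" if "C \<in> CC" for C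
  proof -
    obtain w where w: "w \<in> ?W" "C = cluster R1 w" using \<open>C \<in> CC\<close> by (auto simp: CC_def)
    show "C \<subseteq> ?W" using large_cluster[OF w(1)] w(2) by blast
    show "s \<le> real (card C)" using w by (simp add: large_def)
    show "finite C" using w(2) finite_cluster[OF finR] by simp
  qed
  have UCC: "\<Union> CC = ?W" using CW(1) by (auto simp: CC_def)
  have disjCC: "C \<inter> C' = {}" if C: "C \<in> CC" "C' \<in> CC" "C \<noteq> C'" for C C'
  proof (rule ccontr)
    assume "C \<inter> C' \<noteq> {}"
    then obtain z where z: "z \<in> C" "z \<in> C'" by blast
    obtain w w' where w: "w \<in> R1" "C = cluster R1 w" "w' \<in> R1" "C' = cluster R1 w'"
      using C WR by (auto simp: CC_def)
    have "cluster R1 z = C" "cluster R1 z = C'"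
      using cluster_eq[OF w(1)] cluster_eq[OF w(3)] z w(2,4) by blast+
    then show False using C(3) by simp
  qed
  have cardA: "s * real (card K) \<le> real (card (\<Union> K))" if K: "K \<subseteq> CC" for K
  proof -
    have "finite K" by (rule finite_subset[OF K finCC])
    have "card (\<Union> K) = (\<Sum>C\<in>K. card C)"
    proof (rule card_Union_disjoint)
      show "pairwise disjnt K"
        by (rule pairwiseI) (use K in \<open>simp add: disjnt_def disjCC subsetD\<close>)
      show "finite C" if "C \<in> K" for C using CW(3)[OF subsetD[OF K that]] .
    qed
    then have "real (card (\<Union> K)) = (\<Sum>C\<in>K. real (card C))" by simp
    also have "\<dots> \<ge> (\<Sum>C\<in>K. s)" by (rule sum_mono) (use K CW(2) in blast)
    finally show ?thesis by (simp add: mult.commute)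
  qed
  let ?bad = "\<lambda>K R2. \<forall>a\<in>\<Union> K. \<forall>b\<in>\<Union> (CC - K). b \<notin> cluster (R1 \<union> R2) a"
  let ?KK = "{K \<in> Pow CC - {{}}. card (\<Union> K) \<le> card (\<Union> (CC - K))}"
  have "sprob ?V q (\<lambda>R2. \<exists>w\<in>?W. \<exists>w'\<in>?W. w' \<notin> cluster (R1 \<union> R2) w)
      \<le> sprob ?V q (\<lambda>R2. \<exists>K\<in>?KK. ?bad K R2)"
  proof (rule sprob_mono[OF q])
    fix R2 assume "\<exists>w\<in>?W. \<exists>w'\<in>?W. w' \<notin> cluster (R1 \<union> R2) w"
    then obtain w w' where w: "w \<in> ?W" "w' \<in> ?W" "w' \<notin> cluster (R1 \<union> R2) w" by blast
    let ?R = "R1 \<union> R2"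
    define K where "K = {C \<in> CC. C \<subseteq> cluster ?R w}"
    have in_R: "C \<subseteq> ?R" if "C \<in> CC" for C using CW(1)[OF that] WR by blast
    have KR: "\<Union> K \<subseteq> cluster ?R w" by (auto simp: K_def)
    have notK: "b \<notin> cluster ?R w" if bCC: "b \<in> \<Union> (CC - K)" for b
    proof
      assume b: "b \<in> cluster ?R w"
      obtain C where C: "b \<in> C" "C \<in> CC" "C \<notin> K" using bCC by blast
      obtain y where y: "y \<in> R1" "C = cluster R1 y" using C(2) WR by (auto simp: CC_def)
      have Cb: "C = cluster R1 b" using cluster_eq[OF y(1), of b] C(1) y(2) by simp
      have "C \<subseteq> cluster ?R w"
      proof
        fix z assume "z \<in> C"
        then have "z \<in> cluster ?R b" unfolding Cb by (rule cluster_mono[OF Un_upper1])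
        then show "z \<in> cluster ?R w" by (rule cluster_trans[OF b])
      qed
      then show False using C(2,3) by (simp add: K_def)
    qed
    have bad1: "?bad K R2"
    proof (intro ballI notI)
      fix a b assume ab: "a \<in> \<Union> K" "b \<in> \<Union> (CC - K)" "b \<in> cluster ?R a"
      have "a \<in> cluster ?R w" using KR ab(1) by blast
      then have "b \<in> cluster ?R w" using ab(3) by (rule cluster_trans)
      then show False using notK[OF ab(2)] by simp
    qed
    \<comment> \<open>\<open>not_joined\<close> starts from the smaller side, which may be either of
      the two; symmetry of clusters provides the reverse direction.\<close>
    have bad2: "?bad (CC - K) R2"
    proof (intro ballI notI)
      fix a b assume ab: "a \<in> \<Union> (CC - K)" "b \<in> \<Union> (CC - (CC - K))" "b \<in> cluster ?R a"
      have "b \<in> \<Union> K" using ab(2) by (auto simp: K_def)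
      moreover have "a \<in> ?R" using ab(1) in_R by blast
      then have "a \<in> cluster ?R b" using ab(3) by (rule cluster_sym)
      ultimately show False using bad1 ab(1) by blast
    qed
    have Kne: "K \<noteq> {}"
    proof -
      have "cluster R1 w \<subseteq> cluster ?R w" by (rule subsetI) (rule cluster_mono[OF Un_upper1])
      then have "cluster R1 w \<in> K" using w(1) by (simp add: K_def CC_def)
      then show ?thesis by blast
    qed
    have CKne: "CC - K \<noteq> {}"
    proof -
      have "cluster R1 w' \<notin> K"
      proof
        assume "cluster R1 w' \<in> K"
        then have "cluster R1 w' \<subseteq> cluster ?R w" by (simp add: K_def)
        then have "w' \<in> cluster ?R w" by (rule subsetD) simp
        then show False using w(3) by simp
      qed
      then show ?thesis using w(2) by (auto simp: CC_def)
    qed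
    have "CC - (CC - K) = K" by (auto simp: K_def)
    then have "K \<in> ?KK \<or> CC - K \<in> ?KK" using Kne CKne by (auto simp: K_def)
    then show "\<exists>K\<in>?KK. ?bad K R2" using bad1 bad2 by blast
  qed
  also have "\<dots> \<le> (\<Sum>K\<in>?KK. sprob ?V q (?bad K))"
    by (rule sprob_UN[OF q]) (simp add: finCC)
  also have "\<dots> \<le> (\<Sum>K\<in>?KK. \<theta> ^ card K)"
  proof (rule sum_mono)
    fix K assume K: "K \<in> ?KK"
    have "sprob ?V q (?bad K) \<le> exp (- (q ^ 8 * (real (card (\<Union> K)) / (spread J))))"
    proof (rule not_joined[OF J _ _ _ _ _ q])
      show "\<Union> K \<subseteq> ?V" "\<Union> (CC - K) \<subseteq> ?V" using K CW(1) WV by blast+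
      show "\<Union> K \<inter> \<Union> (CC - K) = {}"
      proof (rule ccontr)
        assume "\<Union> K \<inter> \<Union> (CC - K) \<noteq> {}"
        then obtain z C C' where "z \<in> C" "z \<in> C'" "C \<in> K" "C' \<in> CC - K" by blast
        then show False using disjCC[of C C'] K by auto
      qed
      show "card (\<Union> K) \<le> card (\<Union> (CC - K))" using K by simp
      have KC: "K \<union> (CC - K) = CC" using K by blast
      fix x assume "x \<in> ?V"
      then have "walk3 J (\<Union> K \<union> \<Union> (CC - K)) x"
        using cover[of x] unfolding Union_Un_distrib[symmetric] KC UCC by simp
      then show "walk3 J (\<Union> K) x \<or> walk3 J (\<Union> (CC - K)) x" unfolding walk3_def by blast
    qed
    also have "\<dots> \<le> exp (- (q ^ 8 * (s * real (card K) / (spread J))))"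
    proof -
      have "s * real (card K) \<le> real (card (\<Union> K))" using K by (intro cardA) auto
      then have le: "s * real (card K) / (spread J) \<le>
          real (card (\<Union> K)) / (spread J)" by (rule divide_right_mono) simp
      show ?thesis
        unfolding exp_le_cancel_iff neg_le_iff_le
        by (rule mult_left_mono[OF le]) (use q in simp)
    qed
    also have "\<dots> = \<theta> ^ card K"
      unfolding \<theta>_def exp_of_nat_mult[symmetric] by (simp del: of_nat_Suc)
    finally show "sprob ?V q (?bad K) \<le> \<theta> ^ card K" .
  qed
  also have "\<dots> \<le> (\<Sum>K\<in>Pow CC - {{}}. \<theta> ^ card K)"
    by (rule sum_mono2) (auto simp: finCC \<theta>_def)
  also have "\<dots> = (1 + \<theta>) ^ card CC - 1"
    using sum_Pow_power_card[OF finCC, of \<theta>] finCC by (simp add: sum_diff1)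
  also have "\<dots> \<le> exp (2 ^ card J * \<theta>) - 1"
  proof -
    have "card CC \<le> card ?W" unfolding CC_def by (rule card_image_le[OF finW])
    also have "\<dots> \<le> card ?V" by (rule card_mono[OF finV WV])
    finally have "real (card CC) \<le> real (2 ^ card J)" unfolding card_cube[OF J(1)] by (rule of_nat_mono)
    then have c: "real (card CC) \<le> 2 ^ card J" by simp
    have "(1 + \<theta>) ^ card CC \<le> exp \<theta> ^ card CC"
      by (rule power_mono) (auto simp: \<theta>_def)
    also have "\<dots> = exp (real (card CC) * \<theta>)" by (simp add: exp_of_nat_mult)
    also have "\<dots> \<le> exp (2 ^ card J * \<theta>)" using c by (simp add: \<theta>_def)
    finally show ?thesis by simp
  qed
  finally show ?thesis unfolding \<theta>_def .
qed

section \<open>Combining the two rounds\<close>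

lemma unique_large_cluster:
  assumes J: "finite J" and R1: "R1 \<subseteq> cube v J" and R2: "R2 \<subseteq> cube v J"
    and B: "B = {u\<in>cube v J. touches R1 s u} - R1"
    and att: "\<And>x. x \<in> cube v J \<Longrightarrow> x \<in> R1 \<union> (R2 - B) \<Longrightarrow>
      cluster (R1 \<union> (R2 - B)) x \<inter> large R1 s = {} \<Longrightarrow> k < card (cluster (R1 \<union> (R2 - B)) x) \<Longrightarrow>
      (R2 \<inter> B) \<inter> \<Union> (nbrs J ` cluster (R1 \<union> (R2 - B)) x) \<noteq> {}"
    and merged: "\<And>w w'. w \<in> large R1 s \<Longrightarrow> w' \<in> large R1 s \<Longrightarrow> w' \<in> cluster (R1 \<union> R2) w"
    and x: "x \<in> R1 \<union> R2" "k < card (cluster (R1 \<union> R2) x)"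
    and y: "y \<in> R1 \<union> R2" "k < card (cluster (R1 \<union> R2) y)"
  shows "cluster (R1 \<union> R2) x = cluster (R1 \<union> R2) y"
proof -
  let ?R = "R1 \<union> R2" and ?R' = "R1 \<union> (R2 - B)"
  \<comment> \<open>A cluster that misses the large ones contains no vertex of \<open>B\<close>,
    hence is unchanged when \<open>B\<close> is removed from \<open>R2\<close>. Then
    \<open>att\<close> yields a vertex of \<open>R2\<close> in \<open>B\<close> next to it, which
    would have to belong to it.\<close>
  have hits: "\<exists>w. w \<in> cluster ?R z \<and> w \<in> large R1 s" if z: "z \<in> ?R" "k < card (cluster ?R z)" for z
  proof (rule ccontr)
    assume "\<not> ?thesis"
    then have no: "w \<notin> large R1 s" if "w \<in> cluster ?R z" for w using that by blast
    have CB: "b \<notin> B" if b: "b \<in> cluster ?R z" for b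
    proof
      assume "b \<in> B"
      then obtain w where w: "w \<in> large R1 s" "adj b w" using B by (auto simp: touches_def)
      then have "w \<in> ?R" by (simp add: large_def)
      then have "w \<in> cluster ?R z" by (rule cluster_step[OF b w(2)])
      then show False using no w(1) by blast
    qed
    have CR: "cluster ?R z \<subseteq> ?R'"
    proof
      fix b assume b: "b \<in> cluster ?R z"
      then have "b \<in> ?R" using cluster_subset'[OF z(1)] by (rule subsetD[rotated])
      then show "b \<in> ?R'" using CB[OF b] by simp
    qed
    have sub: "?R' \<subseteq> ?R" by auto
    have eq: "cluster ?R' z = cluster ?R z" by (rule cluster_closed_eq[OF sub z(1) CR])
    have "z \<in> ?R'" by (rule subsetD[OF CR]) simp
    moreover have "z \<in> cube v J" using z(1) R1 R2 by auto
    moreover have "cluster ?R' z \<inter> large R1 s = {}" unfolding eq using no by (simp add: disjoint_iff)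
    moreover have "k < card (cluster ?R' z)" unfolding eq by (rule z(2))
    ultimately have "(R2 \<inter> B) \<inter> \<Union> (nbrs J ` cluster ?R z) \<noteq> {}" using att[of z] unfolding eq by simp
    then obtain u b i where u: "u \<in> R2" "u \<in> B" "b \<in> cluster ?R z" "u = flip i b" by blast
    have "u \<in> cluster ?R z" by (rule cluster_step[OF u(3)]) (use u in auto)
    then show False using CB u(2) by simp
  qed
  obtain w where w: "w \<in> cluster ?R x" "w \<in> large R1 s" using hits[OF x] by (elim exE conjE) (rule that)
  obtain w' where w': "w' \<in> cluster ?R y" "w' \<in> large R1 s" using hits[OF y] by (elim exE conjE) (rule that)
  have wR: "w \<in> ?R" using w(2) by (simp add: large_def)
  have "cluster ?R x = cluster ?R w" by (rule cluster_eq[OF x(1) w(1), symmetric])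
  also have "\<dots> = cluster ?R w'" by (rule cluster_eq[OF wR merged[OF w(2) w'(2)], symmetric])
  also have "\<dots> = cluster ?R y" by (rule cluster_eq[OF y(1) w'(1)])
  finally show ?thesis .
qed

definition unique_above :: "real \<Rightarrow> nat set set \<Rightarrow> bool" where
  "unique_above m R \<longleftrightarrow> (\<forall>x\<in>R. \<forall>y\<in>R. m < card (cluster R x) \<longrightarrow> m < card (cluster R y) \<longrightarrow>
     cluster R x = cluster R y)"

lemma two_round_bound:
  fixes p1 q c m :: real
  assumes J: "finite J" "J \<noteq> {}" and p1: "0 \<le> p1" "p1 \<le> 1" and q: "0 \<le> q" "q \<le> 1" and s: "0 < s"
    and m: "real k \<le> m"
  shows "sprob (cube v J) (p1 + q - p1 * q) (\<lambda>R. \<not> unique_above m R) \<le>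
    sprob (cube v J) p1 (untouched v J k s a)
    + (2 ^ card J * exp (- q * a)
       + (exp (2 ^ card J * exp (- (q ^ 8 * (s / spread J)))) - 1))"
    (is "_ \<le> sprob _ _ ?bad + (?t + ?u)")
proof -
  let ?V = "cube v J"
  have finV: "finite ?V" using J by simp
  have tu: "0 \<le> ?t" "0 \<le> ?u" by auto
  have "sprob ?V (p1 + q - p1 * q) (\<lambda>R. \<not> unique_above m R) =
      expect ?V p1 (\<lambda>R1. sprob ?V q (\<lambda>R2. \<not> unique_above m (R1 \<union> R2)))"
    unfolding sprob_def by (rule expect_two_rounds[OF finV])
  also have "\<dots> \<le> expect ?V p1 (\<lambda>R1. of_bool (?bad R1) + (?t + ?u))"
  proof (rule expect_mono[OF p1])
    fix R1 assume R1: "R1 \<subseteq> ?V"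
    show "sprob ?V q (\<lambda>R2. \<not> unique_above m (R1 \<union> R2)) \<le> of_bool (?bad R1) + (?t + ?u)"
    proof (cases "?bad R1")
      case True
      have "sprob ?V q (\<lambda>R2. \<not> unique_above m (R1 \<union> R2)) \<le> 1" by (rule sprob_le_1[OF q finV])
      moreover have "of_bool (?bad R1) = (1::real)" using True by (simp only: of_bool_eq(2))
      ultimately show ?thesis using tu by linarith
    next
      case False
      have good: "a \<le> real (card {u\<in>\<Union> (nbrs J ` S). touches R1 s u})" if "S \<in> conn v J k" "card S = Suc k" for S
      proof (rule ccontr)
        assume "\<not> ?thesis"
        then have "real (card {u\<in>\<Union> (nbrs J ` S). touches R1 s u}) < a" by simp
        moreover have "S \<in> {S\<in>conn v J k. card S = Suc k}" using that by simp
        ultimately show False using False by blast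
      qed
      \<comment> \<open>Two steps reach a vertex that touches a large cluster, the third step enters
        it.\<close>
      have cover: "walk3 J (large R1 s) x" if x: "x \<in> ?V" for x
      proof -
        obtain t i where t: "t \<in> nbrs J x" "i \<in> J" "touches R1 s (flip i t)" using False x by blast
        obtain w where w: "w \<in> large R1 s" "adj (flip i t) w" using t(3) by (auto simp: touches_def)
        have "t \<in> ?V" using t(1) x by auto
        then have "flip i t \<in> ?V" using t(2) by simp
        moreover have "w \<in> ?V" using w(1) R1 by (auto simp: large_def)
        ultimately obtain l where "l \<in> J" "w = flip l (flip i t)" using adj_in_cubeE[OF w(2)] by metis
        then have "w \<in> nbrs J (flip i t)" by simp
        moreover have "flip i t \<in> nbrs J t" using t(2) by simp
        ultimately show ?thesis unfolding walk3_def using t(1) w(1) by blast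
      qed
      define B where "B = {u\<in>?V. touches R1 s u} - R1"
      let ?att = "\<lambda>R2. \<exists>x\<in>?V. x \<in> R1 \<union> (R2 - B)
        \<and> cluster (R1 \<union> (R2 - B)) x \<inter> large R1 s = {} \<and> k < card (cluster (R1 \<union> (R2 - B)) x)
        \<and> (R2 \<inter> B) \<inter> \<Union> (nbrs J ` cluster (R1 \<union> (R2 - B)) x) = {}"
      let ?mer = "\<lambda>R2. \<exists>w\<in>large R1 s. \<exists>w'\<in>large R1 s. w' \<notin> cluster (R1 \<union> R2) w"
      have "sprob ?V q (\<lambda>R2. \<not> unique_above m (R1 \<union> R2)) \<le> sprob ?V q (\<lambda>R2. ?att R2 \<or> ?mer R2)"
      proof (rule sprob_mono[OF q], rule ccontr)
        fix R2 assume R2: "R2 \<subseteq> ?V" and nu: "\<not> unique_above m (R1 \<union> R2)" and neg: "\<not> (?att R2 \<or> ?mer R2)"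
        have "cluster (R1 \<union> R2) x = cluster (R1 \<union> R2) y"
          if xy: "x \<in> R1 \<union> R2" "y \<in> R1 \<union> R2" "m < card (cluster (R1 \<union> R2) x)" "m < card (cluster (R1 \<union> R2) y)" for x y
        proof (rule unique_large_cluster[OF J(1) R1 R2 B_def])
          show "k < card (cluster (R1 \<union> R2) x)" "k < card (cluster (R1 \<union> R2) y)" using xy m by linarith+
          show "w' \<in> cluster (R1 \<union> R2) w" if "w \<in> large R1 s" "w' \<in> large R1 s" for w w'
            using neg that by blast
          show "R2 \<inter> B \<inter> \<Union> (nbrs J ` cluster (R1 \<union> (R2 - B)) z) \<noteq> {}"
            if "z \<in> ?V" "z \<in> R1 \<union> (R2 - B)" "cluster (R1 \<union> (R2 - B)) z \<inter> large R1 s = {}"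
              "k < card (cluster (R1 \<union> (R2 - B)) z)" for z
            using neg that by blast
        qed (rule xy)+
        then show False using nu unfolding unique_above_def by blast
      qed
      also have "\<dots> \<le> sprob ?V q ?att + sprob ?V q ?mer" by (rule sprob_disj[OF q])
      also have "\<dots> \<le> ?t + ?u"
        by (rule add_mono[OF attach[OF J(1) R1 q good B_def] merge[OF J R1 q s cover]])
      finally show ?thesis by simp
    qed
  qed
  also have "\<dots> = sprob ?V p1 ?bad + (?t + ?u)"
    unfolding expect_add sprob_def expect_const[OF finV] ..
  finally show ?thesis .
qed

text \<open>In order: the connected sets and the single vertices in the first round, attaching, and
  merging. The logarithm enters only multiplied by d, so the quadratic term wins.\<close>

lemma error_terms_tendsto_0:
  fixes K M c C b \<beta> :: real
  assumes "0 < K" "0 < M" "0 < c" "0 < C" "0 < b" "0 < \<beta>"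
  shows "(\<lambda>d::nat. exp (b * d + (K * d + 1) * ln (M * d * d) - c * d * d) * (K * d + 2)
     + exp (b * d - c * d * d) + exp (- (\<beta> * d)) + (exp (exp (b * d - C * d * d)) - 1)) \<longlonglongrightarrow> 0"
proof (intro tendsto_add_zero)
  show "(\<lambda>d::nat. exp (b * d + (K * d + 1) * ln (M * d * d) - c * d * d) * (K * d + 2)) \<longlonglongrightarrow> 0"
    using assms by real_asymp
  show "(\<lambda>d::nat. exp (b * d - c * d * d)) \<longlonglongrightarrow> 0" using assms by real_asymp
  show "(\<lambda>d::nat. exp (- (\<beta> * d))) \<longlonglongrightarrow> 0" using assms by real_asymp
  show "(\<lambda>d::nat. exp (exp (b * d - C * d * d)) - 1) \<longlonglongrightarrow> 0" using assms by real_asymp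
qed

lemma unique_above_whp:
  fixes \<epsilon> :: real
  assumes e: "0 < \<epsilon>" "\<epsilon> \<le> 1"
  shows "\<exists>K>0. (\<lambda>d. sprob (cube {} {..<d}) ((1 + \<epsilon>) / real d) (\<lambda>R. \<not> unique_above (K * real d) R)) \<longlonglongrightarrow> 0"
proof -
  \<comment> \<open>With \<open>j = 19\<close> the product of \<open>q ^ 8\<close>, of order \<open>d ^ (-8)\<close>, and
    \<open>d ^ 19 / spread J\<close>, of order \<open>d ^ 10\<close>, has order \<open>d ^ 2\<close>.\<close>
  have "0 < \<epsilon> / 2" using e by simp
  then obtain c \<gamma> D where c: "0 < c" and \<gamma>: "0 < \<gamma>" and H: "touching_bound (\<epsilon> / 2) 19 c \<gamma> D"
    using touching_structure[of "\<epsilon> / 2" 19] by blast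
  \<comment> \<open>36 * \<gamma> is demanded by \<open>touching_bound\<close>. With 2 / (\<epsilon>
    c) the exponent q a, at least \<epsilon> c K d / 2, reaches d, and exp(-d) beats 2^d because ln
    2 < 1.\<close>
  define K where "K = 36 * \<gamma> + 2 / (\<epsilon> * c)"
  have "0 < 2 / (\<epsilon> * c)" using e c by simp
  then have K: "0 < K" "36 * \<gamma> \<le> K" "2 / (\<epsilon> * c) \<le> K" using \<gamma> unfolding K_def by linarith+
  \<comment> \<open>The constant of d^2 in q^8 s / spread: (\<epsilon>/2)^8 comes from q \<ge>
    \<epsilon> / (2 d), and 2^9 from \<open>spread\<close> with d + 1 \<le> 2 d.\<close>
  define C where "C = (\<epsilon> / 2) ^ 8 * c / 2 ^ 9"
  have C: "0 < C" using e c by (simp add: C_def)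
  define f :: "nat \<Rightarrow> real" where "f d = exp (ln 2 * d + (K * d + 1) * ln ((K + 2) * d * d) - c * d * d) * (K * d + 2)
     + exp (ln 2 * d - c * d * d) + exp (- ((1 - ln 2) * d)) + (exp (exp (ln 2 * d - C * d * d)) - 1)" for d
  have lim: "f \<longlonglongrightarrow> 0"
    unfolding f_def by (rule error_terms_tendsto_0) (use K(1) c C ln_2_less_1 in auto)
  have "\<forall>\<^sub>F d in sequentially. sprob (cube {} {..<d}) ((1 + \<epsilon>) / real d) (\<lambda>R. \<not> unique_above ((K + 1) * real d) R) \<le> f d"
  proof -
    have "\<forall>\<^sub>F d in sequentially. 4 * (K * real d + 2) \<le> real d ^ 2" using K(1) by real_asymp
    then show ?thesis
      using eventually_ge_at_top[of "max D 4"]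
    proof eventually_elim
      case (elim d)
      define J where "J = {..<d}"
      have J: "finite J" "J \<noteq> {}" "card J = d" using elim(2) by (auto simp: J_def lessThan_empty_iff bot_nat_def)
      have d4: "4 \<le> real d" using elim(2) by simp
      define p1 where "p1 = (1 + \<epsilon> / 2) / real d"
      define p where "p = (1 + \<epsilon>) / real d"
      \<comment> \<open>Solves p = p1 + q - p1 * q, so that the two rounds together have density
        exactly p.\<close>
      define q where "q = (p - p1) / (1 - p1)"
      have p1: "0 \<le> p1" "p1 < 1" "p1 * real d = 1 + \<epsilon> / 2" using e d4 by (auto simp: p1_def field_simps)
      have p: "p \<le> 1" "p - p1 = \<epsilon> / (2 * real d)" using e d4 by (auto simp: p_def p1_def field_simps)
      have "q * (1 - p1) = p - p1" using p1(2) by (simp add: q_def)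
      then have pq: "p = p1 + q - p1 * q" by (simp add: algebra_simps)
      have pos: "0 < 1 - p1" using p1(2) by simp
      have q1: "q \<le> 1" unfolding q_def pos_divide_le_eq[OF pos] using p(1) by simp
      have qe: "\<epsilon> / (2 * real d) \<le> q"
      proof -
        have "\<epsilon> / (2 * real d) * (1 - p1) \<le> \<epsilon> / (2 * real d) * 1" using p1 e d4 by (intro mult_left_mono) auto
        then show ?thesis unfolding q_def pos_le_divide_eq[OF pos] p(2) by simp
      qed
      have "0 \<le> \<epsilon> / (2 * real d)" using e by simp
      then have q0: "0 \<le> q" using qe by linarith
      define k where "k = nat \<lceil>K * real d\<rceil>"
      have "0 \<le> K * real d" using K by simp
      then have k: "K * real d \<le> real k" "real k \<le> K * real d + 1" unfolding k_def by linarith+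
      \<comment> \<open>Rounding K d up to an integer is absorbed by enlarging K to K + 1.\<close>
      have m: "real k \<le> (K + 1) * real d" using k d4 by (simp add: algebra_simps)
      let ?s = "c * real d ^ 19"
      have s: "0 < ?s" using c d4 by simp
      define a where "a = c * real (Suc k) * real d"
      have "36 * \<gamma> * real d \<le> K * real d" using K d4 by (intro mult_right_mono) auto
      then have g36: "36 * \<gamma> * real d \<le> real (Suc k)" using k by simp
      have "real (4 * Suc k) \<le> real (d\<^sup>2)" using elim(1) k by simp
      then have k4: "4 * Suc k \<le> d\<^sup>2" unfolding of_nat_le_iff .
      have t12: "sprob (cube {} J) p1 (untouched {} J k ?s a)
        \<le> 2 ^ d * (real (Suc k) * real d) ^ k * real (Suc k) * exp (- (c * real d * real d))
          + 2 ^ d * exp (- (c * real d * real d))"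
        using H[unfolded touching_bound_def, rule_format, of J p1 k "{}"] J p1 elim(2) g36 k4
        unfolding a_def by simp
      have "sprob (cube {} J) p (\<lambda>R. \<not> unique_above ((K + 1) * real d) R) \<le>
         (2 ^ d * (real (Suc k) * real d) ^ k * real (Suc k) * exp (- (c * real d * real d))
          + 2 ^ d * exp (- (c * real d * real d)))
        + (2 ^ d * exp (- q * a) + (exp (2 ^ d * exp (- (q ^ 8 * (?s / (2 * real d * real (Suc d) ^ 8))))) - 1))"
        using order_trans[OF two_round_bound[OF J(1,2) p1(1) less_imp_le[OF p1(2)] q0 q1 s m, of "{}" a]
            add_right_mono[OF t12]] unfolding pq J(3) .
      also have "\<dots> \<le> f d"
      proof -
        have two: "(2::real) ^ d = exp (ln 2 * real d)"
          by (simp add: exp_of_nat_mult mult.commute[of "ln 2"] del: exp_of_nat_mult) (simp add: exp_of_nat_mult)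
        have 1: "2 ^ d * (real (Suc k) * real d) ^ k * real (Suc k) * exp (- (c * real d * real d)) \<le>
          exp (ln 2 * d + (K * d + 1) * ln ((K + 2) * d * d) - c * d * d) * (K * d + 2)"
        proof -
          have kk: "real (Suc k) \<le> K * d + 2" using k by simp
          have "K * d + 2 \<le> (K + 2) * d" using d4 by (simp add: algebra_simps)
          then have b: "real (Suc k) * real d \<le> (K + 2) * d * d"
            using kk by (intro mult_right_mono) auto
          have "1 \<le> real (Suc k) * real d" using d4 mult_mono[of 1 "real (Suc k)" 1 "real d"] by simp
          then have b1: "1 \<le> (K + 2) * d * d" using b by linarith
          have "(real (Suc k) * real d) ^ k \<le> ((K + 2) * d * d) ^ k" using b by (intro power_mono) auto
          also have "\<dots> = exp (real k * ln ((K + 2) * d * d))" using b1 by (simp add: exp_of_nat_mult)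
          also have "\<dots> \<le> exp ((K * d + 1) * ln ((K + 2) * d * d))"
            using k(2) ln_ge_zero[OF b1] by (simp add: mult_right_mono)
          finally have pw: "(real (Suc k) * real d) ^ k \<le> exp ((K * d + 1) * ln ((K + 2) * d * d))" .
          have "2 ^ d * (real (Suc k) * real d) ^ k * real (Suc k) * exp (- (c * real d * real d)) \<le>
            exp (ln 2 * d) * exp ((K * d + 1) * ln ((K + 2) * d * d)) * (K * d + 2) * exp (- (c * d * d))"
            unfolding two using pw kk K(1) by (intro mult_right_mono mult_mono) auto
          also have "\<dots> = (exp (ln 2 * d) * exp ((K * d + 1) * ln ((K + 2) * d * d)) * exp (- (c * d * d))) * (K * d + 2)"
            by (simp only: mult.assoc mult.commute mult.left_commute)
          also have "\<dots> = exp (ln 2 * d + (K * d + 1) * ln ((K + 2) * d * d) - c * d * d) * (K * d + 2)"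
            by (simp only: exp_add[symmetric] diff_conv_add_uminus)
          finally show ?thesis .
        qed
        have 2: "2 ^ d * exp (- (c * real d * real d)) = exp (ln 2 * d - c * d * d)"
          unfolding two exp_add[symmetric] by simp
        have 3: "2 ^ d * exp (- q * a) \<le> exp (- ((1 - ln 2) * d))"
        proof -
          have "2 \<le> K * (\<epsilon> * c)" using K(3) e c by (simp add: pos_divide_le_eq)
          then have "2 * real d \<le> (K * (\<epsilon> * c)) * real d" by (intro mult_right_mono) auto
          also have "\<dots> = (\<epsilon> * c) * (K * real d)" by simp
          also have "\<dots> \<le> (\<epsilon> * c) * real (Suc k)" using k e c by (intro mult_left_mono) auto
          finally have "real d \<le> \<epsilon> / (2 * real d) * a" using d4 by (simp add: a_def)
          also have "\<dots> \<le> q * a" using qe c by (intro mult_right_mono) (auto simp: a_def)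
          finally have "exp (- q * a) \<le> exp (- real d)" by simp
          then have "2 ^ d * exp (- q * a) \<le> exp (ln 2 * d) * exp (- real d)"
            unfolding two by (intro mult_left_mono) auto
          then show ?thesis by (simp add: exp_add[symmetric] algebra_simps)
        qed
        have 4: "2 ^ d * exp (- (q ^ 8 * (?s / (2 * real d * real (Suc d) ^ 8)))) \<le> exp (ln 2 * d - C * d * d)"
        proof -
          have Sd: "real (Suc d) \<le> 2 * real d" using d4 by simp
          have "C * d * d = (\<epsilon> / (2 * real d)) ^ 8 * (?s / (2 * real d * (2 * real d) ^ 8))"
            using d4 by (simp add: C_def power_divide power_mult_distrib field_simps eval_nat_numeral)
          also have "\<dots> \<le> q ^ 8 * (?s / (2 * real d * real (Suc d) ^ 8))"
            using qe e s d4 Sd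
            by (intro mult_mono power_mono divide_left_mono mult_left_mono mult_pos_pos) auto
          finally have "exp (- (q ^ 8 * (?s / (2 * real d * real (Suc d) ^ 8)))) \<le> exp (- (C * d * d))" by simp
          then have "2 ^ d * exp (- (q ^ 8 * (?s / (2 * real d * real (Suc d) ^ 8)))) \<le> exp (ln 2 * d) * exp (- (C * d * d))"
            unfolding two by (intro mult_left_mono) auto
          then show ?thesis by (simp add: exp_add[symmetric])
        qed
        have 5: "exp (2 ^ d * exp (- (q ^ 8 * (?s / (2 * real d * real (Suc d) ^ 8))))) - 1
            \<le> exp (exp (ln 2 * d - C * d * d)) - 1"
          using 4 by (simp only: diff_right_mono exp_le_cancel_iff)
        show ?thesis
          using add_mono[OF add_mono[OF add_mono[OF 1 eq_refl[OF 2]] 3] 5]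
          unfolding f_def by (simp only: add.assoc)
      qed
      finally show ?case by (simp only: p_def J_def)
    qed
  qed
  moreover have "\<forall>\<^sub>F d in sequentially. 0 \<le> sprob (cube {} {..<d}) ((1 + \<epsilon>) / real d) (\<lambda>R. \<not> unique_above ((K + 1) * real d) R)"
    using eventually_ge_at_top[of 2]
  proof eventually_elim
    case (elim d)
    then have "2 \<le> real d" by simp
    then show ?case using e by (intro sprob_nonneg) (auto simp: field_simps)
  qed
  ultimately have "(\<lambda>d. sprob (cube {} {..<d}) ((1 + \<epsilon>) / real d) (\<lambda>R. \<not> unique_above ((K + 1) * real d) R)) \<longlonglongrightarrow> 0"
    by (intro tendsto_sandwich[OF _ _ tendsto_const lim])
  then show ?thesis using K(1) by (intro exI[of _ "K + 1"]) auto
qed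

section \<open>Components of the hypercube\<close>

lemma pmf_random_subset:
  assumes "finite V" "0 \<le> p" "p \<le> 1" "R \<subseteq> V"
  shows "pmf (random_subset V p) R = p ^ card R * (1 - p) ^ card (V - R)"
proof -
  let ?M = "Pi_pmf V False (\<lambda>_. bernoulli_pmf p)"
  let ?f = "\<lambda>v. v \<in> R"
  have "pmf (random_subset V p) R = measure_pmf.prob ?M ((\<lambda>f. {v\<in>V. f v}) -` {R})"
    by (simp add: random_subset_def pmf_map)
  \<comment> \<open>Functions that are true somewhere outside \<open>V\<close> may also map to
    \<open>R\<close>, but they have mass 0 because the default value is
    \<open>False\<close>.\<close>
  also have "\<dots> = measure_pmf.prob ?M {?f}"
  proof (rule measure_prob_cong_0)
    fix f assume f: "f \<in> (\<lambda>f. {v\<in>V. f v}) -` {R} - {?f}"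
    have "\<exists>x. x \<notin> V \<and> f x \<noteq> False"
    proof (rule ccontr)
      assume "\<not> ?thesis"
      then have "f = ?f" using f by auto
      then show False using f by simp
    qed
    then show "pmf ?M f = 0" by (rule pmf_Pi_outside[OF assms(1)])
  next
    fix f assume "f \<in> {?f} - (\<lambda>f. {v\<in>V. f v}) -` {R}"
    then show "pmf ?M f = 0" using assms(4) by auto
  qed
  also have "\<dots> = (\<Prod>x\<in>V. if x \<in> R then p else 1 - p)"
  proof -
    have "pmf ?M ?f = (\<Prod>x\<in>V. pmf (bernoulli_pmf p) (?f x))"
      by (rule pmf_Pi'[OF assms(1)]) (use assms(4) in auto)
    also have "\<dots> = (\<Prod>x\<in>V. if x \<in> R then p else 1 - p)"
      by (rule prod.cong) (use assms in auto)
    finally show ?thesis by (simp add: measure_pmf_single)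
  qed
  also have "\<dots> = p ^ card R * (1 - p) ^ card (V - R)"
  proof -
    have "V \<inter> {x. x \<in> R} = R" "V \<inter> - {x. x \<in> R} = V - R" using assms(4) by auto
    then show ?thesis by (simp add: prod.If_cases assms(1))
  qed
  finally show ?thesis .
qed

lemma prob_random_subset:
  assumes "finite V" "0 \<le> p" "p \<le> 1"
  shows "measure_pmf.prob (random_subset V p) A = sprob V p (\<lambda>R. R \<in> A)"
proof -
  have "set_pmf (random_subset V p) \<subseteq> Pow V" by (auto simp: random_subset_def)
  then have "measure_pmf.prob (random_subset V p) A = measure_pmf.prob (random_subset V p) (A \<inter> Pow V)"
    by (intro measure_prob_cong_0) (auto simp: set_pmf_iff)
  also have "\<dots> = (\<Sum>R\<in>A \<inter> Pow V. pmf (random_subset V p) R)"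
    by (rule measure_measure_pmf_finite) (simp add: assms(1))
  also have "\<dots> = (\<Sum>R\<in>Pow V. pmf (random_subset V p) R * of_bool (R \<in> A))"
    by (rule sum.mono_neutral_cong_left) (auto simp: assms(1))
  also have "\<dots> = sprob V p (\<lambda>R. R \<in> A)"
    unfolding sprob_def expect_def by (rule sum.cong) (auto simp: pmf_random_subset assms)
  finally show ?thesis .
qed

section \<open>From 0/1 vectors to sets of coordinates\<close>

definition ones :: "nat \<Rightarrow> (nat \<Rightarrow> nat) \<Rightarrow> nat set" where
  "ones d u = {i. i < d \<and> u i = 1}"

lemma hypercube_verts_values:
  assumes "u \<in> hypercube_verts d" "i < d"
  shows "u i = 0 \<or> u i = 1"
  using assms by (auto simp: hypercube_verts_def PiE_def Pi_def)

lemma inj_on_ones: "inj_on (ones d) (hypercube_verts d)"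
proof (rule inj_onI)
  fix u w assume uw: "u \<in> hypercube_verts d" "w \<in> hypercube_verts d" "ones d u = ones d w"
  have "u i = w i" if i: "i < d" for i
  proof -
    have "i \<in> ones d u \<longleftrightarrow> i \<in> ones d w" using uw(3) by simp
    then have "u i = 1 \<longleftrightarrow> w i = 1" using i by (simp add: ones_def)
    then show ?thesis
      using hypercube_verts_values[OF uw(1) i] hypercube_verts_values[OF uw(2) i] by linarith
  qed
  then show "u = w" by (intro PiE_ext[OF uw(1,2)[unfolded hypercube_verts_def]]) simp
qed

lemma ones_image: "ones d ` hypercube_verts d = cube {} {..<d}"
proof (intro equalityI subsetI)
  fix w assume "w \<in> cube {} {..<d}"
  then have w: "w \<subseteq> {..<d}" by (auto simp: cube_def)
  let ?u = "restrict (\<lambda>i. of_bool (i \<in> w)) {..<d}"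
  have "?u \<in> hypercube_verts d" by (auto simp: hypercube_verts_def)
  moreover have "ones d ?u = w" using w by (auto simp: ones_def)
  ultimately show "w \<in> ones d ` hypercube_verts d" by blast
qed (auto simp: ones_def cube_def)

lemma adj_ones_iff:
  assumes "u \<in> hypercube_verts d" "w \<in> hypercube_verts d"
  shows "adj (ones d u) (ones d w) \<longleftrightarrow> card {i. i < d \<and> u i \<noteq> w i} = 1"
proof -
  have eq: "{i. i < d \<and> u i \<noteq> w i} = {i. (i \<in> ones d u) \<noteq> (i \<in> ones d w)}"
    using hypercube_verts_values[OF assms(1)] hypercube_verts_values[OF assms(2)]
    by (fastforce simp: ones_def)
  have "adj x y \<longleftrightarrow> (\<exists>i. {k. (k \<in> x) \<noteq> (k \<in> y)} = {i})" for x y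
  proof -
    have "y = flip i x \<longleftrightarrow> {k. (k \<in> x) \<noteq> (k \<in> y)} = {i}" for i
      by (auto simp: flip_def set_eq_iff)
    then show ?thesis by (simp add: adj_def)
  qed
  then show ?thesis unfolding eq by (simp add: card_1_singleton_iff)
qed

lemma step_iff:
  assumes "R \<subseteq> hypercube_verts d"
  shows "(u, w) \<in> arcs_ends (with_proj (hypercube d) \<restriction> R) \<longleftrightarrow>
    u \<in> R \<and> w \<in> R \<and> adj (ones d u) (ones d w)"
  using assms adj_ones_iff[of u d w]
  by (auto simp: arcs_ends_def arc_to_ends_def induce_subgraph_def hypercube_def image_iff)

lemma reachable_cluster:
  assumes "R \<subseteq> hypercube_verts d" "u \<rightarrow>\<^sup>*\<^bsub>with_proj (hypercube d) \<restriction> R\<^esub> w"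
  shows "u \<in> R \<and> w \<in> R \<and> ones d w \<in> cluster (ones d ` R) (ones d u)"
  using assms(2) unfolding reachable_def
proof (induction rule: rtrancl_on.induct)
  case (rtrancl_on_refl a)
  then show ?case by simp
next
  case (rtrancl_on_into_rtrancl_on a b c)
  then have "c \<in> R" "adj (ones d b) (ones d c)" using step_iff[OF assms(1), of b c] by auto
  then show ?case
    using rtrancl_on_into_rtrancl_on.IH cluster_step[of "ones d b" "ones d ` R" "ones d a" "ones d c"] by auto
qed

lemma cluster_reachable:
  assumes "R \<subseteq> hypercube_verts d" "u \<in> R" "y \<in> cluster (ones d ` R) (ones d u)"
  shows "\<exists>w\<in>R. y = ones d w \<and> u \<rightarrow>\<^sup>*\<^bsub>with_proj (hypercube d) \<restriction> R\<^esub> w"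
  using assms(3)
proof (induction rule: cluster_induct)
  case refl
  have "u \<rightarrow>\<^sup>*\<^bsub>with_proj (hypercube d) \<restriction> R\<^esub> u"
    unfolding reachable_def by (rule rtrancl_on_refl) (simp add: assms(2))
  then show ?case using assms(2) by blast
next
  case (step y z)
  from step.IH obtain w where w: "w \<in> R" "y = ones d w" "u \<rightarrow>\<^sup>*\<^bsub>with_proj (hypercube d) \<restriction> R\<^esub> w"
    by (elim bexE conjE) (rule that)
  from \<open>z \<in> ones d ` R\<close> obtain w' where w': "w' \<in> R" "z = ones d w'" by (elim imageE) (rule that)
  have arc: "(w, w') \<in> arcs_ends (with_proj (hypercube d) \<restriction> R)"
    using step_iff[OF assms(1), of w w'] w(1,2) w' \<open>adj y z\<close> by simp
  have "u \<rightarrow>\<^sup>*\<^bsub>with_proj (hypercube d) \<restriction> R\<^esub> w'"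
    unfolding reachable_def
    by (rule rtrancl_on_into_rtrancl_on[OF w(3)[unfolded reachable_def] arc]) (simp add: w'(1))
  then show ?case using w' by (intro bexI[of _ w']) simp_all
qed

lemma component_cluster:
  assumes R: "R \<subseteq> hypercube_verts d" and C: "C \<in> graph_components (with_proj (hypercube d) \<restriction> R)"
  obtains u where "u \<in> R" "C \<subseteq> R" "ones d ` C = cluster (ones d ` R) (ones d u)"
proof -
  let ?G = "with_proj (hypercube d) \<restriction> R"
  have scc: "C \<noteq> {}" "\<And>u w. u \<in> C \<Longrightarrow> w \<in> C \<Longrightarrow> u \<rightarrow>\<^sup>*\<^bsub>?G\<^esub> w"
    "\<And>u w. u \<in> C \<Longrightarrow> w \<notin> C \<Longrightarrow> \<not> u \<rightarrow>\<^sup>*\<^bsub>?G\<^esub> w \<or> \<not> w \<rightarrow>\<^sup>*\<^bsub>?G\<^esub> u"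
    using C unfolding graph_components_def pre_digraph.sccs_verts_def by auto
  obtain u where u: "u \<in> C" using scc(1) by blast
  have CR: "w \<in> R" if "w \<in> C" for w using reachable_cluster[OF R scc(2)[OF that that]] by simp
  have "ones d ` C = cluster (ones d ` R) (ones d u)"
  proof (intro equalityI subsetI)
    fix y assume "y \<in> ones d ` C"
    then show "y \<in> cluster (ones d ` R) (ones d u)"
      using reachable_cluster[OF R scc(2)[OF u]] by blast
  next
    fix y assume y: "y \<in> cluster (ones d ` R) (ones d u)"
    obtain w where w: "w \<in> R" "y = ones d w" "u \<rightarrow>\<^sup>*\<^bsub>?G\<^esub> w"
      using cluster_reachable[OF R CR[OF u] y] by blast
    \<comment> \<open>Strong components require a path back as well; it comes from the symmetry of
      clusters.\<close>
    have "ones d u \<in> cluster (ones d ` R) (ones d w)"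
      using cluster_sym[OF _ y] CR[OF u] w(2) by blast
    then obtain u' where u': "u' \<in> R" "ones d u = ones d u'" "w \<rightarrow>\<^sup>*\<^bsub>?G\<^esub> u'"
      using cluster_reachable[OF R w(1)] by blast
    have "u' \<in> hypercube_verts d" "u \<in> hypercube_verts d" using u'(1) CR[OF u] R by blast+
    then have "u' = u" using inj_onD[OF inj_on_ones[of d], of u' u] u'(2) by simp
    then have "w \<in> C" using scc(3)[OF u] w(3) u'(3) by blast
    then show "y \<in> ones d ` C" using w(2) by blast
  qed
  then show ?thesis using that CR u by blast
qed

text \<open>If \<open>C\<close> exceeds the bound, so does \<open>L\<close>, by maximality;
  uniqueness then identifies them. The argument works for any choice of \<open>L\<close> among tied
  components.\<close>

lemma small_components:
  assumes R: "R \<subseteq> hypercube_verts d" and un: "unique_above m (ones d ` R)"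
    and L: "largest_component (with_proj (hypercube d) \<restriction> R) L"
    and C: "C \<in> graph_components (with_proj (hypercube d) \<restriction> R)" "C \<noteq> L"
  shows "real (card C) \<le> m"
proof (rule ccontr)
  assume big: "\<not> real (card C) \<le> m"
  have LG: "L \<in> graph_components (with_proj (hypercube d) \<restriction> R)" and CL: "card C \<le> card L"
    using L C(1) unfolding largest_component_def is_arg_max_def by (auto simp: not_less)
  obtain u where u: "u \<in> R" "C \<subseteq> R" "ones d ` C = cluster (ones d ` R) (ones d u)"
    using component_cluster[OF R C(1)] by metis
  obtain w where w: "w \<in> R" "L \<subseteq> R" "ones d ` L = cluster (ones d ` R) (ones d w)"
    using component_cluster[OF R LG] by metis
  have CV: "C \<subseteq> hypercube_verts d" and LV: "L \<subseteq> hypercube_verts d" using u(2) w(2) R by auto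
  have "card (ones d ` C) = card C" "card (ones d ` L) = card L"
    by (intro card_image inj_on_subset[OF inj_on_ones] CV LV)+
  then have "m < card (cluster (ones d ` R) (ones d u))" "m < card (cluster (ones d ` R) (ones d w))"
    using big CL unfolding u(3)[symmetric] w(3)[symmetric] by linarith+
  then have "ones d ` C = ones d ` L"
    using un u(1) w(1) unfolding u(3) w(3) unique_above_def by blast
  then have "C = L" using inj_on_image_eq_iff[OF inj_on_ones CV LV] by simp
  then show False using C(2) by simp
qed

theorem theorem1:
  shows "\<exists>\<epsilon>\<^sub>0 > (0::real). \<forall>\<epsilon>. 0 < \<epsilon> \<and> \<epsilon> \<le> \<epsilon>\<^sub>0 \<longrightarrow>
    (\<exists>K > (0::real).
      (\<lambda>d. measure_pmf.prob (random_subset (hypercube_verts d) ((1 + \<epsilon>) / real d))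
         {R. \<forall>L. largest_component (with_proj (hypercube d) \<restriction> R) L \<longrightarrow>
               (\<forall>C \<in> graph_components (with_proj (hypercube d) \<restriction> R).
                  C \<noteq> L \<longrightarrow> real (card C) \<le> K * real d)})
      \<longlonglongrightarrow> 1)"
proof (rule exI[of _ 1], intro conjI allI impI)
  fix \<epsilon> :: real assume e: "0 < \<epsilon> \<and> \<epsilon> \<le> 1"
  then obtain K where K: "0 < K" and lim:
    "(\<lambda>d. sprob (cube {} {..<d}) ((1 + \<epsilon>) / real d) (\<lambda>R. \<not> unique_above (K * real d) R)) \<longlonglongrightarrow> 0"
    using unique_above_whp by blast
  let ?good = "\<lambda>K d. {R. \<forall>L. largest_component (with_proj (hypercube d) \<restriction> R) L \<longrightarrow>
               (\<forall>C \<in> graph_components (with_proj (hypercube d) \<restriction> R).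
                  C \<noteq> L \<longrightarrow> real (card C) \<le> K * real d)}"
  let ?P = "\<lambda>K d. measure_pmf.prob (random_subset (hypercube_verts d) ((1 + \<epsilon>) / real d)) (?good K d)"
  let ?Q = "\<lambda>d. sprob (cube {} {..<d}) ((1 + \<epsilon>) / real d) (\<lambda>R. \<not> unique_above (K * real d) R)"
  have "\<forall>\<^sub>F d in sequentially. 1 - ?Q d \<le> ?P K d"
    using eventually_ge_at_top[of 2]
  proof eventually_elim
    case (elim d)
    then have "2 \<le> real d" by simp
    \<comment> \<open>From d = 2 on, \<epsilon> \<le> 1 keeps the density within [0, 1], where
      \<open>bernoulli_pmf\<close> takes its parameter unchanged.\<close>
    then have p: "0 \<le> (1 + \<epsilon>) / real d" "(1 + \<epsilon>) / real d \<le> 1" using e by (auto simp: field_simps)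
    let ?V = "hypercube_verts d"
    have "1 - ?Q d = sprob (ones d ` ?V) ((1 + \<epsilon>) / real d) (unique_above (K * real d))"
      by (simp add: ones_image sprob_not)
    also have "\<dots> = sprob ?V ((1 + \<epsilon>) / real d) (\<lambda>R. unique_above (K * real d) (ones d ` R))"
      unfolding sprob_def by (rule expect_bij[OF inj_on_ones finite_hypercube_verts])
    also have "\<dots> \<le> sprob ?V ((1 + \<epsilon>) / real d)
        (\<lambda>R. R \<in> ?good K d)"
    proof (rule sprob_mono[OF p])
      fix R assume "R \<subseteq> ?V" "unique_above (K * real d) (ones d ` R)"
      then show "R \<in> ?good K d" using small_components by blast
    qed
    also have "\<dots> = ?P K d" by (rule prob_random_subset[OF finite_hypercube_verts p, symmetric])
    finally show ?case .
  qed
  moreover have "\<forall>\<^sub>F d in sequentially. ?P K d \<le> 1" by simp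
  moreover have "(\<lambda>d. 1 - ?Q d) \<longlonglongrightarrow> 1" using tendsto_diff[OF tendsto_const lim] by simp
  ultimately have "?P K \<longlonglongrightarrow> 1" by (rule tendsto_sandwich[OF _ _ _ tendsto_const])
  then show "\<exists>K>0. ?P K \<longlonglongrightarrow> 1" using K by blast
qed simp

end
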